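(* Assume that $D$ is the inside of a convex polyhedron such that, for each vertex $p$ of $D$, in a neighbourhood of $p$ the set $D$ coincides with the inside of a tetrahedron with apex $p$, and the source $F=F_{\rho,D}$ is active at $p$. Then, for all $\omega\in S^2$ regular with respect to $D$ and all $\vartheta\in S(\omega)$, $$\lim_{\tau\to\infty}\frac{\log|I_{\omega,\vartheta}(\tau)|}{\tau}=h_D(\omega);$$ $$\lim_{\tau\to\infty}\frac{I'_{\omega,\vartheta}(\tau)}{I_{\omega,\vartheta}(\tau)}=h_D(\omega)+i\,p(\omega)\cdot\vartheta;$$ $$\lim_{\tau\to\infty}e^{-\tau t}|I_{\omega,\vartheta}(\tau)|=\begin{cases}0,&\text{if } t\ge h_D(\omega),\\ \infty,&\text{if } t<h_D(\omega).\end{cases}$$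
   Context: Setting. $\Omega\subset\mathbb R^3$ is a bounded domain with $C^2$ boundary and outward unit normal $\nu$; $k\ge 0$. $D$ is a nonempty open set with $\overline D\subset\Omega$, $\rho\in L^2(D)$ is complex-valued, and $F=F_{\rho,D}$ equals $\rho$ on $D$ and $0$ on $\Omega\setminus D$. $u\in H^1(\Omega)$ (complex-valued) is an arbitrary weak solution of $\Delta u+k^2u=F$ in $\Omega$ (no boundary condition is prescribed). The normal derivative $\partial u/\partial\nu\in H^{-1/2}(\partial\Omega)$ is defined weakly by $\langle \partial u/\partial\nu,g|_{\partial\Omega}\rangle=\int_\Omega(\nabla u\cdot\nabla g-k^2ug+Fg)\,dx$ for $g\in H^1(\Omega)$, and boundary integrals containing it are understood as this pairing. For $\omega\in S^2$, $S(\omega)=\{\vartheta\in S^2:\omega\cdot\vartheta=0\}$. For $\vartheta\in S(\omega)$, $\tau>0$, put $v=e^{x\cdot(\tau\omega+i\sqrt{\tau^2+k^2}\,\vartheta)}$ (bilinear dot product), $v_\tau=\partial_\tau v=\{x\cdot(\omega+i\frac{\tau}{\sqrt{\tau^2+k^2}}\vartheta)\}v$, and $$I_{\omega,\vartheta}(\tau)=\int_{\partial\Omega}\Bigl(\frac{\partial u}{\partial\nu}v-\frac{\partial v}{\partial\nu}u\Bigr)dS,\qquad I'_{\omega,\vartheta}(\tau)=\int_{\partial\Omega}\Bigl(\frac{\partial u}{\partial\nu}v_\tau-\frac{\partial v_\tau}{\partial\nu}u\Bigr)dS.$$ $h_D(\omega)=\sup_{x\in D}x\cdot\omega$. $\omega$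 is regular with respect to $D$ if $\{x\in\overline D: x\cdot\omega=h_D(\omega)\}$ is a single point, denoted $p(\omega)$. $F_{\rho,D}$ is active at a point $p\in\partial D$ if there exist an open ball $B_\eta(p)$ centered at $p$ with radius $\eta>0$, $0<\alpha\le1$ and a (complex-valued) $\tilde\rho\in C^{0,\alpha}(\overline{B_\eta(p)})$ such that $\rho=\tilde\rho$ almost everywhere on $B_\eta(p)\cap D$ and $\tilde\rho(p)\ne0$. *)

theory Defs
  imports "HOL-Analysis.Analysis"
begin

section \<open>Regularity and smooth boundaries\<close>

(* f is of class C^n on the open set U.  All directional derivatives are iterated, which in
   finite dimension is the usual notion. *)
primrec Ck_on :: "nat \<Rightarrow> 'a::euclidean_space set \<Rightarrow> ('a \<Rightarrow> 'b::real_normed_vector) \<Rightarrow> bool" where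
  "Ck_on 0 U f \<longleftrightarrow> continuous_on U f"
| "Ck_on (Suc n) U f \<longleftrightarrow>
     (\<forall>x\<in>U. f differentiable (at x)) \<and> (\<forall>v. Ck_on n U (\<lambda>x. frechet_derivative f (at x) v))"

(* Near each boundary point, after a linear isometric change of coordinates A, the set is the
   region strictly above the graph of a C^n function. *)
definition Ck_boundary :: "nat \<Rightarrow> (real^3) set \<Rightarrow> bool" where
  "Ck_boundary n \<Omega> \<longleftrightarrow>
     (\<forall>p\<in>frontier \<Omega>. \<exists>r>0. \<exists>(A :: real^3 \<Rightarrow> real^3) (\<gamma> :: real^2 \<Rightarrow> real).
        orthogonal_transformation A \<and> Ck_on n UNIV \<gamma> \<and>
        \<Omega> \<inter> ball p r = {x \<in> ball p r. \<gamma> (vector [A x $ 1, A x $ 2]) < A x $ 3})"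

(* The unit vector n for which \<Omega> agrees to first order at x with the half-space
   {y. (y - x) \<bullet> n < 0}.  It is unique, and it exists at every point of a C^1 boundary. *)
definition outward_normal :: "(real^3) set \<Rightarrow> real^3 \<Rightarrow> real^3" where
  "outward_normal \<Omega> x =
     (THE n. norm n = 1 \<and>
        (\<forall>\<epsilon>>0. \<forall>\<^sub>F y in at x.
           ((y - x) \<bullet> n < - \<epsilon> * norm (y - x) \<longrightarrow> y \<in> \<Omega>) \<and>
           ((y - x) \<bullet> n > \<epsilon> * norm (y - x) \<longrightarrow> y \<notin> \<Omega>)))"

(* S is the surface measure dS of the C^1 surface \<Sigma>: it is carried by \<Sigma> and has density
   |d_1 \<phi> x d_2 \<phi>| in every regular local parametrization \<phi>.  For a surface that is locally a
   C^1 graph there is exactly one such Borel measure. *)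
definition surface_measure_on :: "(real^3) set \<Rightarrow> (real^3) measure \<Rightarrow> bool" where
  "surface_measure_on \<Sigma> S \<longleftrightarrow>
     sets S = sets borel \<and> emeasure S (- \<Sigma>) = 0 \<and>
     (\<forall>(\<phi> :: real^2 \<Rightarrow> real^3) U B.
        open U \<and> Ck_on 1 U \<phi> \<and> inj_on \<phi> U \<and> (\<forall>y\<in>U. inj (frechet_derivative \<phi> (at y))) \<and>
        \<phi> ` U \<subseteq> \<Sigma> \<and> B \<in> sets borel \<and> B \<subseteq> U \<longrightarrow>
        emeasure S (\<phi> ` B) =
          (\<integral>\<^sup>+y\<in>B. ennreal (norm (cross3 (frechet_derivative \<phi> (at y) (axis 1 1))
                                      (frechet_derivative \<phi> (at y) (axis 2 1)))) \<partial>lborel))"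

section \<open>Sobolev functions\<close>

definition L2 :: "'a measure \<Rightarrow> ('a \<Rightarrow> 'b::{real_normed_vector, second_countable_topology}) \<Rightarrow> bool" where
  "L2 M f \<longleftrightarrow> f \<in> borel_measurable M \<and> integrable M (\<lambda>x. (norm (f x))\<^sup>2)"

definition grad :: "(real^3 \<Rightarrow> complex) \<Rightarrow> real^3 \<Rightarrow> complex^3" where
  "grad f x = (\<chi> j. frechet_derivative f (at x) (axis j 1))"

(* bilinear, without complex conjugation *)
definition cdot :: "complex^3 \<Rightarrow> complex^3 \<Rightarrow> complex" where
  "cdot a b = (\<Sum>j\<in>UNIV. a $ j * b $ j)"

definition test_function :: "(real^3) set \<Rightarrow> (real^3 \<Rightarrow> complex) \<Rightarrow> bool" where
  "test_function \<Omega> \<phi> \<longleftrightarrow>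
     (\<forall>n. Ck_on n UNIV \<phi>) \<and> compact (closure {x. \<phi> x \<noteq> 0}) \<and> closure {x. \<phi> x \<noteq> 0} \<subseteq> \<Omega>"

(* u belongs to H^1(\<Omega>) and g is its weak gradient (determined by u almost everywhere) *)
definition H1 :: "(real^3) set \<Rightarrow> (real^3 \<Rightarrow> complex) \<Rightarrow> (real^3 \<Rightarrow> complex^3) \<Rightarrow> bool" where
  "H1 \<Omega> u g \<longleftrightarrow>
     L2 (lebesgue_on \<Omega>) u \<and> L2 (lebesgue_on \<Omega>) g \<and>
     (\<forall>\<phi> j. test_function \<Omega> \<phi> \<longrightarrow>
        (\<integral>x. u x * grad \<phi> x $ j \<partial>lebesgue_on \<Omega>) = - (\<integral>x. g x $ j * \<phi> x \<partial>lebesgue_on \<Omega>))"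

(* T is the trace on the boundary, with surface measure S, of the H^1(\<Omega>) function u with weak
   gradient g: the L^2 limit of the boundary values of C^1 functions approximating u in H^1(\<Omega>).
   On a bounded C^1 domain every u in H^1(\<Omega>) has a trace, unique up to S-null sets. *)
definition boundary_trace ::
  "(real^3) set \<Rightarrow> (real^3) measure \<Rightarrow> (real^3 \<Rightarrow> complex) \<Rightarrow> (real^3 \<Rightarrow> complex^3) \<Rightarrow>
   (real^3 \<Rightarrow> complex) \<Rightarrow> bool" where
  "boundary_trace \<Omega> S u g T \<longleftrightarrow>
     L2 S T \<and>
     (\<exists>\<phi> :: nat \<Rightarrow> real^3 \<Rightarrow> complex.
        (\<forall>n. Ck_on 1 UNIV (\<phi> n)) \<and>
        (\<lambda>n. \<integral>\<^sup>+x. ennreal ((norm (\<phi> n x - u x))\<^sup>2 + (norm (grad (\<phi> n) x - g x))\<^sup>2)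
             \<partial>lebesgue_on \<Omega>) \<longlonglongrightarrow> 0 \<and>
        (\<lambda>n. \<integral>\<^sup>+x. ennreal ((norm (\<phi> n x - T x))\<^sup>2) \<partial>S) \<longlonglongrightarrow> 0)"

section \<open>Weak solutions and the indicator function\<close>

(* For w in H^1(\<Omega>) with gradient Dw and u a weak solution, this is by definition the pairing of
   the weak normal derivative of u, an element of H^{-1/2}, with the trace of w. *)
definition normal_derivative_pairing ::
  "(real^3) set \<Rightarrow> real \<Rightarrow> (real^3 \<Rightarrow> complex) \<Rightarrow> (real^3 \<Rightarrow> complex) \<Rightarrow> (real^3 \<Rightarrow> complex^3) \<Rightarrow>
   (real^3 \<Rightarrow> complex) \<Rightarrow> (real^3 \<Rightarrow> complex^3) \<Rightarrow> complex" where
  "normal_derivative_pairing \<Omega> k F u Du w Dw =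
     (\<integral>x. (cdot (Du x) (Dw x) - of_real (k\<^sup>2) * u x * w x + F x * w x) \<partial>lebesgue_on \<Omega>)"

(* \<Delta> u + k^2 u = F in \<Omega>, tested against compactly supported smooth functions *)
definition weak_solution ::
  "(real^3) set \<Rightarrow> real \<Rightarrow> (real^3 \<Rightarrow> complex) \<Rightarrow> (real^3 \<Rightarrow> complex) \<Rightarrow> (real^3 \<Rightarrow> complex^3) \<Rightarrow> bool"
  where
  "weak_solution \<Omega> k F u Du \<longleftrightarrow>
     H1 \<Omega> u Du \<and>
     (\<forall>\<phi>. test_function \<Omega> \<phi> \<longrightarrow>
        (\<integral>x. (- cdot (Du x) (grad \<phi> x) + of_real (k\<^sup>2) * u x * \<phi> x) \<partial>lebesgue_on \<Omega>)
        = (\<integral>x. F x * \<phi> x \<partial>lebesgue_on \<Omega>))"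

definition source :: "(real^3 \<Rightarrow> complex) \<Rightarrow> (real^3) set \<Rightarrow> real^3 \<Rightarrow> complex" where
  "source \<rho> D x = (if x \<in> D then \<rho> x else 0)"

(* The boundary integral of (du/d\<nu>) w - (dw/d\<nu>) u for w smooth near the closure of \<Omega>; T is the
   trace of u and S the surface measure. *)
definition boundary_indicator ::
  "(real^3) set \<Rightarrow> (real^3) measure \<Rightarrow> real \<Rightarrow> (real^3 \<Rightarrow> complex) \<Rightarrow> (real^3 \<Rightarrow> complex) \<Rightarrow>
   (real^3 \<Rightarrow> complex^3) \<Rightarrow> (real^3 \<Rightarrow> complex) \<Rightarrow> (real^3 \<Rightarrow> complex) \<Rightarrow> complex" where
  "boundary_indicator \<Omega> S k F u Du T w =
     normal_derivative_pairing \<Omega> k F u Du w (grad w)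
     - (\<integral>x. frechet_derivative w (at x) (outward_normal \<Omega> x) * T x \<partial>S)"

definition exp_solution :: "real \<Rightarrow> real^3 \<Rightarrow> real^3 \<Rightarrow> real \<Rightarrow> real^3 \<Rightarrow> complex" where
  "exp_solution k \<omega> \<theta> \<tau> x =
     exp (of_real (\<tau> * (x \<bullet> \<omega>)) + \<i> * of_real (sqrt (\<tau>\<^sup>2 + k\<^sup>2) * (x \<bullet> \<theta>)))"

definition exp_solution_deriv :: "real \<Rightarrow> real^3 \<Rightarrow> real^3 \<Rightarrow> real \<Rightarrow> real^3 \<Rightarrow> complex" where
  "exp_solution_deriv k \<omega> \<theta> \<tau> x =
     (of_real (x \<bullet> \<omega>) + \<i> * of_real (\<tau> / sqrt (\<tau>\<^sup>2 + k\<^sup>2) * (x \<bullet> \<theta>))) * exp_solution k \<omega> \<theta> \<tau> x"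

lemma exp_solution_deriv:
  assumes "\<tau> > 0"
  shows "((\<lambda>s. exp_solution k \<omega> \<theta> s x) has_vector_derivative exp_solution_deriv k \<omega> \<theta> \<tau> x) (at \<tau>)"
proof -
  have pos: "\<tau>\<^sup>2 + k\<^sup>2 > 0"
    using assms by (simp add: add_pos_nonneg)
  have sq: "((\<lambda>s. sqrt (s\<^sup>2 + k\<^sup>2)) has_real_derivative \<tau> / sqrt (\<tau>\<^sup>2 + k\<^sup>2)) (at \<tau>)"
    using pos by (auto intro!: derivative_eq_intros simp: field_simps)
  have 1: "((\<lambda>s. complex_of_real (s * (x \<bullet> \<omega>))) has_vector_derivative of_real (x \<bullet> \<omega>)) (at \<tau>)"
    by (rule has_vector_derivative_of_real) (auto intro!: derivative_eq_intros)
  have 2: "((\<lambda>s. complex_of_real (sqrt (s\<^sup>2 + k\<^sup>2) * (x \<bullet> \<theta>))) has_vector_derivative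
            of_real (\<tau> / sqrt (\<tau>\<^sup>2 + k\<^sup>2) * (x \<bullet> \<theta>))) (at \<tau>)"
    by (rule has_vector_derivative_of_real) (rule DERIV_cmult_right[OF sq])
  have 3: "((\<lambda>s. complex_of_real (s * (x \<bullet> \<omega>)) + \<i> * of_real (sqrt (s\<^sup>2 + k\<^sup>2) * (x \<bullet> \<theta>)))
            has_vector_derivative
            of_real (x \<bullet> \<omega>) + \<i> * of_real (\<tau> / sqrt (\<tau>\<^sup>2 + k\<^sup>2) * (x \<bullet> \<theta>))) (at \<tau>)"
    by (intro has_vector_derivative_add 1 has_vector_derivative_mult_right 2)
  show ?thesis
    using field_vector_diff_chain_at[OF 3 DERIV_exp]
    by (simp add: o_def exp_solution_def exp_solution_deriv_def)
qed

section \<open>Geometry of the support of the source\<close>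

definition support_fun :: "(real^3) set \<Rightarrow> real^3 \<Rightarrow> real" where
  "support_fun D \<omega> = (SUP x\<in>D. x \<bullet> \<omega>)"

definition contact_set :: "(real^3) set \<Rightarrow> real^3 \<Rightarrow> (real^3) set" where
  "contact_set D \<omega> = {x \<in> closure D. x \<bullet> \<omega> = support_fun D \<omega>}"

definition regular_direction :: "(real^3) set \<Rightarrow> real^3 \<Rightarrow> bool" where
  "regular_direction D \<omega> \<longleftrightarrow> is_singleton (contact_set D \<omega>)"

definition contact_point :: "(real^3) set \<Rightarrow> real^3 \<Rightarrow> real^3" where
  "contact_point D \<omega> = the_elem (contact_set D \<omega>)"

definition source_active_at :: "(real^3 \<Rightarrow> complex) \<Rightarrow> (real^3) set \<Rightarrow> real^3 \<Rightarrow> bool" where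
  "source_active_at \<rho> D p \<longleftrightarrow>
     p \<in> frontier D \<and>
     (\<exists>\<eta>>0. \<exists>\<alpha>>0. \<alpha> \<le> 1 \<and> (\<exists>(\<rho>' :: real^3 \<Rightarrow> complex) C.
        (\<forall>x\<in>cball p \<eta>. \<forall>y\<in>cball p \<eta>. norm (\<rho>' x - \<rho>' y) \<le> C * dist x y powr \<alpha>) \<and>
        (AE x in lebesgue. x \<in> ball p \<eta> \<inter> D \<longrightarrow> \<rho> x = \<rho>' x) \<and>
        \<rho>' p \<noteq> 0))"

definition locally_tetrahedral_at :: "(real^3) set \<Rightarrow> real^3 \<Rightarrow> bool" where
  "locally_tetrahedral_at D p \<longleftrightarrow>
     (\<exists>\<eta>>0. \<exists>K. 3 simplex K \<and> p extreme_point_of K \<and> D \<inter> ball p \<eta> = interior K \<inter> ball p \<eta>)"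

end

theory Submission
  imports Defs
begin

text \<open>
  Green's formula turns the boundary integral into a volume integral: the exponential solution \<open>v\<close>
  and its \<open>\<tau>\<close>-derivative solve the Helmholtz equation, so both indicator functions equal
  \<open>\<integral>\<^sub>D \<rho> w dx\<close> with \<open>w = v\<close> or \<open>w = \<partial>v/\<partial>\<tau>\<close>.  This needs the divergence theorem for \<open>C\<^sup>1\<close>
  functions on \<open>\<Omega>\<close>, which passes to traces because a trace is an \<open>L\<^sup>2\<close> limit of boundary values.
  Near the boundary the divergence theorem is proved by flattening the graph with a shear and
  integrating along the two kinds of coordinate lines.

  A regular direction touches the polyhedron in one vertex \<open>p\<close>, where \<open>D\<close> is a cone \<open>p + L(s)\<close>,
  \<open>s > 0\<close>.  Points away from \<open>p\<close> contribute an exponentially smaller amount.  In the cone the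
  substitution \<open>x = p + L(s)/\<tau>\<close> gives, by dominated convergence,
  \<open>\<tau>\<^sup>3 I(\<tau>) / v(p) \<longlonglongrightarrow> c \<rho>(p) \<integral> exp(L(s) \<bullet> (\<omega> + i\<theta>)) ds\<close>, and the last integral over the octant is a
  product of three one-dimensional integrals \<open>- 1 / \<lambda>\<close>, hence nonzero.  For \<open>I'\<close> the limit carries the
  additional factor \<open>p \<bullet> (\<omega> + i\<theta>)\<close>.
\<close>

section \<open>Lebesgue measure under linear maps and shears\<close>

text \<open>The pairing that defines the weak normal derivative already contains the source term, so
  every second derivative can be put on the smooth test function: what remains is Green's identity
  for a pair (\<open>u\<close>, \<open>Du\<close>) with trace \<open>T\<close> and a
  \<open>C^1\<close> field of prescribed divergence. Two obstacles shape the measure theory. The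
  surface measure is known only through the sizes of parametrized pieces, and the normal only
  through a first-order condition under a definite description; both have to be computed in a graph
  chart before a boundary integral can be evaluated. The chart is flattened by a shear, since
  invariance of volume under a shear is Tonelli plus translation and involves no derivative of the
  graph. At the vertex, uniqueness of the maximizer makes \<open>x \<bullet> \<omega>\<close>
  strictly decrease along each edge; this gives the numbers \<open>\<lambda>\<close> of the octant
  integral negative real parts, whatever \<theta> is. The power \<open>\<tau>^3\<close> comes from
  the dimension. It is invisible to the logarithm and cancels in the quotient, but it decides the
  borderline case in which \<open>t\<close> equals the support value: there the decay is only
  polynomial.\<close>

lemma Basis_vec_eq_axis: "(Basis :: (real^'n) set) = (\<lambda>i. axis i 1) ` UNIV"
  by (auto simp: Basis_vec_def)

lemma prod_Basis_vec: "(\<Prod>b\<in>(Basis :: (real^'n) set). g b) = (\<Prod>i\<in>UNIV. g (axis i 1))"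
  unfolding Basis_vec_eq_axis by (subst prod.reindex) (auto simp: inj_on_def axis_eq_axis)

lemma emeasure_lborel_box_cart:
  fixes l u :: "real^'n"
  assumes "\<And>i. l $ i \<le> u $ i"
  shows "emeasure lborel (box l u) = ennreal (\<Prod>i\<in>UNIV. u $ i - l $ i)"
proof -
  have "emeasure lborel (box l u) = ennreal (\<Prod>b\<in>Basis. (u - l) \<bullet> b)"
    using assms by (intro emeasure_lborel_box) (auto simp: Basis_vec_def inner_axis)
  then show ?thesis
    by (simp only: prod_Basis_vec) (simp add: inner_axis)
qed

text \<open>A linear bijection scales volume by a constant. Here \<open>c\<close> is the reciprocal
  of the absolute determinant of the left inverse \<open>L'\<close>, that is, the absolute
  determinant of \<open>L\<close>; only its positivity is exposed.\<close>

lemma lborel_linear_image: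
  fixes L :: "real^'n::{finite,wellorder} \<Rightarrow> real^'n::_"
  assumes "linear L" "inj L"
  obtains c where "c > 0" "lborel = density (distr lborel borel L) (\<lambda>_. ennreal c)"
proof -
  obtain L' where L': "linear L'" "L' \<circ> L = id"
    using linear_injective_left_inverse[OF assms] by blast
  then have L'2: "L \<circ> L' = id"
    using assms linear_inverse_left by blast
  have injL': "inj L'"
    using L'2 by (metis inj_on_id inj_on_imageI2)
  define d where "d = \<bar>det (matrix L')\<bar>"
  have d: "d > 0"
    using injL' L'(1) det_nz_iff_inj d_def by auto
  have [measurable]: "L \<in> borel_measurable borel"
    using assms(1) by (intro borel_measurable_continuous_onI linear_continuous_on linear_linear[THEN iffD2]
        linear_conv_bounded_linear[THEN iffD1])
  have "lborel = density (distr lborel borel L) (\<lambda>_. ennreal (1/d))"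
  proof (rule lborel_eqI)
    fix l u :: "real^'n::_" assume lu: "\<And>b. b \<in> Basis \<Longrightarrow> l \<bullet> b \<le> u \<bullet> b"
    have eq: "L -` box l u = L' ` box l u"
    proof -
      have "L (L' x) = x" "L' (L x) = x" for x
        using L'(2) L'2 by (metis comp_apply id_apply)+
      then show ?thesis by (intro set_eqI) (metis image_iff vimage_eq)
    qed
    have m: "L' ` box l u \<in> lmeasurable" "measure lebesgue (L' ` box l u) = d * measure lebesgue (box l u)"
      using measurable_linear_image[OF L'(1), of "box l u"] measure_linear_image[OF L'(1), of "box l u"] d_def
      by auto
    have b: "L' ` box l u \<in> sets borel"
      unfolding eq[symmetric] using measurable_sets[of L borel borel "box l u"] by simp
    have "emeasure lborel (L' ` box l u) = ennreal (d * measure lborel (box l u))"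
    proof -
      have "emeasure lborel (L' ` box l u) = emeasure lebesgue (L' ` box l u)"
        using b by (simp add: emeasure_completion)
      also have "\<dots> = ennreal (measure lebesgue (L' ` box l u))"
        using fmeasurableD2[OF m(1)] by (rule emeasure_eq_ennreal_measure)
      finally show ?thesis using m(2) by (simp add: measure_completion)
    qed
    then have "emeasure (density (distr lborel borel L) (\<lambda>_. ennreal (1/d))) (box l u)
       = ennreal (1/d) * ennreal (d * measure lborel (box l u))"
      by (simp add: emeasure_density_const emeasure_distr eq b)
    also have "\<dots> = ennreal (measure lborel (box l u))"
      using d by (simp add: ennreal_mult[symmetric])
    finally show "emeasure (density (distr lborel borel L) (\<lambda>_. ennreal (1/d))) (box l u)
       = ennreal (\<Prod>b\<in>Basis. (u - l) \<bullet> b)"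
      using lu by (simp add: measure_lborel_box_eq)
  qed simp
  then show ?thesis using d by (intro that[of "1/d"]) auto
qed

text \<open>The unit ball is its own preimage and has finite positive volume, which forces the
  scaling constant of the linear image to be 1.\<close>

lemma lborel_distr_orthogonal:
  fixes L :: "real^'n::{finite,wellorder} \<Rightarrow> real^'n::{finite,wellorder}"
  assumes "orthogonal_transformation L"
  shows "distr lborel borel L = lborel"
proof -
  have lin: "linear L" and inj: "inj L"
    using assms orthogonal_transformation_linear orthogonal_transformation_inj by blast+
  obtain c where c: "c > 0" "lborel = density (distr lborel borel L) (\<lambda>_. ennreal c)"
    using lborel_linear_image[OF lin inj] by blast
  have [measurable]: "L \<in> borel_measurable borel"
    using lin by (intro borel_measurable_continuous_onI linear_continuous_on linear_conv_bounded_linear[THEN iffD1])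
  have ball: "L -` ball 0 1 = ball 0 1"
    using assms by (auto simp: orthogonal_transformation_norm)
  have "emeasure lborel (ball 0 1 :: (real^'n::{finite,wellorder}) set) = ennreal c * emeasure lborel (ball 0 1 :: (real^'n::{finite,wellorder}) set)"
    by (subst c(2)) (simp add: emeasure_density_const emeasure_distr ball)
  moreover have "emeasure lborel (ball 0 1 :: (real^'n::{finite,wellorder}) set) = ennreal (measure lborel (ball 0 1 :: (real^'n::{finite,wellorder}) set))"
    by (metis emeasure_bounded_finite bounded_ball emeasure_eq_ennreal_measure infinity_ennreal_def less_irrefl)
  moreover have "measure lborel (ball 0 1 :: (real^'n::{finite,wellorder}) set) > 0"
    using content_ball_pos[of 1 "0::real^'n::{finite,wellorder}"] by (simp add: measure_completion)
  ultimately have "c = 1"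
    using c(1) by (simp add: ennreal_mult[symmetric] ennreal_inj)
  then show ?thesis using c by (simp add: density_1)
qed

definition lift3 :: "real^2 \<Rightarrow> real \<Rightarrow> real^3" where
  "lift3 y s = vector [y $ 1, y $ 2, s]"

lemma lift3_nth [simp]: "lift3 y s $ 1 = y $ 1" "lift3 y s $ 2 = y $ 2" "lift3 y s $ 3 = s"
  by (auto simp: lift3_def)

lemma lift3_cover: "lift3 (vector [x $ 1, x $ 2]) (x $ 3) = x"
  by (simp add: vec_eq_iff forall_3 lift3_def)

lemma bounded_linear_lift3: "bounded_linear (\<lambda>(y, s). lift3 y s)"
  by (intro linear_conv_bounded_linear[THEN iffD1] linearI) 
    (auto simp: vec_eq_iff forall_3)

lemma inner_lift3: "lift3 y s \<bullet> lift3 y' s' = y \<bullet> y' + s * s'"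
  by (simp add: inner_vec_def sum_3 sum_2)

lemma norm_lift3: "(norm (lift3 y s))\<^sup>2 = (norm y)\<^sup>2 + s\<^sup>2"
  by (simp add: power2_norm_eq_inner inner_lift3) (simp add: power2_eq_square)

lemma continuous_on_lift3 [continuous_intros]:
  "continuous_on U f \<Longrightarrow> continuous_on U g \<Longrightarrow> continuous_on U (\<lambda>x. lift3 (f x) (g x))"
  using bounded_linear.continuous_on[OF bounded_linear_lift3 continuous_on_Pair[of U f g]] by simp

text \<open>Boxes determine Lebesgue measure, and the preimage of a box is a planar box times an
  interval.\<close>

lemma lborel_distr_lift3: "distr lborel borel (\<lambda>(y, s). lift3 y s) = lborel"
proof (rule lborel_eqI[symmetric])
  fix l u :: "real^3" assume "\<And>b. b \<in> Basis \<Longrightarrow> l \<bullet> b \<le> u \<bullet> b"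
  from this[of "axis i 1" for i] have lu: "\<And>i. l $ i \<le> u $ i"
    by (simp add: inner_axis)
  have [measurable]: "(\<lambda>(y, s). lift3 y s) \<in> borel_measurable borel"
    by (intro borel_measurable_continuous_onI linear_continuous_on bounded_linear_lift3)
  let ?p = "\<lambda>x::real^3. vector [x $ 1, x $ 2] :: real^2"
  have "(\<lambda>(y, s). lift3 y s) -` box l u = box (?p l) (?p u) \<times> box (l $ 3) (u $ 3)"
    by (intro set_eqI) (simp add: split_beta mem_Times_iff mem_box_cart forall_3 forall_2 box_real)
  then have "emeasure (distr lborel borel (\<lambda>(y, s). lift3 y s)) (box l u)
    = emeasure lborel (box (?p l) (?p u) \<times> box (l $ 3) (u $ 3))"
    by (simp add: emeasure_distr)
  also have "\<dots> = emeasure lborel (box (?p l) (?p u)) * emeasure lborel (box (l $ 3) (u $ 3))"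
    unfolding lborel_prod[symmetric] by (rule lborel.emeasure_pair_measure_Times) auto
  also have "\<dots> = ennreal (\<Prod>i\<in>UNIV. u $ i - l $ i)"
  proof -
    have "\<forall>i. ?p l $ i \<le> ?p u $ i"
      unfolding forall_2 using lu by simp
    then have "emeasure lborel (box (?p l) (?p u)) = ennreal (\<Prod>i\<in>UNIV. ?p u $ i - ?p l $ i)"
      by (intro emeasure_lborel_box_cart) simp
    also have "(\<Prod>i\<in>UNIV. ?p u $ i - ?p l $ i) = (u $ 1 - l $ 1) * (u $ 2 - l $ 2)"
      unfolding UNIV_2 by simp
    finally have "emeasure lborel (box (?p l) (?p u)) = ennreal ((u $ 1 - l $ 1) * (u $ 2 - l $ 2))" .
    moreover have "emeasure lborel (box (l $ 3) (u $ 3)) = ennreal (u $ 3 - l $ 3)"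
      unfolding box_real using lu[of 3] by (rule emeasure_lborel_Ioo)
    moreover have "(\<Prod>i\<in>UNIV. u $ i - l $ i) = (u $ 1 - l $ 1) * (u $ 2 - l $ 2) * (u $ 3 - l $ 3)"
      unfolding UNIV_3 by simp
    moreover have "0 \<le> (u $ 1 - l $ 1) * (u $ 2 - l $ 2)" "0 \<le> u $ 3 - l $ 3"
      using lu by (auto intro!: mult_nonneg_nonneg)
    ultimately show ?thesis
      by (simp only: ennreal_mult)
  qed
  finally show "emeasure (distr lborel borel (\<lambda>(y, s). lift3 y s)) (box l u) = ennreal (prod ((\<bullet>) (u - l)) Basis)"
    by (simp only: prod_Basis_vec) (simp add: inner_axis)
qed simp

text \<open>Every slice over a fixed \<open>y\<close> is merely translated by
  \<open>\<gamma> y\<close>, so Tonelli gives the claim for measurable \<open>\<gamma>\<close>,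
  without a Jacobian.\<close>

lemma lborel_distr_shear:
  fixes \<gamma> :: "'a::euclidean_space \<Rightarrow> real"
  assumes [measurable]: "\<gamma> \<in> borel_measurable borel"
  shows "distr lborel borel (\<lambda>(y, s). (y, \<gamma> y + s)) = lborel"
proof (rule measure_eqI)
  fix X :: "('a \<times> real) set" assume "X \<in> sets (distr lborel borel (\<lambda>(y, s). (y, \<gamma> y + s)))"
  then have [measurable]: "X \<in> sets (borel \<Otimes>\<^sub>M borel)" unfolding borel_prod by simp
  have m: "(\<lambda>(y, s). (y, \<gamma> y + s)) \<in> measurable (borel \<Otimes>\<^sub>M borel) (borel \<Otimes>\<^sub>M borel)"
    by measurable
  then have mb: "(\<lambda>(y, s). (y, \<gamma> y + s)) \<in> measurable borel borel"
    by (simp add: borel_prod)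
  have ms: "(\<lambda>(y, s). (y, \<gamma> y + s)) -` X \<in> sets (lborel \<Otimes>\<^sub>M lborel)"
    using measurable_sets[OF m, of X] by (simp add: borel_prod lborel_prod space_pair_measure)
  have "emeasure (distr lborel borel (\<lambda>(y, s). (y, \<gamma> y + s))) X
     = emeasure (lborel \<Otimes>\<^sub>M lborel) ((\<lambda>(y, s). (y, \<gamma> y + s)) -` X)"
    using mb \<open>X \<in> sets (distr _ _ _)\<close> unfolding lborel_prod by (subst emeasure_distr) auto
  also have "\<dots> = (\<integral>\<^sup>+y. emeasure lborel (Pair y -` (\<lambda>(y, s). (y, \<gamma> y + s)) -` X) \<partial>lborel)"
    using ms by (rule lborel.emeasure_pair_measure_alt)
  also have "\<dots> = (\<integral>\<^sup>+y. emeasure lborel (Pair y -` X) \<partial>lborel)"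
  proof (rule nn_integral_cong)
    fix y
    have [measurable]: "Pair y -` X \<in> sets borel"
      using sets_Pair1[of X borel borel y] by simp
    have "Pair y -` (\<lambda>(y, s). (y, \<gamma> y + s)) -` X = (+) (\<gamma> y) -` (Pair y -` X)" by auto
    also have "emeasure lborel \<dots> = emeasure (distr lborel borel ((+) (\<gamma> y))) (Pair y -` X)"
      by (simp add: emeasure_distr)
    finally show "emeasure lborel (Pair y -` (\<lambda>(y, s). (y, \<gamma> y + s)) -` X) = emeasure lborel (Pair y -` X)"
      by (simp add: lborel_distr_plus)
  qed
  also have "\<dots> = emeasure (lborel \<Otimes>\<^sub>M lborel) X"
    using \<open>X \<in> sets (distr _ _ _)\<close> by (intro lborel.emeasure_pair_measure_alt[symmetric]) (simp add: lborel_prod)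
  finally show "emeasure (distr lborel borel (\<lambda>(y, s). (y, \<gamma> y + s))) X = emeasure lborel X"
    by (simp add: lborel_prod)
qed simp

section \<open>Integrals of derivatives of compactly supported functions\<close>

lemma integrable_lborel_compact_support:
  fixes f :: "'a::euclidean_space \<Rightarrow> 'b::{banach, second_countable_topology}"
  assumes "continuous_on UNIV f" "compact K" "\<And>x. x \<notin> K \<Longrightarrow> f x = 0"
  shows "integrable lborel f"
proof -
  have "(\<lambda>x. indicator K x *\<^sub>R f x) = f"
    using assms(3) by (auto simp: fun_eq_iff indicator_def)
  then show ?thesis
    using borel_integrable_compact[OF assms(2) continuous_on_subset[OF assms(1)]] by simp
qed

lemma bounded_compact_support:
  fixes f :: "'a::euclidean_space \<Rightarrow> 'b::real_normed_vector"
  assumes "continuous_on UNIV f" "compact K" "\<And>x. x \<notin> K \<Longrightarrow> f x = 0"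
  obtains M where "M \<ge> 0" "\<And>x. norm (f x) \<le> M"
proof -
  have "compact (f ` K)" using assms by (meson compact_continuous_image continuous_on_subset subset_UNIV)
  then obtain M where M: "\<And>y. y \<in> f ` K \<Longrightarrow> norm y \<le> M" "M > 0"
    by (meson bounded_pos compact_imp_bounded)
  have "norm (f x) \<le> M" for x
    by (cases "x \<in> K") (use M assms in auto)
  with M show ?thesis by (intro that[of M]) auto
qed

text \<open>Difference quotients of \<open>f\<close> along \<open>e\<close> integrate to zero
  because Lebesgue measure is translation invariant, and dominated convergence carries this to the
  derivative. Working with quotients avoids a choice of coordinates in which \<open>e\<close> is an
  axis.\<close>

lemma integral_directional_derivative_eq_0:
  fixes f g :: "'a::euclidean_space \<Rightarrow> 'b::euclidean_space"
  assumes der: "\<And>x. ((\<lambda>t. f (x + t *\<^sub>R e)) has_vector_derivative g x) (at 0)"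
    and cf: "continuous_on UNIV f" and cg: "continuous_on UNIV g"
    and sf: "\<And>x. norm x > R \<Longrightarrow> f x = 0" and sg: "\<And>x. norm x > R \<Longrightarrow> g x = 0"
  shows "(\<integral>x. g x \<partial>lborel) = 0"
proof -
  \<comment> \<open>The hypothesis gives derivatives only at parameter 0; re-basing the line at
    \<open>x + t *\<^sub>R e\<close> gives them at every \<open>t\<close>, as the mean value bound
    below requires.\<close>
  have der': "((\<lambda>t. f (x + t *\<^sub>R e)) has_vector_derivative g (x + t *\<^sub>R e)) (at t)" for x t
  proof -
    have "((\<lambda>s. f ((x + t *\<^sub>R e) + s *\<^sub>R e)) has_vector_derivative g (x + t *\<^sub>R e)) (at (t - t))"
      using der[of "x + t *\<^sub>R e"] by simp
    then have "((\<lambda>s. f ((x + t *\<^sub>R e) + s *\<^sub>R e)) \<circ> (\<lambda>s. s - t) has_vector_derivative (1 *\<^sub>R g (x + t *\<^sub>R e))) (at t)"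
      by (intro vector_diff_chain_at) (auto intro!: derivative_eq_intros)
    then show ?thesis by (simp add: o_def algebra_simps)
  qed
  obtain M where M: "M \<ge> 0" "\<And>x. norm (g x) \<le> M"
    using bounded_compact_support[OF cg compact_cball[of 0 R]] sg by (auto simp: not_le)
  have lip: "norm (f (x + t *\<^sub>R e) - f x) \<le> M * t" if "t \<ge> 0" for x t
  proof -
    have "norm (f (x + t *\<^sub>R e) - f (x + 0 *\<^sub>R e)) \<le> M * norm (t - 0)"
    proof (rule differentiable_bound[where S = UNIV and f' = "\<lambda>s h. h *\<^sub>R g (x + s *\<^sub>R e)"])
      fix s show "((\<lambda>t. f (x + t *\<^sub>R e)) has_derivative (\<lambda>h. h *\<^sub>R g (x + s *\<^sub>R e))) (at s)"
        using der'[of x s] by (simp add: has_vector_derivative_def)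
      show "onorm (\<lambda>h. h *\<^sub>R g (x + s *\<^sub>R e)) \<le> M"
        using M by (intro onorm_le) (metis mult.commute mult_right_mono norm_scaleR abs_ge_zero real_norm_def)
    qed auto
    then show ?thesis using that by simp
  qed
  define q where "q n x = real (Suc n) *\<^sub>R (f (x + (1 / real (Suc n)) *\<^sub>R e) - f x)" for n x
  have int_f: "integrable lborel f"
    using integrable_lborel_compact_support[OF cf compact_cball[of 0 R]] sf by (auto simp: not_le)
  have cont_shift: "continuous_on UNIV (\<lambda>x. f (x + c))" for c
    by (rule continuous_on_compose2[OF cf]) (auto intro!: continuous_intros)
  have shift: "integrable lborel (\<lambda>x. f (x + c))" "(\<integral>x. f (x + c) \<partial>lborel) = (\<integral>x. f x \<partial>lborel)" for c
  proof -
    have bm: "f \<in> borel_measurable borel" using cf by (rule borel_measurable_continuous_onI)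
    show "integrable lborel (\<lambda>x. f (x + c))"
      using integrable_distr[of "(+) c" lborel borel f] int_f
      by (simp add: lborel_distr_plus add.commute)
    have "(\<integral>x. f x \<partial>lborel) = (\<integral>x. f x \<partial>distr lborel borel ((+) c))" by (simp add: lborel_distr_plus)
    also have "\<dots> = (\<integral>x. f (c + x) \<partial>lborel)" using bm by (subst integral_distr) auto
    finally show "(\<integral>x. f (x + c) \<partial>lborel) = (\<integral>x. f x \<partial>lborel)" by (simp add: add.commute)
  qed
  have "(\<integral>x. q n x \<partial>lborel) = 0" for n
    unfolding q_def using shift int_f by (simp add: Bochner_Integration.integral_diff)
  moreover have "(\<lambda>n. \<integral>x. q n x \<partial>lborel) \<longlonglongrightarrow> (\<integral>x. g x \<partial>lborel)"
  proof (rule integral_dominated_convergence[where w = "\<lambda>x. indicator (cball 0 (R + norm e)) x *\<^sub>R M"])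
    show "g \<in> borel_measurable lborel" using cg by (simp add: borel_measurable_continuous_onI)
    show "q n \<in> borel_measurable lborel" for n
      unfolding q_def using cf cont_shift
      by (auto intro!: borel_measurable_continuous_onI continuous_intros)
    show "integrable lborel (\<lambda>x. indicator (cball 0 (R + norm e)) x *\<^sub>R M)"
      by (rule borel_integrable_compact) auto
    show "AE x in lborel. (\<lambda>n. q n x) \<longlonglongrightarrow> g x"
    proof (rule AE_I2)
      fix x
      have "((\<lambda>h. (f (x + h *\<^sub>R e) - f x) /\<^sub>R h) \<longlongrightarrow> g x) (at 0)"
      proof (rule LIM_zero_cancel, rule tendsto_norm_zero_cancel)
        have "(\<lambda>h. norm (f (x + h *\<^sub>R e) - f x - h *\<^sub>R g x) / norm h) \<midarrow>0\<rightarrow> 0"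
          using der[of x] by (simp add: has_vector_derivative_def has_derivative_at)
        then show "(\<lambda>h. norm ((f (x + h *\<^sub>R e) - f x) /\<^sub>R h - g x)) \<midarrow>0\<rightarrow> 0"
        proof (rule Lim_transform_eventually)
          show "\<forall>\<^sub>F h in at 0. norm (f (x + h *\<^sub>R e) - f x - h *\<^sub>R g x) / norm h
              = norm ((f (x + h *\<^sub>R e) - f x) /\<^sub>R h - g x)"
          proof (rule eventually_at_topological[THEN iffD2, OF exI[of _ UNIV]], safe)
            fix h :: real assume "h \<noteq> 0"
            then have "(f (x + h *\<^sub>R e) - f x) /\<^sub>R h - g x = (f (x + h *\<^sub>R e) - f x - h *\<^sub>R g x) /\<^sub>R h"
              by (simp add: scaleR_diff_right)
            then show "norm (f (x + h *\<^sub>R e) - f x - h *\<^sub>R g x) / norm h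
              = norm ((f (x + h *\<^sub>R e) - f x) /\<^sub>R h - g x)"
              by (simp add: divide_inverse mult.commute)
          qed auto
        qed
      qed
      moreover have "filterlim (\<lambda>n. 1 / real (Suc n)) (at 0) sequentially"
        unfolding filterlim_at using LIMSEQ_Suc[OF lim_const_over_n[of 1]] by (simp del: of_nat_Suc)
      ultimately have "(\<lambda>n. (f (x + (1 / real (Suc n)) *\<^sub>R e) - f x) /\<^sub>R (1 / real (Suc n))) \<longlonglongrightarrow> g x"
        by (rule filterlim_compose)
      then show "(\<lambda>n. q n x) \<longlonglongrightarrow> g x" by (simp add: q_def del: of_nat_Suc)
    qed
    show "AE x in lborel. norm (q n x) \<le> indicator (cball 0 (R + norm e)) x *\<^sub>R M" for n
    proof (rule AE_I2)
      fix x
      let ?t = "1 / real (Suc n)"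
      show "norm (q n x) \<le> indicator (cball 0 (R + norm e)) x *\<^sub>R M"
      proof (cases "norm x \<le> R + norm e")
        case True
        have "norm (q n x) = real (Suc n) * norm (f (x + ?t *\<^sub>R e) - f x)" by (simp add: q_def del: of_nat_Suc)
        also have "\<dots> \<le> real (Suc n) * (M * ?t)" by (intro mult_left_mono lip) auto
        also have "\<dots> = M" by simp
        finally show ?thesis using True by simp
      next
        case False
        have "norm (?t *\<^sub>R e) \<le> norm e"
          using mult_left_le_one_le[of "norm e" ?t] by (simp del: of_nat_Suc)
        moreover have "norm x \<le> norm (x + ?t *\<^sub>R e) + norm (?t *\<^sub>R e)"
          using norm_triangle_ineq4[of "x + ?t *\<^sub>R e" "?t *\<^sub>R e"] by simp
        ultimately have "norm (x + ?t *\<^sub>R e) > R" using False by linarith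
        moreover have "norm x > R" using False norm_ge_zero[of e] by linarith
        ultimately show ?thesis using False by (simp add: q_def sf)
      qed
    qed
  qed
  ultimately show ?thesis by (simp add: LIMSEQ_const_iff)
qed

section \<open>The divergence theorem above a graph\<close>

lemma continuous_on_orthogonal:
  fixes B :: "'a::euclidean_space \<Rightarrow> 'a"
  assumes "orthogonal_transformation B" "continuous_on U f"
  shows "continuous_on U (\<lambda>x. B (f x))"
  using linear_continuous_on[OF linear_conv_bounded_linear[THEN iffD1, OF orthogonal_transformation_linear[OF assms(1)]]]
  by (rule continuous_on_compose2[OF _ assms(2)]) auto

lemma integral_halfline_derivative:
  fixes g g' :: "real \<Rightarrow> 'b::euclidean_space"
  assumes "\<And>s. (g has_vector_derivative g' s) (at s)" "continuous_on UNIV g'"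
    and "\<And>s. s > N \<Longrightarrow> g s = 0" "N \<ge> 0"
  shows "(\<integral>s. indicator {0<..} s *\<^sub>R g' s \<partial>lborel) = - g 0"
proof -
  \<comment> \<open>\<open>g\<close> is identically zero near every \<open>s > N\<close>, so its
    derivative vanishes there; the half-line integral may be cut off at \<open>N + 1\<close>, where
    the fundamental theorem of calculus meets the value 0.\<close>
  have z: "g' s = 0" if "s > N" for s
  proof -
    have "\<forall>\<^sub>F t in nhds s. t > N" using that eventually_gt_at_top
      by (metis eventually_nhds greaterThan_iff open_greaterThan)
    then have "((\<lambda>_. 0) has_vector_derivative g' s) (at s)"
      using assms(1)[of s] assms(3) that
      by (subst has_vector_derivative_cong_ev[where g = g])
        (auto elim!: eventually_mono)
    then show ?thesis using vector_derivative_unique_at has_vector_derivative_const by blast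
  qed
  have "(\<integral>s. indicator {0<..} s *\<^sub>R g' s \<partial>lborel) = (\<integral>s. indicator {0..N+1} s *\<^sub>R g' s \<partial>lborel)"
  proof (rule integral_cong_AE)
    have [measurable]: "g' \<in> borel_measurable borel" using assms(2) by (rule borel_measurable_continuous_onI)
    show "(\<lambda>s. indicator {0<..} s *\<^sub>R g' s) \<in> borel_measurable lborel" 
      "(\<lambda>s. indicator {0..N+1} s *\<^sub>R g' s) \<in> borel_measurable lborel" by measurable
    show "AE s in lborel. indicator {0<..} s *\<^sub>R g' s = indicator {0..N+1} s *\<^sub>R g' s"
      using AE_lborel_singleton[of 0] by eventually_elim (auto simp: indicator_def z)
  qed
  also have "\<dots> = g (N + 1) - g 0"
    using assms by (intro integral_FTC_Icc) 
      (auto intro: has_vector_derivative_at_within continuous_on_subset)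
  finally show ?thesis using assms(3)[of "N+1"] by simp
qed

lemma lborel_distr_graph_chart:
  fixes \<gamma> :: "real^2 \<Rightarrow> real" and B :: "real^3 \<Rightarrow> real^3"
  assumes B: "orthogonal_transformation B" and [measurable]: "\<gamma> \<in> borel_measurable borel"
  shows "distr lborel borel (\<lambda>(y, s). B (lift3 y (\<gamma> y + s))) = lborel"
proof -
  have [measurable]: "B \<in> borel_measurable borel"
    using continuous_on_orthogonal[OF B continuous_on_id] by (rule borel_measurable_continuous_onI)
  have [measurable]: "(\<lambda>(y, s). lift3 y s) \<in> borel_measurable borel"
    by (intro borel_measurable_continuous_onI linear_continuous_on bounded_linear_lift3)
  have "(\<lambda>(y, s). (y, \<gamma> y + s)) \<in> measurable (borel \<Otimes>\<^sub>M borel) (borel \<Otimes>\<^sub>M borel)" by measurable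
  then have [measurable]: "(\<lambda>(y, s). (y, \<gamma> y + s)) \<in> measurable borel borel" unfolding borel_prod .
  have "lborel = distr lborel borel B"
    using lborel_distr_orthogonal[OF B] by simp
  also have "\<dots> = distr (distr (distr lborel borel (\<lambda>(y, s). (y, \<gamma> y + s))) borel (\<lambda>(y, s). lift3 y s)) borel B"
    by (simp add: lborel_distr_lift3 lborel_distr_shear)
  also have "\<dots> = distr lborel borel (B \<circ> ((\<lambda>(y, s). lift3 y s) \<circ> (\<lambda>(y, s). (y, \<gamma> y + s))))"
    by (simp add: distr_distr)
  also have "B \<circ> ((\<lambda>(y, s). lift3 y s) \<circ> (\<lambda>(y, s). (y, \<gamma> y + s))) = (\<lambda>(y, s). B (lift3 y (\<gamma> y + s)))"
    by auto
  finally show ?thesis by simp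
qed

lemma integrable_indicator_times_compact_support:
  fixes f :: "'a::euclidean_space \<Rightarrow> 'b::{banach, second_countable_topology}"
  assumes "continuous_on UNIV f" "compact K" "\<And>x. x \<notin> K \<Longrightarrow> f x = 0" "A \<in> sets borel"
  shows "integrable lborel (\<lambda>x. indicator A x *\<^sub>R f x)"
  using assms by (intro integrable_mult_indicator integrable_lborel_compact_support) auto

lemma has_derivative_along_curve:
  assumes "(p has_vector_derivative v) (at t)" "(f has_derivative f') (at (p t))"
  shows "((\<lambda>t. f (p t)) has_vector_derivative f' v) (at t)"
proof -
  have "((\<lambda>t. f (p t)) has_derivative (\<lambda>h. f' (h *\<^sub>R v))) (at t)"
    using assms has_derivative_compose[of p "\<lambda>h. h *\<^sub>R v" t UNIV f f']
    by (simp add: has_vector_derivative_def)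
  then show ?thesis
    by (simp add: has_vector_derivative_def linear_scale[OF has_derivative_linear[OF assms(2)]])
qed

lemma abs_le_norm_lift3: "\<bar>s\<bar> \<le> norm (lift3 y s)" "norm y \<le> norm (lift3 y s)"
proof -
  have "\<bar>s\<bar>\<^sup>2 \<le> (norm (lift3 y s))\<^sup>2" "(norm y)\<^sup>2 \<le> (norm (lift3 y s))\<^sup>2"
    unfolding norm_lift3 by simp_all
  then show "\<bar>s\<bar> \<le> norm (lift3 y s)" "norm y \<le> norm (lift3 y s)"
    by (meson norm_ge_zero power2_le_imp_le)+
qed

text \<open>In the coordinates \<open>\<Phi> y s\<close> the region becomes \<open>s > 0\<close>,
  and \<open>e\<close> splits into a vector tangent to the translated graph and a vertical remainder
  of size \<open>c - \<gamma>' y d\<close>. The tangential part is a derivative in \<open>y\<close>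
  at fixed \<open>s\<close> and integrates to zero; the vertical part is a derivative in
  \<open>s\<close> and leaves the value at \<open>s = 0\<close>.\<close>

lemma divergence_theorem_graph:
  fixes f :: "real^3 \<Rightarrow> complex" and \<gamma> :: "real^2 \<Rightarrow> real" and B :: "real^3 \<Rightarrow> real^3"
  assumes B: "orthogonal_transformation B"
    and fd: "\<And>x. (f has_derivative f' x) (at x)" and fc: "\<And>v. continuous_on UNIV (\<lambda>x. f' x v)"
    and \<gamma>d: "\<And>y. (\<gamma> has_derivative \<gamma>' y) (at y)" and \<gamma>c: "\<And>v. continuous_on UNIV (\<lambda>y. \<gamma>' y v)"
    and supp: "\<And>x. norm x > R \<Longrightarrow> f x = 0"
    and W: "W \<in> sets borel" "\<And>y s. B (lift3 y s) \<in> W \<longleftrightarrow> \<gamma> y < s"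
    and e: "e = B (lift3 d c)"
  shows "(\<integral>x. indicator W x *\<^sub>R f' x e \<partial>lborel) = (\<integral>y. (\<gamma>' y d - c) *\<^sub>R f (B (lift3 y (\<gamma> y))) \<partial>lborel)"
proof -
  define \<Phi> where "\<Phi> y s = B (lift3 y (\<gamma> y + s))" for y s
  have linB: "linear B" using B orthogonal_transformation_linear by blast
  have normB: "norm (B x) = norm x" for x using B orthogonal_transformation_norm by blast
  have cf: "continuous_on UNIV f"
    by (intro continuous_at_imp_continuous_on ballI has_derivative_continuous[OF fd])
  have c\<gamma>: "continuous_on UNIV \<gamma>"
    by (intro continuous_at_imp_continuous_on ballI has_derivative_continuous[OF \<gamma>d])
  have linf: "linear (f' x)" for x by (rule has_derivative_linear[OF fd])
  have supp': "f' x v = 0" if "norm x > R" for x v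
  proof -
    have "open {x. norm x > R}" by (intro open_Collect_less continuous_intros)
    then have "((\<lambda>_. 0) has_derivative f' x) (at x)"
      using that supp by (intro has_derivative_transform_within_open[OF fd[of x]]) auto
    then have "f' x = (\<lambda>_. 0)" by (rule has_derivative_unique) (rule has_derivative_const)
    then show ?thesis by simp
  qed
  have \<Phi>0: "norm (\<Phi> y s) > R" if "norm y > R \<or> \<bar>\<gamma> y + s\<bar> > R" for y s
    using that abs_le_norm_lift3[where y = y and s = "\<gamma> y + s"] by (auto simp: \<Phi>_def normB)
  have c\<Phi>: "continuous_on UNIV (\<lambda>(y, s). \<Phi> y s)"
    unfolding \<Phi>_def case_prod_unfold
    by (intro continuous_on_orthogonal[OF B] continuous_intros continuous_on_compose2[OF c\<gamma>]) auto
  have "compact (\<gamma> ` cball 0 R)"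
    by (intro compact_continuous_image continuous_on_subset[OF c\<gamma>]) auto
  then obtain M where "\<forall>z\<in>\<gamma> ` cball 0 R. norm z \<le> M"
    using compact_imp_bounded bounded_iff by metis
  then have M: "\<bar>\<gamma> y\<bar> \<le> M" if "norm y \<le> R" for y
    using that by auto
  \<comment> \<open>Where \<open>f (\<Phi> y s)\<close> is nonzero, both \<open>y\<close> and
    \<open>\<gamma> y + s\<close> have size at most \<open>R\<close>; as \<open>M\<close> bounds
    \<open>\<gamma>\<close> on the disc of radius \<open>R\<close>, the size of \<open>s\<close> is
    then at most \<open>R + M\<close>.\<close>
  define K where "K = cball (0::real^2) R \<times> cball (0::real) (R + M)"
  have cK: "compact K" unfolding K_def by (intro compact_Times compact_cball)
  have K: "norm (\<Phi> (fst z) (snd z)) > R" if "z \<notin> K" for z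
  proof (cases "norm (fst z) \<le> R")
    case True
    then show ?thesis using that M[OF True] by (intro \<Phi>0) (auto simp: K_def mem_Times_iff)
  qed (auto intro: \<Phi>0)
  define h where "h = B (lift3 0 1)"
  define H1 where "H1 y s = f' (\<Phi> y s) (B (lift3 d (\<gamma>' y d)))" for y s
  define H2 where "H2 y s = (c - \<gamma>' y d) *\<^sub>R f' (\<Phi> y s) h" for y s
  have H1': "H1 y s = f' (\<Phi> y s) (B (lift3 d 0)) + \<gamma>' y d *\<^sub>R f' (\<Phi> y s) h" for y s
  proof -
    have "lift3 d (\<gamma>' y d) = lift3 d 0 + \<gamma>' y d *\<^sub>R lift3 0 1"
      by (auto simp: vec_eq_iff forall_3)
    then show ?thesis
      unfolding H1_def h_def by (simp add: linear_add linB linf linear_scale)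
  qed
  have eH: "f' (\<Phi> y s) e = H1 y s + H2 y s" for y s
  proof -
    have "lift3 d c = lift3 d 0 + c *\<^sub>R lift3 0 1"
      by (auto simp: vec_eq_iff forall_3)
    then have "f' (\<Phi> y s) e = f' (\<Phi> y s) (B (lift3 d 0)) + c *\<^sub>R f' (\<Phi> y s) h"
      unfolding e h_def by (simp add: linear_add linB linf linear_scale)
    then show ?thesis unfolding H1' H2_def by (simp add: algebra_simps)
  qed
  have cc: "continuous_on UNIV (\<lambda>(y, s). f' (\<Phi> y s) v)" for v
    using continuous_on_compose2[OF fc[of v] c\<Phi>] by (auto simp: case_prod_unfold)
  have c\<gamma>': "continuous_on UNIV (\<lambda>z. \<gamma>' (fst z) d)"
    by (rule continuous_on_compose2[OF \<gamma>c]) (auto intro: continuous_intros)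
  have cH1: "continuous_on UNIV (\<lambda>(y, s). H1 y s)" and cH2: "continuous_on UNIV (\<lambda>(y, s). H2 y s)"
    unfolding H1' H2_def case_prod_unfold
    using cc[unfolded case_prod_unfold] c\<gamma>' by (auto intro!: continuous_intros)
  have A: "UNIV \<times> {0<..} \<in> sets (borel :: ((real^2) \<times> real) measure)"
    by (intro borel_open open_Times) auto
  have "(case z of (y, s) \<Rightarrow> H1 y s) = 0" "(case z of (y, s) \<Rightarrow> H2 y s) = 0" if "z \<notin> K" for z
    using K[OF that] supp' by (simp_all add: H1_def H2_def case_prod_unfold)
  then have iH: "integrable lborel (\<lambda>z. indicator (UNIV \<times> {0<..}) z *\<^sub>R (case z of (y, s) \<Rightarrow> H1 y s))"
      "integrable lborel (\<lambda>z. indicator (UNIV \<times> {0<..}) z *\<^sub>R (case z of (y, s) \<Rightarrow> H2 y s))"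
    using integrable_indicator_times_compact_support[OF cH1 cK _ A]
      integrable_indicator_times_compact_support[OF cH2 cK _ A] by blast+
  have iH': "integrable (lborel \<Otimes>\<^sub>M lborel) (\<lambda>(y, s). indicator {0<..} s *\<^sub>R H1 y s)"
      "integrable (lborel \<Otimes>\<^sub>M lborel) (\<lambda>(y, s). indicator {0<..} s *\<^sub>R H2 y s)"
    unfolding lborel_prod using iH by (auto simp: case_prod_unfold indicator_times)
  have bm: "(\<lambda>x. indicator W x *\<^sub>R f' x e) \<in> borel_measurable borel"
    using W(1) borel_measurable_continuous_onI[OF fc] by measurable
  have b\<Phi>: "(\<lambda>(y, s). \<Phi> y s) \<in> borel_measurable borel"
    using c\<Phi> by (rule borel_measurable_continuous_onI)
  have "(\<integral>x. indicator W x *\<^sub>R f' x e \<partial>lborel)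
      = (\<integral>x. indicator W x *\<^sub>R f' x e \<partial>distr lborel borel (\<lambda>(y, s). \<Phi> y s))"
    unfolding \<Phi>_def using lborel_distr_graph_chart[OF B borel_measurable_continuous_onI[OF c\<gamma>]] by simp
  also have "\<dots> = (\<integral>(y, s). indicator {0<..} s *\<^sub>R H1 y s + indicator {0<..} s *\<^sub>R H2 y s \<partial>lborel)"
    using b\<Phi> bm
    by (subst integral_distr) (auto intro!: Bochner_Integration.integral_cong
        simp: \<Phi>_def[symmetric] eH[symmetric] scaleR_add_right[symmetric] indicator_def, auto simp: \<Phi>_def W(2))
  also have "\<dots> = (\<integral>(y, s). indicator {0<..} s *\<^sub>R H1 y s \<partial>(lborel \<Otimes>\<^sub>M lborel))
      + (\<integral>(y, s). indicator {0<..} s *\<^sub>R H2 y s \<partial>(lborel \<Otimes>\<^sub>M lborel))"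
    using Bochner_Integration.integral_add[OF iH'] unfolding lborel_prod by (simp add: case_prod_unfold)
  \<comment> \<open>For this term \<open>y\<close> is the inner variable, for the term with
    \<open>H2\<close> it is \<open>s\<close>; integrability was shown for each half separately so
    that Fubini can be used in both orders.\<close>
  also have "(\<integral>(y, s). indicator {0<..} s *\<^sub>R H1 y s \<partial>(lborel \<Otimes>\<^sub>M lborel))
      = (\<integral>s. (\<integral>y. indicator {0<..} s *\<^sub>R H1 y s \<partial>lborel) \<partial>lborel)"
    using lborel_pair.integral_snd[OF iH'(1)] by simp
  also have "\<dots> = (\<integral>s. 0 \<partial>(lborel :: real measure))"
  proof (rule Bochner_Integration.integral_cong[OF refl])
    fix s
    have "(\<integral>y. H1 y s \<partial>lborel) = 0"
    proof (rule integral_directional_derivative_eq_0[where f = "\<lambda>y. f (\<Phi> y s)" and R = R and e = d])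
      show "continuous_on UNIV (\<lambda>y. f (\<Phi> y s))"
        by (rule continuous_on_compose2[OF cf])
          (auto simp: \<Phi>_def intro!: continuous_on_orthogonal[OF B] continuous_intros c\<gamma>)
      show "continuous_on UNIV (\<lambda>y. H1 y s)"
        using continuous_on_compose2[OF cH1 continuous_on_Pair[OF continuous_on_id continuous_on_const[of _ s]]] by simp
      show "f (\<Phi> y s) = 0" "H1 y s = 0" if "norm y > R" for y
        using \<Phi>0 that supp supp' by (auto simp: H1_def)
      show "((\<lambda>t. f (\<Phi> (y + t *\<^sub>R d) s)) has_vector_derivative H1 y s) (at 0)" for y
      proof -
        have line: "((\<lambda>t. y + t *\<^sub>R d) has_vector_derivative d) (at 0)"
          using has_vector_derivative_add[OF has_vector_derivative_const[of y "at 0"]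
              has_vector_derivative_scaleR[OF DERIV_ident has_vector_derivative_const[of d]]] by simp
        have "((\<lambda>t. \<gamma> (y + t *\<^sub>R d)) has_vector_derivative \<gamma>' y d) (at 0)"
          using \<gamma>d[of y] by (intro has_derivative_along_curve[OF line]) simp
        from has_vector_derivative_add[OF this has_vector_derivative_const[of s "at 0"]]
        have "((\<lambda>t. (y + t *\<^sub>R d, \<gamma> (y + t *\<^sub>R d) + s)) has_vector_derivative (d, \<gamma>' y d)) (at 0)"
          by (intro has_vector_derivative_Pair line) simp
        then have "((\<lambda>t. lift3 (y + t *\<^sub>R d) (\<gamma> (y + t *\<^sub>R d) + s)) has_vector_derivative lift3 d (\<gamma>' y d)) (at 0)"
          using bounded_linear.has_vector_derivative[OF bounded_linear_lift3] by fastforce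
        then have "((\<lambda>t. \<Phi> (y + t *\<^sub>R d) s) has_vector_derivative B (lift3 d (\<gamma>' y d))) (at 0)"
          unfolding \<Phi>_def using bounded_linear.has_vector_derivative linB linear_conv_bounded_linear by blast
        then show ?thesis
          unfolding H1_def using fd by (rule has_derivative_along_curve[where p = "\<lambda>t. \<Phi> (y + t *\<^sub>R d) s" and t = 0, simplified])
      qed
    qed
    then show "(\<integral>y. indicator {0<..} s *\<^sub>R H1 y s \<partial>lborel) = 0" by simp
  qed
  also have "(\<integral>(y, s). indicator {0<..} s *\<^sub>R H2 y s \<partial>(lborel \<Otimes>\<^sub>M lborel))
      = (\<integral>y. (\<integral>s. indicator {0<..} s *\<^sub>R H2 y s \<partial>lborel) \<partial>lborel)"
    using lborel_pair.integral_fst[OF iH'(2)] by simp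
  also have "\<dots> = (\<integral>y. (\<gamma>' y d - c) *\<^sub>R f (B (lift3 y (\<gamma> y))) \<partial>lborel)"
  proof (rule Bochner_Integration.integral_cong[OF refl])
    fix y
    have "(\<integral>s. indicator {0<..} s *\<^sub>R f' (\<Phi> y s) h \<partial>lborel) = - f (\<Phi> y 0)"
    proof (rule integral_halfline_derivative[where N = "\<bar>R\<bar> + \<bar>\<gamma> y\<bar>"])
      show "continuous_on UNIV (\<lambda>s. f' (\<Phi> y s) h)"
        using continuous_on_compose2[OF cc continuous_on_Pair[OF continuous_on_const[of _ y] continuous_on_id]] by simp
      show "f (\<Phi> y s) = 0" if "s > \<bar>R\<bar> + \<bar>\<gamma> y\<bar>" for s
        using that by (intro supp \<Phi>0) auto
      show "((\<lambda>s. f (\<Phi> y s)) has_vector_derivative f' (\<Phi> y s) h) (at s)" for s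
      proof -
        have "((\<lambda>s. (y, \<gamma> y + s)) has_vector_derivative (0, 1)) (at s)"
          by (intro has_vector_derivative_Pair) (auto intro!: derivative_eq_intros)
        then have "((\<lambda>s. lift3 y (\<gamma> y + s)) has_vector_derivative lift3 0 1) (at s)"
          using bounded_linear.has_vector_derivative[OF bounded_linear_lift3] by fastforce
        then have "((\<lambda>s. \<Phi> y s) has_vector_derivative h) (at s)"
          unfolding \<Phi>_def h_def using bounded_linear.has_vector_derivative linB linear_conv_bounded_linear by blast
        then show ?thesis
          using fd by (rule has_derivative_along_curve)
      qed
    qed auto
    moreover have "(\<integral>s. indicator {0<..} s *\<^sub>R H2 y s \<partial>lborel)
      = (c - \<gamma>' y d) *\<^sub>R (\<integral>s. indicator {0<..} s *\<^sub>R f' (\<Phi> y s) h \<partial>lborel)"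
      unfolding H2_def by (subst integral_scaleR_right[symmetric]) (simp add: mult.commute)
    ultimately show "(\<integral>s. indicator {0<..} s *\<^sub>R H2 y s \<partial>lborel) = (\<gamma>' y d - c) *\<^sub>R f (B (lift3 y (\<gamma> y)))"
      by (simp add: \<Phi>_def algebra_simps)
  qed
  finally show ?thesis by simp
qed

section \<open>Boundary charts\<close>

text \<open>\<open>\<gamma>\<close> is defined on the whole plane, but its graph describes
  \<open>\<Omega>\<close> only inside \<open>ball p r\<close>. Carrying \<open>B\<close> as an
  explicit inverse of \<open>A\<close> yields a parametrization \<open>\<phi>\<close> and
  coordinates \<open>base\<close>, \<open>height\<close> on all of space.\<close>

locale boundary_chart =
  fixes \<Omega> :: "(real^3) set" and p :: "real^3" and r :: real
    and A :: "real^3 \<Rightarrow> real^3" and B :: "real^3 \<Rightarrow> real^3"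
    and \<gamma> :: "real^2 \<Rightarrow> real" and \<gamma>' :: "real^2 \<Rightarrow> real^2 \<Rightarrow> real"
  assumes open_\<Omega>: "open \<Omega>"
    and r_pos: "r > 0"
    and A: "orthogonal_transformation A" and B: "orthogonal_transformation B"
    and BA: "\<And>x. B (A x) = x" and AB: "\<And>x. A (B x) = x"
    and \<gamma>_deriv: "\<And>y. (\<gamma> has_derivative \<gamma>' y) (at y)"
    and \<gamma>'_cont: "\<And>v. continuous_on UNIV (\<lambda>y. \<gamma>' y v)"
    and chart: "\<And>x. x \<in> ball p r \<Longrightarrow> x \<in> \<Omega> \<longleftrightarrow> \<gamma> (vector [A x $ 1, A x $ 2]) < A x $ 3"
begin

definition base :: "real^3 \<Rightarrow> real^2" where "base x = vector [A x $ 1, A x $ 2]"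
definition height :: "real^3 \<Rightarrow> real" where "height x = A x $ 3"
definition \<phi> :: "real^2 \<Rightarrow> real^3" where "\<phi> y = B (lift3 y (\<gamma> y))"
definition slope :: "real^2 \<Rightarrow> real^2" where "slope y = (\<chi> i. \<gamma>' y (axis i 1))"
text \<open>The outer normal before normalization; the entry -1 points down, out of the region above
  the graph. Its length is the area density of the graph, so normalizing and integrating over the
  surface cancel each other.\<close>

definition N :: "real^2 \<Rightarrow> real^3" where "N y = B (lift3 (slope y) (-1))"

lemma linB: "linear B" and linA: "linear A"
  using A B orthogonal_transformation_linear by blast+

lemma normB [simp]: "norm (B x) = norm x" and normA [simp]: "norm (A x) = norm x"
  using A B orthogonal_transformation_norm by blast+

lemma innerB: "B x \<bullet> B y = x \<bullet> y"
  using B by (simp add: orthogonal_transformation_def)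

lemma B_lift3_eq: "B (lift3 (base x) (height x)) = x"
  by (simp add: base_def height_def lift3_cover BA)

lemma base_B [simp]: "base (B (lift3 y s)) = y" and height_B [simp]: "height (B (lift3 y s)) = s"
  by (auto simp: base_def height_def AB vec_eq_iff forall_2)

lemma chart': "x \<in> ball p r \<Longrightarrow> x \<in> \<Omega> \<longleftrightarrow> \<gamma> (base x) < height x"
  using chart by (simp add: base_def height_def)

lemma cont_A: "continuous_on UNIV A"
  using linA linear_continuous_on linear_conv_bounded_linear by blast

lemma cont_base: "continuous_on UNIV base"
proof -
  have "continuous_on UNIV (\<lambda>x. A x $ i)" for i by (intro continuous_intros cont_A)
  moreover have "base x $ i = A x $ (if i = 1 then 1 else 2)" for x i
    using exhaust_2[of i] by (auto simp: base_def)
  ultimately show ?thesis by (intro continuous_on_vec_lambda[of UNIV "\<lambda>i x. base x $ i", simplified]) auto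
qed

lemma cont_height: "continuous_on UNIV height"
  unfolding height_def by (intro continuous_intros cont_A)

lemma cont_\<gamma>: "continuous_on UNIV \<gamma>"
  by (intro continuous_at_imp_continuous_on ballI has_derivative_continuous[OF \<gamma>_deriv])

lemma cont_\<phi>: "continuous_on UNIV \<phi>"
  unfolding \<phi>_def by (intro continuous_on_orthogonal[OF B] continuous_intros cont_\<gamma>)

lemma \<gamma>'_eq: "\<gamma>' y h = slope y \<bullet> h"
proof -
  have lin: "linear (\<gamma>' y)" by (rule has_derivative_linear[OF \<gamma>_deriv])
  have "h = (\<Sum>i\<in>UNIV. h $ i *\<^sub>R axis i 1)"
    by (simp add: vec_eq_iff axis_def if_distrib cong: if_cong)
  then have "\<gamma>' y h = \<gamma>' y (\<Sum>i\<in>UNIV. h $ i *\<^sub>R axis i 1)" by simp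
  also have "\<dots> = (\<Sum>i\<in>UNIV. h $ i *\<^sub>R \<gamma>' y (axis i 1))"
    by (simp add: linear_sum[OF lin] linear_scale[OF lin])
  finally show ?thesis by (simp add: slope_def inner_vec_def mult.commute)
qed

lemma cont_slope: "continuous_on UNIV slope"
  unfolding slope_def using \<gamma>'_cont by (intro continuous_on_vec_lambda) auto

lemma cont_N: "continuous_on UNIV N"
  unfolding N_def by (intro continuous_on_orthogonal[OF B] continuous_intros cont_slope)

lemma norm_N_sq: "(norm (N y))\<^sup>2 = (norm (slope y))\<^sup>2 + 1"
  unfolding N_def by (simp add: norm_lift3)

lemma N_nz: "norm (N y) > 0"
proof -
  have "(norm (N y))\<^sup>2 > 0" unfolding norm_N_sq by (simp add: add_nonneg_pos)
  then show ?thesis by fastforce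
qed

lemma frontier_iff:
  assumes "x \<in> ball p r"
  shows "x \<in> frontier \<Omega> \<longleftrightarrow> height x = \<gamma> (base x)"
proof -
  have f: "x \<in> frontier \<Omega> \<longleftrightarrow> x \<in> closure \<Omega> \<and> x \<notin> \<Omega>"
    by (simp add: frontier_def interior_open open_\<Omega>)
  consider "height x > \<gamma> (base x)" | "height x < \<gamma> (base x)" | "height x = \<gamma> (base x)" by linarith
  then show ?thesis
  proof cases
    case 1
    then show ?thesis using chart'[OF assms] f by simp
  next
    case 2
    let ?V = "ball p r \<inter> {x. height x < \<gamma> (base x)}"
    have "open ?V"
      by (intro open_Int open_ball open_Collect_less cont_height continuous_on_compose2[OF cont_\<gamma> cont_base]) auto
    moreover have "?V \<inter> \<Omega> = {}" using chart' by force
    moreover have "x \<in> ?V" using 2 assms by simp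
    ultimately have "x \<notin> closure \<Omega>" by (meson disjoint_iff open_Int_closure_eq_empty)
    then show ?thesis using 2 f by simp
  next
    case 3
    have "x \<in> closure \<Omega>"
    proof (rule closure_sequential[THEN iffD2], intro exI conjI allI)
      \<comment> \<open>Points of \<open>\<Omega>\<close> are reached by moving up from
        \<open>x\<close> by at most half of the room \<open>e\<close> left inside the ball. The
        double \<open>Suc\<close> keeps the factor strictly below 1, so the sequence stays in
        \<open>ball p r\<close>.\<close>
      define e where "e = (r - dist p x)"
      have e: "e > 0" using assms by (simp add: e_def)
      let ?x = "\<lambda>n. B (lift3 (base x) (height x + e * inverse (real (Suc (Suc n)))))"
      have "?x n = x + (e * inverse (real (Suc (Suc n)))) *\<^sub>R B (lift3 0 1)" for n
      proof -
        have "lift3 (base x) (height x + e * inverse (real (Suc (Suc n))))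
          = lift3 (base x) (height x) + (e * inverse (real (Suc (Suc n)))) *\<^sub>R lift3 0 1"
          by (simp add: vec_eq_iff forall_3 del: of_nat_Suc)
        then show ?thesis by (simp add: linear_add[OF linB] linear_scale[OF linB] B_lift3_eq del: of_nat_Suc)
      qed
      note xn = this
      have n1: "norm (lift3 0 1) = 1"
        by (rule power2_eq_imp_eq) (simp_all add: norm_lift3)
      show "?x n \<in> \<Omega>" for n
      proof -
        have "dist x (?x n) = e * inverse (real (Suc (Suc n)))"
          unfolding xn using e by (simp add: dist_norm n1 del: of_nat_Suc)
        also have "\<dots> < e * 1" using e by (intro mult_strict_left_mono) (auto simp: field_simps)
        finally have "?x n \<in> ball p r" using dist_triangle[of p "?x n" x] by (simp add: e_def)
        then show ?thesis using chart' 3 e by (simp del: of_nat_Suc)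
      qed
      have "(\<lambda>n. inverse (real (Suc (Suc n)))) \<longlonglongrightarrow> 0"
        using LIMSEQ_Suc[OF LIMSEQ_inverse_real_of_nat] by simp
      then have "(\<lambda>n. x + (e * inverse (real (Suc (Suc n)))) *\<^sub>R B (lift3 0 1)) \<longlonglongrightarrow> x + (e * 0) *\<^sub>R B (lift3 0 1)"
        by (intro tendsto_intros)
      then show "?x \<longlonglongrightarrow> x" unfolding xn by simp
    qed
    then show ?thesis using 3 f chart'[OF assms] by simp
  qed
qed

lemma \<phi>_frontier: "\<phi> y \<in> ball p r \<Longrightarrow> \<phi> y \<in> frontier \<Omega>"
  using frontier_iff by (simp add: \<phi>_def)

lemma frontier_eq_\<phi>: "x \<in> ball p r \<Longrightarrow> x \<in> frontier \<Omega> \<Longrightarrow> x = \<phi> (base x)"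
  using frontier_iff[of x] B_lift3_eq[of x] by (simp add: \<phi>_def)

lemma \<phi>_deriv: "(\<phi> has_derivative (\<lambda>h. B (lift3 h (\<gamma>' y h)))) (at y)"
proof -
  have "((\<lambda>y. (y, \<gamma> y)) has_derivative (\<lambda>h. (h, \<gamma>' y h))) (at y)"
    by (intro has_derivative_Pair has_derivative_ident \<gamma>_deriv)
  from bounded_linear.has_derivative[OF bounded_linear_lift3 this]
  have "((\<lambda>y. lift3 y (\<gamma> y)) has_derivative (\<lambda>h. lift3 h (\<gamma>' y h))) (at y)" by simp
  then show ?thesis
    unfolding \<phi>_def using linB linear_conv_bounded_linear bounded_linear.has_derivative by blast
qed

lemma frechet_\<phi>: "frechet_derivative \<phi> (at y) = (\<lambda>h. B (lift3 h (\<gamma>' y h)))"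
  using frechet_derivative_at[OF \<phi>_deriv] by simp

text \<open>Lagrange's identity for the tangent vectors (1, 0, a) and (0, 1, b), with a and b the
  partial slopes: (1 + a^2)(1 + b^2) - (ab)^2 = 1 + a^2 + b^2. The isometry \<open>B\<close>
  preserves all inner products involved.\<close>

lemma norm_cross_\<phi>:
  "norm (cross3 (frechet_derivative \<phi> (at y) (axis 1 1)) (frechet_derivative \<phi> (at y) (axis 2 1))) = norm (N y)"
proof -
  let ?a = "slope y $ 1" and ?b = "slope y $ 2"
  have [simp]: "slope y \<bullet> axis i 1 = slope y $ i" for i by (simp add: inner_axis)
  have ax: "axis 1 1 \<bullet> (axis 2 1 :: real^2) = 0" by (simp add: inner_axis_axis)
  have "(norm (cross3 (B (lift3 (axis 1 1) ?a)) (B (lift3 (axis 2 1) ?b))))\<^sup>2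
      = (1 + ?a\<^sup>2) * (1 + ?b\<^sup>2) - (?a * ?b)\<^sup>2"
    by (simp add: norm_cross norm_lift3 innerB inner_lift3 ax)
  also have "\<dots> = 1 + ?a\<^sup>2 + ?b\<^sup>2" by (simp add: power2_eq_square algebra_simps)
  also have "\<dots> = (norm (N y))\<^sup>2"
    by (simp only: norm_N_sq power2_norm_eq_inner[of "slope y"]) (simp add: inner_vec_def sum_2 power2_eq_square)
  finally have "(norm (cross3 (B (lift3 (axis 1 1) ?a)) (B (lift3 (axis 2 1) ?b))))\<^sup>2 = (norm (N y))\<^sup>2" .
  then show ?thesis
    by (simp add: frechet_\<phi> \<gamma>'_eq)
qed

lemma Ck_on_1_\<phi>: "Ck_on 1 U \<phi>"
proof -
  have "continuous_on U (\<lambda>x. B (lift3 v (\<gamma>' x v)))" for v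
    by (intro continuous_on_orthogonal[OF B] continuous_intros continuous_on_subset[OF \<gamma>'_cont]) auto
  moreover have "\<phi> differentiable (at x)" for x using \<phi>_deriv differentiable_def by blast
  ultimately show ?thesis unfolding One_nat_def by (simp add: frechet_\<phi>)
qed

lemma inj_\<phi>: "inj_on \<phi> U"
  by (rule inj_on_inverseI[where g = base]) (simp add: \<phi>_def)

lemma inj_frechet_\<phi>: "inj (frechet_derivative \<phi> (at y))"
  unfolding frechet_\<phi> by (rule inj_on_inverseI[where g = base]) simp

definition chart_dom :: "(real^2) set" where "chart_dom = \<phi> -` ball p r"

lemma open_chart_dom: "open chart_dom"
  unfolding chart_dom_def using cont_\<phi> open_ball by (auto intro: open_vimage)

lemma bounded_chart_dom: "chart_dom \<subseteq> cball 0 (norm p + r)"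
proof
  fix y assume "y \<in> chart_dom"
  then have "norm (\<phi> y - p) < r" by (simp add: chart_dom_def dist_norm norm_minus_commute)
  moreover have "norm (\<phi> y) \<le> norm (\<phi> y - p) + norm p" using norm_triangle_sub[of "\<phi> y" p] by simp
  moreover have "norm y \<le> norm (\<phi> y)" using abs_le_norm_lift3(2)[of y "\<gamma> y"] by (simp add: \<phi>_def)
  ultimately show "y \<in> cball 0 (norm p + r)" by simp
qed

text \<open>The surface measure is specified only on images of regular parametrizations. Being
  carried by the boundary, it sees \<open>X\<close> inside the ball only through the graph, and that
  part is the image under \<open>\<phi>\<close> of a Borel set of parameters.\<close>

lemma emeasure_surface:
  assumes S: "surface_measure_on (frontier \<Omega>) S" and X: "X \<in> sets borel"
  shows "emeasure S (X \<inter> ball p r) = (\<integral>\<^sup>+y\<in>chart_dom \<inter> \<phi> -` X. ennreal (norm (N y)) \<partial>lborel)"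
proof -
  have [measurable]: "\<phi> \<in> borel_measurable borel" using cont_\<phi> by (rule borel_measurable_continuous_onI)
  have [measurable_cong]: "sets S = sets borel" and S0: "emeasure S (- frontier \<Omega>) = 0"
    using S by (auto simp: surface_measure_on_def)
  define C where "C = chart_dom \<inter> \<phi> -` X"
  have C: "C \<in> sets borel"
    unfolding C_def using measurable_sets[of \<phi> borel borel X] X open_chart_dom by auto
  have "X \<inter> ball p r \<inter> frontier \<Omega> = \<phi> ` C"
  proof (intro equalityI subsetI)
    fix x assume "x \<in> X \<inter> ball p r \<inter> frontier \<Omega>"
    then show "x \<in> \<phi> ` C"
      using frontier_eq_\<phi>[of x] by (intro image_eqI[of _ _ "base x"]) (auto simp: C_def chart_dom_def)
  qed (use \<phi>_frontier in \<open>auto simp: C_def chart_dom_def\<close>)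
  moreover have "emeasure S (X \<inter> ball p r) = emeasure S (X \<inter> ball p r \<inter> frontier \<Omega>)"
  proof -
    have "emeasure S (X \<inter> ball p r) = emeasure S (X \<inter> ball p r - (- frontier \<Omega>))"
      using S0 X by (intro emeasure_Diff_null_set[symmetric] null_setsI) auto
    then show ?thesis by (simp add: Diff_Compl)
  qed
  moreover have "emeasure S (\<phi> ` C) = (\<integral>\<^sup>+y\<in>C. ennreal (norm (cross3 (frechet_derivative \<phi> (at y) (axis 1 1))
                                      (frechet_derivative \<phi> (at y) (axis 2 1)))) \<partial>lborel)"
  proof -
    have "\<phi> ` chart_dom \<subseteq> frontier \<Omega>" unfolding chart_dom_def using \<phi>_frontier by blast
    moreover have "C \<subseteq> chart_dom" by (auto simp: C_def)
    ultimately show ?thesis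
      using S open_chart_dom Ck_on_1_\<phi>[of chart_dom] inj_\<phi>[of chart_dom] inj_frechet_\<phi> C
      unfolding surface_measure_on_def by blast
  qed
  ultimately show ?thesis by (simp add: norm_cross_\<phi> C_def)
qed

text \<open>The density \<open>norm (N y)\<close> is continuous, hence bounded on the bounded
  parameter domain.\<close>

lemma emeasure_surface_finite:
  assumes S: "surface_measure_on (frontier \<Omega>) S"
  shows "emeasure S (ball p r) < \<infinity>"
proof -
  have "compact (N ` cball 0 (norm p + r))"
    by (intro compact_continuous_image continuous_on_subset[OF cont_N]) auto
  then obtain M where M: "\<forall>z\<in>N ` cball 0 (norm p + r). norm z \<le> M"
    using compact_imp_bounded bounded_iff by metis
  have "emeasure S (ball p r) = (\<integral>\<^sup>+y\<in>chart_dom. ennreal (norm (N y)) \<partial>lborel)"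
    using emeasure_surface[OF S, of UNIV] by simp
  also have "\<dots> \<le> (\<integral>\<^sup>+y. ennreal M * indicator (cball 0 (norm p + r)) y \<partial>(lborel :: (real^2) measure))"
  proof (rule nn_integral_mono)
    fix y show "ennreal (norm (N y)) * indicator chart_dom y \<le> ennreal M * indicator (cball 0 (norm p + r)) y"
      using M subsetD[OF bounded_chart_dom, of y] by (cases "y \<in> chart_dom") (auto simp: indicator_def intro!: ennreal_leI)
  qed
  also have "\<dots> = ennreal M * emeasure lborel (cball 0 (norm p + r) :: (real^2) set)"
    by (subst nn_integral_cmult_indicator) auto
  also have "\<dots> < \<infinity>"
    using emeasure_bounded_finite[of "cball 0 (norm p + r) :: (real^2) set"] by (auto simp: ennreal_mult_less_top)
  finally show ?thesis .
qed

lemma integral_surface: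
  fixes g :: "real^3 \<Rightarrow> 'b::{banach, second_countable_topology}"
  assumes S: "surface_measure_on (frontier \<Omega>) S" and g: "g \<in> borel_measurable borel"
    and supp: "\<And>x. x \<notin> ball p r \<Longrightarrow> g x = 0"
  shows "(\<integral>x. g x \<partial>S) = (\<integral>y. norm (N y) *\<^sub>R g (\<phi> y) \<partial>lborel)"
proof -
  have [measurable]: "\<phi> \<in> borel_measurable borel" "N \<in> borel_measurable borel" "g \<in> borel_measurable borel"
    using cont_\<phi> cont_N g by (auto intro: borel_measurable_continuous_onI)
  have [measurable_cong]: "sets S = sets borel" using S by (auto simp: surface_measure_on_def)
  have [measurable]: "chart_dom \<in> sets borel" using open_chart_dom by auto
  have ball_S: "ball p r \<in> sets S" using \<open>sets S = sets borel\<close> by simp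
  have gS: "g \<in> borel_measurable S"
    using g measurable_cong_sets[OF \<open>sets S = sets borel\<close> refl] by blast
  \<comment> \<open>The formula for sets is read as an equality of two measures, after which
    integrals of arbitrary Borel integrands transfer at once.\<close>
  have eq: "density S (indicator (ball p r))
     = distr (density lborel (\<lambda>y. ennreal (indicator chart_dom y * norm (N y)))) borel \<phi>"
  proof (rule measure_eqI)
    fix X assume "X \<in> sets (density S (indicator (ball p r)))"
    then have X [measurable]: "X \<in> sets borel" using \<open>sets S = sets borel\<close> by simp
    have "emeasure (density S (indicator (ball p r))) X = emeasure S (X \<inter> ball p r)"
    proof -
      have "emeasure (density S (indicator (ball p r))) X = (\<integral>\<^sup>+x. indicator (ball p r) x * indicator X x \<partial>S)"
        using X \<open>sets S = sets borel\<close> by (intro emeasure_density borel_measurable_indicator ball_S) simp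
      also have "\<dots> = (\<integral>\<^sup>+x. indicator (X \<inter> ball p r) x \<partial>S)"
        by (intro nn_integral_cong) (auto simp: indicator_def)
      also have "\<dots> = emeasure S (X \<inter> ball p r)"
        using X ball_S \<open>sets S = sets borel\<close> by (intro nn_integral_indicator sets.Int) simp_all
      finally show ?thesis .
    qed
    also have "\<dots> = (\<integral>\<^sup>+y\<in>chart_dom \<inter> \<phi> -` X. ennreal (norm (N y)) \<partial>lborel)"
      by (rule emeasure_surface[OF S X])
    also have "\<dots> = (\<integral>\<^sup>+y. ennreal (indicator chart_dom y * norm (N y)) * indicator (\<phi> -` X) y \<partial>lborel)"
      by (intro nn_integral_cong) (auto simp: indicator_def)
    also have "\<dots> = emeasure (distr (density lborel (\<lambda>y. ennreal (indicator chart_dom y * norm (N y)))) borel \<phi>) X"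
      using measurable_sets[of \<phi> borel borel X] by (simp add: emeasure_distr emeasure_density)
    finally show "emeasure (density S (indicator (ball p r))) X
      = emeasure (distr (density lborel (\<lambda>y. ennreal (indicator chart_dom y * norm (N y)))) borel \<phi>) X" .
  qed (use \<open>sets S = sets borel\<close> in simp)
  have "(\<integral>x. g x \<partial>S) = (\<integral>x. indicator (ball p r) x *\<^sub>R g x \<partial>S)"
    using supp by (intro Bochner_Integration.integral_cong) (auto simp: indicator_def)
  also have "\<dots> = (\<integral>x. g x \<partial>density S (\<lambda>x. ennreal (indicator (ball p r) x)))"
    using gS ball_S by (intro integral_density[symmetric] borel_measurable_indicator) auto
  also have "\<dots> = (\<integral>x. g x \<partial>distr (density lborel (\<lambda>y. ennreal (indicator chart_dom y * norm (N y)))) borel \<phi>)"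
    using eq by (simp add: ennreal_indicator)
  also have "\<dots> = (\<integral>y. g (\<phi> y) \<partial>density lborel (\<lambda>y. ennreal (indicator chart_dom y * norm (N y))))"
    by (rule integral_distr) auto
  also have "\<dots> = (\<integral>y. (indicator chart_dom y * norm (N y)) *\<^sub>R g (\<phi> y) \<partial>lborel)"
    by (rule integral_density) auto
  also have "\<dots> = (\<integral>y. norm (N y) *\<^sub>R g (\<phi> y) \<partial>lborel)"
    using supp by (intro Bochner_Integration.integral_cong) (auto simp: indicator_def chart_dom_def)
  finally show ?thesis .
qed

end

section \<open>The outward normal as a first-order condition\<close>

definition is_outward_normal :: "(real^3) set \<Rightarrow> real^3 \<Rightarrow> real^3 \<Rightarrow> bool" where
  "is_outward_normal \<Omega> x n \<longleftrightarrow> norm n = 1 \<and>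
        (\<forall>\<epsilon>>0. \<forall>\<^sub>F y in at x.
           ((y - x) \<bullet> n < - \<epsilon> * norm (y - x) \<longrightarrow> y \<in> \<Omega>) \<and>
           ((y - x) \<bullet> n > \<epsilon> * norm (y - x) \<longrightarrow> y \<notin> \<Omega>))"

lemma outward_normal_eq: "outward_normal \<Omega> x = (THE n. is_outward_normal \<Omega> x n)"
  by (simp add: outward_normal_def is_outward_normal_def)

text \<open>The conditions on a normal are homogeneous in \<open>y - x\<close>, so a single point of
  a ray, close enough to \<open>x\<close>, decides them for the whole direction.\<close>

lemma eventually_at_ray:
  fixes x d :: "'a::real_normed_vector"
  assumes "\<forall>\<^sub>F y in at x. P y" "d \<noteq> 0"
  obtains s where "s > 0" "P (x + s *\<^sub>R d)"
proof -
  obtain \<delta> where \<delta>: "\<delta> > 0" "\<And>y. y \<noteq> x \<Longrightarrow> dist y x < \<delta> \<Longrightarrow> P y"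
    using assms(1) unfolding eventually_at by blast
  define s where "s = \<delta> / (2 * norm d)"
  have "s > 0" using \<delta> assms(2) by (simp add: s_def)
  moreover have "dist (x + s *\<^sub>R d) x < \<delta>"
    using \<delta>(1) assms(2) by (simp add: dist_norm s_def)
  ultimately show ?thesis using assms(2) by (intro that[of s] \<delta>(2)) auto
qed

lemma is_outward_normal_unique:
  assumes "is_outward_normal \<Omega> x n" "is_outward_normal \<Omega> x m"
  shows "n = m"
proof (rule ccontr)
  assume "n \<noteq> m"
  \<comment> \<open>Along \<open>m - n\<close> two distinct unit normals disagree: the product with
    \<open>m\<close> is \<open>1 - n \<bullet> m > 0\<close> and the product with \<open>n\<close>
    is its negative. One normal puts the ray inside \<open>\<Omega>\<close>, the other
    outside.\<close>
  define d where "d = m - n"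
  have d: "d \<noteq> 0" using \<open>n \<noteq> m\<close> by (simp add: d_def)
  have nn: "n \<bullet> n = 1" "m \<bullet> m = 1"
    using assms by (auto simp: is_outward_normal_def norm_eq_1)
  have "d \<bullet> d > 0" using d by simp
  then have lt: "n \<bullet> m < 1" using nn by (simp add: d_def inner_diff inner_commute)
  \<comment> \<open>Chosen so that \<open>\<epsilon> * norm d\<close> is half of the gap
    \<open>1 - n \<bullet> m\<close>, which leaves both inequalities strict.\<close>
  define \<epsilon> where "\<epsilon> = (1 - n \<bullet> m) / (2 * norm d)"
  have \<epsilon>: "\<epsilon> > 0" using lt d by (simp add: \<epsilon>_def)
  have "\<forall>\<^sub>F y in at x. ((y - x) \<bullet> n < - \<epsilon> * norm (y - x) \<longrightarrow> y \<in> \<Omega>) \<and> ((y - x) \<bullet> m > \<epsilon> * norm (y - x) \<longrightarrow> y \<notin> \<Omega>)"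
  proof -
    have "\<forall>\<^sub>F y in at x. (y - x) \<bullet> n < - \<epsilon> * norm (y - x) \<longrightarrow> y \<in> \<Omega>"
      using assms(1) \<epsilon> unfolding is_outward_normal_def by (simp add: eventually_conj_iff)
    moreover have "\<forall>\<^sub>F y in at x. (y - x) \<bullet> m > \<epsilon> * norm (y - x) \<longrightarrow> y \<notin> \<Omega>"
      using assms(2) \<epsilon> unfolding is_outward_normal_def by (simp add: eventually_conj_iff)
    ultimately show ?thesis by eventually_elim blast
  qed
  from eventually_at_ray[OF this d] obtain s where s: "s > 0"
    "(s *\<^sub>R d) \<bullet> n < - \<epsilon> * norm (s *\<^sub>R d) \<longrightarrow> x + s *\<^sub>R d \<in> \<Omega>"
    "(s *\<^sub>R d) \<bullet> m > \<epsilon> * norm (s *\<^sub>R d) \<longrightarrow> x + s *\<^sub>R d \<notin> \<Omega>" by auto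
  have "\<epsilon> * norm d = (1 - n \<bullet> m) / 2" using d by (simp add: \<epsilon>_def)
  then have e: "\<epsilon> * norm (s *\<^sub>R d) = s * ((1 - n \<bullet> m) / 2)" using s(1) by (simp add: mult.left_commute)
  have "(s *\<^sub>R d) \<bullet> n = - (s * (1 - n \<bullet> m))" "(s *\<^sub>R d) \<bullet> m = s * (1 - n \<bullet> m)"
    using nn by (simp_all add: d_def inner_diff inner_commute algebra_simps)
  moreover have "s * (1 - n \<bullet> m) > 0" using s(1) lt by simp
  ultimately have "(s *\<^sub>R d) \<bullet> n < - (\<epsilon> * norm (s *\<^sub>R d))" "(s *\<^sub>R d) \<bullet> m > \<epsilon> * norm (s *\<^sub>R d)"
    unfolding e by linarith+
  then show False using s by simp
qed

lemma outward_normal_eqI: "is_outward_normal \<Omega> x n \<Longrightarrow> outward_normal \<Omega> x = n"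
  unfolding outward_normal_eq using is_outward_normal_unique by blast

text \<open>The set is met along \<open>- n\<close> and left along \<open>n\<close> arbitrarily
  close to \<open>x\<close>, so \<open>x\<close> can be neither interior nor exterior.\<close>

lemma is_outward_normal_imp_frontier:
  assumes "is_outward_normal \<Omega> x n"
  shows "x \<in> frontier \<Omega>"
proof -
  have "norm n = 1" using assms by (simp add: is_outward_normal_def)
  then have nn: "n \<bullet> n = 1" "norm n = 1" "n \<noteq> 0" by (simp_all add: norm_eq_1[symmetric]) auto
  have ev: "\<forall>\<^sub>F y in at x. ((y - x) \<bullet> n < - (1/2) * norm (y - x) \<longrightarrow> y \<in> \<Omega>) \<and> ((y - x) \<bullet> n > 1/2 * norm (y - x) \<longrightarrow> y \<notin> \<Omega>)"
    using assms unfolding is_outward_normal_def by (elim conjE allE[of _ "1/2"]) simp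
  show ?thesis
  proof (rule ccontr)
    assume "x \<notin> frontier \<Omega>"
    then consider "x \<in> interior \<Omega>" | "x \<in> interior (- \<Omega>)"
      by (auto simp: frontier_def interior_closure)
    then show False
    proof cases
      case 1
      have "\<forall>\<^sub>F y in at x. y \<in> \<Omega>"
        by (rule eventually_mono[OF eventually_at_in_open'[OF open_interior 1]]) (use interior_subset in blast)
      with ev have "\<forall>\<^sub>F y in at x. \<not> (y - x) \<bullet> n > 1/2 * norm (y - x)"
        by eventually_elim blast
      from eventually_at_ray[OF this \<open>n \<noteq> 0\<close>] obtain s where "s > 0" "\<not> (s *\<^sub>R n) \<bullet> n > 1/2 * norm (s *\<^sub>R n)"
        by auto
      then show False using nn by simp
    next
      case 2
      have "\<forall>\<^sub>F y in at x. y \<notin> \<Omega>"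
        by (rule eventually_mono[OF eventually_at_in_open'[OF open_interior 2]]) (use interior_subset in blast)
      with ev have "\<forall>\<^sub>F y in at x. \<not> (y - x) \<bullet> n < - (1/2) * norm (y - x)"
        by eventually_elim blast
      from eventually_at_ray[OF this, of "- n"] \<open>n \<noteq> 0\<close> obtain s where "s > 0" "\<not> - (s *\<^sub>R n) \<bullet> n < - (1/2) * norm (s *\<^sub>R n)"
        by auto
      then show False using nn by simp
    qed
  qed
qed

text \<open>No vector fits the description there, so all points off the boundary share one
  unspecified value. Only this constancy matters: it makes the normal Borel measurable on the
  complement of the boundary.\<close>

lemma outward_normal_off_frontier:
  "x \<notin> frontier \<Omega> \<Longrightarrow> outward_normal \<Omega> x = (THE n. False)"
  unfolding outward_normal_eq using is_outward_normal_imp_frontier by metis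

context boundary_chart
begin

text \<open>With \<open>h\<close>, \<open>t\<close> the displacement in chart coordinates,
  \<open>(x - \<phi> y) \<bullet> N y\<close> equals \<open>slope y \<bullet> h - t\<close>, which
  differs from \<open>\<gamma> (base x) - height x\<close> by the linearization error of
  \<open>\<gamma>\<close>. Once the product exceeds that error in size, its sign tells on which side
  of the graph \<open>x\<close> lies.\<close>

lemma outward_normal_\<phi>:
  assumes y: "\<phi> y \<in> ball p r"
  shows "outward_normal \<Omega> (\<phi> y) = N y /\<^sub>R norm (N y)"
proof (rule outward_normal_eqI)
  show "is_outward_normal \<Omega> (\<phi> y) (N y /\<^sub>R norm (N y))"
    unfolding is_outward_normal_def
  proof (intro conjI allI impI)
    show "norm (N y /\<^sub>R norm (N y)) = 1" using N_nz[of y] by simp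
    fix \<epsilon> :: real assume \<epsilon>: "\<epsilon> > 0"
    \<comment> \<open>The tolerance carries the factor \<open>norm (N y)\<close> because the normal
      is divided by it.\<close>
    have "\<epsilon> * norm (N y) > 0" using \<epsilon> N_nz by simp
    then have "\<exists>\<delta>>0. \<forall>y'. norm (y' - y) < \<delta> \<longrightarrow>
        norm (\<gamma> y' - \<gamma> y - \<gamma>' y (y' - y)) \<le> (\<epsilon> * norm (N y)) * norm (y' - y)"
      by (rule \<gamma>_deriv[of y, unfolded has_derivative_at_alt, THEN conjunct2, THEN spec, THEN mp])
    then obtain \<delta> where \<delta>: "\<delta> > 0" 
      "\<And>y'. norm (y' - y) < \<delta> \<Longrightarrow> norm (\<gamma> y' - \<gamma> y - \<gamma>' y (y' - y)) \<le> (\<epsilon> * norm (N y)) * norm (y' - y)"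
      by (elim exE conjE) simp
    have "\<forall>\<^sub>F x in at (\<phi> y). x \<in> ball p r"
      by (rule eventually_at_in_open'[OF open_ball y])
    moreover have "\<forall>\<^sub>F x in at (\<phi> y). dist x (\<phi> y) < \<delta>"
      using eventually_at_in_open'[OF open_ball, of "\<phi> y" "\<phi> y" \<delta>] \<delta>(1) by (simp add: dist_commute)
    ultimately show "\<forall>\<^sub>F x in at (\<phi> y). 
       ((x - \<phi> y) \<bullet> (N y /\<^sub>R norm (N y)) < - \<epsilon> * norm (x - \<phi> y) \<longrightarrow> x \<in> \<Omega>) \<and>
       ((x - \<phi> y) \<bullet> (N y /\<^sub>R norm (N y)) > \<epsilon> * norm (x - \<phi> y) \<longrightarrow> x \<notin> \<Omega>)"
    proof eventually_elim
      case (elim x)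
      define h where "h = base x - y"
      define t where "t = height x - \<gamma> y"
      have xe: "x = B (lift3 (base x) (height x))" by (simp add: B_lift3_eq)
      have "lift3 (base x) (height x) - lift3 y (\<gamma> y) = lift3 h t"
        by (simp add: h_def t_def vec_eq_iff forall_3)
      then have d: "x - \<phi> y = B (lift3 h t)"
        by (subst xe) (simp add: \<phi>_def linear_diff[OF linB, symmetric])
      have nd: "norm (x - \<phi> y) = norm (lift3 h t)" by (simp add: d)
      have hle: "norm h \<le> norm (x - \<phi> y)" unfolding nd by (rule abs_le_norm_lift3)
      have "norm h < \<delta>" using hle elim(2) by (simp add: dist_norm)
      then have err: "\<bar>\<gamma> (base x) - \<gamma> y - slope y \<bullet> h\<bar> \<le> \<epsilon> * norm (N y) * norm (x - \<phi> y)"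
      proof -
        have "\<bar>\<gamma> (base x) - \<gamma> y - slope y \<bullet> h\<bar> \<le> \<epsilon> * norm (N y) * norm h"
          using \<delta>(2)[of "base x"] \<open>norm h < \<delta>\<close> by (simp add: h_def \<gamma>'_eq)
        also have "\<dots> \<le> \<epsilon> * norm (N y) * norm (x - \<phi> y)"
          using \<epsilon> by (intro mult_left_mono[OF hle]) simp
        finally show ?thesis .
      qed
      have inn: "(x - \<phi> y) \<bullet> N y = slope y \<bullet> h - t"
        unfolding d N_def innerB inner_lift3 by (simp add: inner_commute)
      have inn': "(x - \<phi> y) \<bullet> (N y /\<^sub>R norm (N y)) = (slope y \<bullet> h - t) / norm (N y)"
        using inn by (simp add: divide_inverse mult.commute)
      show ?case
      proof (intro conjI impI)
        assume "(x - \<phi> y) \<bullet> (N y /\<^sub>R norm (N y)) < - \<epsilon> * norm (x - \<phi> y)"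
        then have "slope y \<bullet> h - t < - (\<epsilon> * norm (N y) * norm (x - \<phi> y))"
          using N_nz[of y] unfolding inn' by (simp add: field_simps)
        then have "\<gamma> (base x) < height x" using err by (auto simp: t_def)
        then show "x \<in> \<Omega>" using chart'[OF elim(1)] by simp
      next
        assume "(x - \<phi> y) \<bullet> (N y /\<^sub>R norm (N y)) > \<epsilon> * norm (x - \<phi> y)"
        then have "slope y \<bullet> h - t > \<epsilon> * norm (N y) * norm (x - \<phi> y)"
          using N_nz[of y] unfolding inn' by (simp add: field_simps)
        then have "\<gamma> (base x) > height x" using err by (auto simp: t_def)
        then show "x \<notin> \<Omega>" using chart'[OF elim(1)] by simp
      qed
    qed
  qed
qed

lemma measurable_outward_normal_local:
  "outward_normal \<Omega> \<in> borel_measurable (restrict_space borel (ball p r))"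
proof -
  have [measurable]: "N \<in> borel_measurable borel" "base \<in> borel_measurable borel"
    using cont_N cont_base by (auto intro: borel_measurable_continuous_onI)
  have [measurable]: "frontier \<Omega> \<in> sets borel" by auto
  have "(\<lambda>x. if x \<in> frontier \<Omega> then N (base x) /\<^sub>R norm (N (base x)) else (THE n. False)) \<in> borel_measurable borel"
    by measurable
  then have "(\<lambda>x. if x \<in> frontier \<Omega> then N (base x) /\<^sub>R norm (N (base x)) else (THE n. False)) \<in> borel_measurable (restrict_space borel (ball p r))"
    by (rule measurable_restrict_space1)
  moreover have "outward_normal \<Omega> x = (if x \<in> frontier \<Omega> then N (base x) /\<^sub>R norm (N (base x)) else (THE n. False))"
    if "x \<in> ball p r" for x
    using that outward_normal_\<phi>[of "base x"] frontier_eq_\<phi>[of x] outward_normal_off_frontier by auto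
  ultimately show ?thesis
    by (subst measurable_cong) (auto simp: space_restrict_space)
qed

lemma divergence_theorem_local:
  fixes f :: "real^3 \<Rightarrow> complex"
  assumes S: "surface_measure_on (frontier \<Omega>) S"
    and fd: "\<And>x. (f has_derivative f' x) (at x)" and fc: "\<And>v. continuous_on UNIV (\<lambda>x. f' x v)"
    and supp: "\<And>x. x \<notin> cball p r' \<Longrightarrow> f x = 0" and r': "r' < r"
    and meas: "outward_normal \<Omega> \<in> borel_measurable borel"
  shows "(\<integral>x. indicator \<Omega> x *\<^sub>R f' x e \<partial>lborel) = (\<integral>x. (e \<bullet> outward_normal \<Omega> x) *\<^sub>R f x \<partial>S)"
proof -
  define d c where "d = base e" and "c = height e"
  have e: "e = B (lift3 d c)" by (simp add: d_def c_def B_lift3_eq)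
  define W where "W = {x. \<gamma> (base x) < height x}"
  have cf: "continuous_on UNIV f"
    by (intro continuous_at_imp_continuous_on ballI has_derivative_continuous[OF fd])
  have f'0: "f' x v = 0" if "x \<notin> cball p r'" for x v
  proof -
    have "((\<lambda>_. 0) has_derivative f' x) (at x)"
      using that supp by (intro has_derivative_transform_within_open[OF fd[of x], of "- cball p r'"]) auto
    then have "f' x = (\<lambda>_. 0)" by (rule has_derivative_unique) (rule has_derivative_const)
    then show ?thesis by simp
  qed
  \<comment> \<open>\<open>f'\<close> vanishes off the smaller ball, so \<open>\<Omega>\<close> may
    be replaced by the full region above the graph; the gap between \<open>r'\<close> and
    \<open>r\<close> keeps the whole support inside the chart.\<close>
  have "(\<integral>x. indicator \<Omega> x *\<^sub>R f' x e \<partial>lborel) = (\<integral>x. indicator W x *\<^sub>R f' x e \<partial>lborel)"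
  proof (rule Bochner_Integration.integral_cong[OF refl])
    fix x show "indicator \<Omega> x *\<^sub>R f' x e = indicator W x *\<^sub>R f' x e"
      using f'0[of x] r' chart'[of x] by (cases "x \<in> cball p r'") (auto simp: indicator_def W_def)
  qed
  also have "\<dots> = (\<integral>y. (\<gamma>' y d - c) *\<^sub>R f (B (lift3 y (\<gamma> y))) \<partial>lborel)"
  proof (rule divergence_theorem_graph[OF B fd fc \<gamma>_deriv \<gamma>'_cont _ _ _ e])
    show "f x = 0" if "norm x > norm p + r'" for x
    proof (rule supp)
      have "norm x \<le> norm p + dist p x"
        using norm_triangle_sub[of x p] by (simp add: dist_norm norm_minus_commute)
      then show "x \<notin> cball p r'" using that by auto
    qed
    have "open W" unfolding W_def
      by (intro open_Collect_less cont_height continuous_on_compose2[OF cont_\<gamma> cont_base]) auto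
    then show "W \<in> sets borel" by auto
  qed (simp add: W_def)
  also have "\<dots> = (\<integral>y. norm (N y) *\<^sub>R ((e \<bullet> outward_normal \<Omega> (\<phi> y)) *\<^sub>R f (\<phi> y)) \<partial>lborel)"
  proof (rule Bochner_Integration.integral_cong[OF refl])
    fix y
    \<comment> \<open>The flattened boundary integrand is the unnormalized flux; writing
      \<open>N y\<close> as its length times the unit normal brings in the area density.\<close>
    have "e \<bullet> N y = \<gamma>' y d - c"
      unfolding e N_def innerB inner_lift3 by (simp add: \<gamma>'_eq inner_commute)
    then show "(\<gamma>' y d - c) *\<^sub>R f (B (lift3 y (\<gamma> y))) = norm (N y) *\<^sub>R ((e \<bullet> outward_normal \<Omega> (\<phi> y)) *\<^sub>R f (\<phi> y))"
      using outward_normal_\<phi>[of y] N_nz[of y] supp[of "\<phi> y"] r'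
      by (cases "\<phi> y \<in> cball p r'") (auto simp: \<phi>_def[symmetric])
  qed
  also have "\<dots> = (\<integral>x. (e \<bullet> outward_normal \<Omega> x) *\<^sub>R f x \<partial>S)"
  proof (rule integral_surface[OF S, symmetric])
    have [measurable]: "f \<in> borel_measurable borel" using cf by (rule borel_measurable_continuous_onI)
    show "(\<lambda>x. (e \<bullet> outward_normal \<Omega> x) *\<^sub>R f x) \<in> borel_measurable borel"
      using meas by measurable
    show "(e \<bullet> outward_normal \<Omega> x) *\<^sub>R f x = 0" if "x \<notin> ball p r" for x
      using supp[of x] that r' by auto
  qed
  finally show ?thesis .
qed

end

lemma boundary_chart_exists:
  assumes "open \<Omega>" "Ck_boundary 2 \<Omega>" "p \<in> frontier \<Omega>"
  obtains r A B \<gamma> \<gamma>' where "boundary_chart \<Omega> p r A B \<gamma> \<gamma>'"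
proof -
  obtain r and A :: "real^3 \<Rightarrow> real^3" and \<gamma> :: "real^2 \<Rightarrow> real"
    where r: "r > 0" and A: "orthogonal_transformation A" and \<gamma>: "Ck_on 2 UNIV \<gamma>"
    and ch: "\<Omega> \<inter> ball p r = {x \<in> ball p r. \<gamma> (vector [A x $ 1, A x $ 2]) < A x $ 3}"
    using assms(2,3) unfolding Ck_boundary_def by meson
  have inj: "inj A" "surj A" using A orthogonal_transformation_inj orthogonal_transformation_surj by blast+
  have "boundary_chart \<Omega> p r A (inv A) \<gamma> (\<lambda>y. frechet_derivative \<gamma> (at y))"
  proof
    show "orthogonal_transformation (inv A)" using A by (rule orthogonal_transformation_inv)
    show "inv A (A x) = x" "A (inv A x) = x" for x using inj by (auto simp: surj_f_inv_f)
    have C: "\<gamma> differentiable (at y)" "Ck_on (Suc 0) UNIV (\<lambda>x. frechet_derivative \<gamma> (at x) v)" for y v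
      using \<gamma> by (auto simp: numeral_2_eq_2)
    show "(\<gamma> has_derivative frechet_derivative \<gamma> (at y)) (at y)" for y
      using C(1) frechet_derivative_works by blast
    \<comment> \<open>Second-order regularity enters here: the first derivatives of
      \<open>\<gamma>\<close> are differentiable, hence continuous.\<close>
    have "(\<lambda>x. frechet_derivative \<gamma> (at x) v) differentiable (at y)" for y v
      using C(2) by simp
    then show "continuous_on UNIV (\<lambda>y. frechet_derivative \<gamma> (at y) v)" for v
      by (intro continuous_at_imp_continuous_on ballI differentiable_imp_continuous_within)
    show "x \<in> \<Omega> \<longleftrightarrow> \<gamma> (vector [A x $ 1, A x $ 2]) < A x $ 3" if "x \<in> ball p r" for x
      using that ch by blast
  qed (use assms r A in auto)
  then show ?thesis by (rule that)
qed

section \<open>The divergence theorem on a \<open>C\<^sup>2\<close> domain\<close>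

text \<open>The derivative is carried as an explicit function, so that the product and chain rules
  compute it. Continuity is asked for each direction separately, which in finite dimension is
  continuity of the derivative.\<close>

definition C1_deriv :: "('a::euclidean_space \<Rightarrow> 'b::real_normed_vector) \<Rightarrow> ('a \<Rightarrow> 'a \<Rightarrow> 'b) \<Rightarrow> bool" where
  "C1_deriv f f' \<longleftrightarrow> (\<forall>x. (f has_derivative f' x) (at x)) \<and> (\<forall>v. continuous_on UNIV (\<lambda>x. f' x v))"

lemma C1_derivD:
  assumes "C1_deriv f f'"
  shows "(f has_derivative f' x) (at x)" "continuous_on UNIV (\<lambda>x. f' x v)" "continuous_on UNIV f"
proof -
  show 1: "(f has_derivative f' x) (at x)" "continuous_on UNIV (\<lambda>x. f' x v)" for x
    using assms by (auto simp: C1_deriv_def)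
  show "continuous_on UNIV f"
    by (intro continuous_at_imp_continuous_on ballI has_derivative_continuous[OF 1(1)])
qed

lemma C1_deriv_const: "C1_deriv (\<lambda>x. c) (\<lambda>x v. 0)"
  by (simp add: C1_deriv_def)

lemma C1_deriv_diff:
  assumes "C1_deriv f f'" "C1_deriv g g'"
  shows "C1_deriv (\<lambda>x. f x - g x) (\<lambda>x v. f' x v - g' x v)"
  using assms by (auto simp: C1_deriv_def intro!: has_derivative_diff continuous_intros)

lemma C1_deriv_add:
  assumes "C1_deriv f f'" "C1_deriv g g'"
  shows "C1_deriv (\<lambda>x. f x + g x) (\<lambda>x v. f' x v + g' x v)"
  using assms by (auto simp: C1_deriv_def intro!: has_derivative_add continuous_intros)

lemma C1_deriv_scaleR:
  assumes "C1_deriv f f'" "C1_deriv g g'"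
  shows "C1_deriv (\<lambda>x. f x *\<^sub>R g x) (\<lambda>x v. f x *\<^sub>R g' x v + f' x v *\<^sub>R g x)"
  using assms(1)[THEN C1_derivD(3)] assms(2)[THEN C1_derivD(3)] assms
  by (auto simp: C1_deriv_def intro!: has_derivative_scaleR continuous_intros)

lemma C1_deriv_mult:
  fixes f g :: "'a::euclidean_space \<Rightarrow> 'b::real_normed_algebra"
  assumes "C1_deriv f f'" "C1_deriv g g'"
  shows "C1_deriv (\<lambda>x. f x * g x) (\<lambda>x v. f x * g' x v + f' x v * g x)"
  using assms(1)[THEN C1_derivD(3)] assms(2)[THEN C1_derivD(3)] assms
  by (auto simp: C1_deriv_def intro!: has_derivative_mult continuous_intros)

lemma C1_deriv_compose_real:
  assumes "C1_deriv f f'" "\<And>t. (g has_real_derivative g' t) (at t)" "continuous_on UNIV g'"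
  shows "C1_deriv (\<lambda>x. g (f x)) (\<lambda>x v. g' (f x) * f' x v)"
  unfolding C1_deriv_def
proof (intro conjI allI)
  fix x show "((\<lambda>x. g (f x)) has_derivative (\<lambda>v. g' (f x) * f' x v)) (at x)"
    using has_derivative_compose[OF C1_derivD(1)[OF assms(1)] assms(2)[unfolded has_field_derivative_def]] by simp
next
  fix v show "continuous_on UNIV (\<lambda>x. g' (f x) * f' x v)"
    by (intro continuous_intros C1_derivD(2)[OF assms(1)] continuous_on_compose2[OF assms(3) C1_derivD(3)[OF assms(1)]]) auto
qed

lemma C1_deriv_inverse:
  fixes f :: "'a::euclidean_space \<Rightarrow> real"
  assumes "C1_deriv f f'" "\<And>x. f x \<noteq> 0"
  shows "C1_deriv (\<lambda>x. inverse (f x)) (\<lambda>x v. - (inverse (f x) * f' x v * inverse (f x)))"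
  using assms(1)[THEN C1_derivD(3)] assms
  by (auto simp: C1_deriv_def intro!: has_derivative_inverse continuous_intros)

text \<open>Squaring the positive part makes it continuously differentiable, which is the smoothness
  the cutoffs require; at 0 the difference quotient is bounded by the size of
  \<open>h\<close>.\<close>

lemma max0_squared_deriv: "((\<lambda>t::real. (max 0 t)\<^sup>2) has_real_derivative 2 * max 0 t) (at t)"
proof -
  consider "t > 0" | "t < 0" | "t = 0" by linarith
  then show ?thesis
  proof cases
    case 1
    have "((\<lambda>t::real. t\<^sup>2) has_real_derivative 2 * max 0 t) (at t)"
      using 1 by (auto intro!: derivative_eq_intros)
    then show ?thesis
      by (rule has_field_derivative_transform_within_open[of _ _ _ "{0<..}"]) (use 1 in auto)
  next
    case 2
    have "((\<lambda>t::real. 0) has_real_derivative 2 * max 0 t) (at t)"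
      using 2 by (auto intro!: derivative_eq_intros)
    then show ?thesis
      by (rule has_field_derivative_transform_within_open[of _ _ _ "{..<0}"]) (use 2 in auto)
  next
    case 3
    have "((\<lambda>h::real. max 0 h * (max 0 h / h)) \<longlongrightarrow> 0) (at 0)"
    proof (rule Lim_null_comparison)
      show "\<forall>\<^sub>F h::real in at 0. norm (max 0 h * (max 0 h / h)) \<le> \<bar>h\<bar>"
        by (intro always_eventually allI) (auto simp: max_def)
      show "((\<lambda>h::real. \<bar>h\<bar>) \<longlongrightarrow> 0) (at 0)" by (auto intro!: tendsto_eq_intros)
    qed
    then show ?thesis using 3 by (simp add: DERIV_def power2_eq_square)
  qed
qed

lemma C1_deriv_norm_sq: "C1_deriv (\<lambda>x. (norm (x - p))\<^sup>2) (\<lambda>x v. 2 * ((x - p) \<bullet> v))"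
  unfolding C1_deriv_def power2_norm_eq_inner
  by (auto intro!: derivative_eq_intros continuous_intros simp: inner_commute algebra_simps)

text \<open>The cutoff is a quotient of squared positive parts in the squared distance. The
  thresholds \<open>r^2/2\<close> and \<open>r^2/4\<close> overlap, so the denominator never
  vanishes; the value is 1 within radius \<open>r/2\<close> and 0 from radius
  \<open>r / sqrt 2\<close> on, which is below \<open>3/4 * r\<close> because 1/2 < 9/16.\<close>

lemma C1_bump_exists:
  fixes p :: "'a::euclidean_space"
  assumes "r > 0"
  obtains \<psi> \<psi>' where "C1_deriv \<psi> \<psi>'" "\<And>x. x \<in> ball p (r/2) \<Longrightarrow> \<psi> x = (1::real)"
    "\<And>x. x \<notin> cball p (3/4 * r) \<Longrightarrow> \<psi> x = 0"
proof -
  let ?g = "\<lambda>t::real. (max 0 t)\<^sup>2"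
  define n where "n x = (norm (x - p))\<^sup>2" for x
  have n: "C1_deriv n (\<lambda>x v. 2 * ((x - p) \<bullet> v))" unfolding n_def by (rule C1_deriv_norm_sq)
  have cg: "continuous_on UNIV (\<lambda>t::real. 2 * max 0 t)" by (intro continuous_intros)
  note G = C1_deriv_compose_real[OF _ max0_squared_deriv cg]
  note G1 = G[OF C1_deriv_diff[OF C1_deriv_const[of "r\<^sup>2/2"] n]]
  note G2 = G[OF C1_deriv_diff[OF n C1_deriv_const[of "r\<^sup>2/4"]]]
  have nz: "?g (r\<^sup>2/2 - n x) + ?g (n x - r\<^sup>2/4) \<noteq> 0" for x
  proof -
    have "r\<^sup>2 > 0" using assms by simp
    then have "r\<^sup>2/2 - n x > 0 \<or> n x - r\<^sup>2/4 > 0" by linarith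
    then have "?g (r\<^sup>2/2 - n x) > 0 \<or> ?g (n x - r\<^sup>2/4) > 0" by (auto simp: max_def)
    then show ?thesis by (metis add_nonneg_eq_0_iff less_irrefl zero_le_power2)
  qed
  note C = C1_deriv_mult[OF G1 C1_deriv_inverse[OF C1_deriv_add[OF G1 G2] nz]]
  show ?thesis
  proof (rule that[OF C])
    fix x assume "x \<in> ball p (r/2)"
    then have "(norm (x - p))\<^sup>2 < (r/2)\<^sup>2" by (intro power_strict_mono) (auto simp: dist_norm norm_minus_commute)
    then have "n x - r\<^sup>2/4 < 0" by (simp add: n_def power_divide)
    then have "?g (n x - r\<^sup>2/4) = 0" by (simp add: max_def)
    then show "?g (r\<^sup>2/2 - n x) * inverse (?g (r\<^sup>2/2 - n x) + ?g (n x - r\<^sup>2/4)) = 1"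
      using nz[of x] by simp
  next
    fix x assume "x \<notin> cball p (3/4 * r)"
    then have "(3/4 * r)\<^sup>2 < (norm (x - p))\<^sup>2" using assms by (intro power_strict_mono) (auto simp: dist_norm norm_minus_commute)
    then have "9/16 * r\<^sup>2 < n x" by (simp add: n_def power_mult_distrib power_divide)
    moreover have "r\<^sup>2 > 0" using assms by simp
    ultimately have "r\<^sup>2/2 - n x < 0" by linarith
    then show "?g (r\<^sup>2/2 - n x) * inverse (?g (r\<^sup>2/2 - n x) + ?g (n x - r\<^sup>2/4)) = 0"
      by (simp add: max_def)
  qed
qed

section \<open>From charts to the whole domain\<close>

locale C2_domain =
  fixes \<Omega> :: "(real^3) set" and S :: "(real^3) measure"
  assumes open_\<Omega>: "open \<Omega>" and bounded_\<Omega>: "bounded \<Omega>" and C2: "Ck_boundary 2 \<Omega>"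
    and S: "surface_measure_on (frontier \<Omega>) S"
begin

lemma compact_frontier: "compact (frontier \<Omega>)"
  using bounded_\<Omega> by (simp add: compact_frontier_bounded)

lemma sets_S [measurable_cong, simp]: "sets S = sets borel" and space_S [simp]: "space S = UNIV"
proof -
  show "sets S = sets borel" using S unfolding surface_measure_on_def by blast
  from sets_eq_imp_space_eq[OF this] show "space S = UNIV" by simp
qed

lemma measurable_S: "measurable S M = measurable borel M"
  by (rule measurable_cong_sets) simp_all

lemma AE_frontier: "AE x in S. x \<in> frontier \<Omega>"
proof (rule AE_I')
  have "emeasure S (- frontier \<Omega>) = 0" using S unfolding surface_measure_on_def by blast
  then show "- frontier \<Omega> \<in> null_sets S" by (intro null_setsI) auto
qed auto

lemma frontier_cover:
  obtains F rad where "finite F" "frontier \<Omega> \<subseteq> (\<Union>p\<in>F. ball p (rad p / 2))"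
    "\<forall>p\<in>F. \<exists>A B \<gamma> \<gamma>'. boundary_chart \<Omega> p (rad p) A B \<gamma> \<gamma>'"
proof -
  have "\<forall>p\<in>frontier \<Omega>. \<exists>r. \<exists>A B \<gamma> \<gamma>'. boundary_chart \<Omega> p r A B \<gamma> \<gamma>'"
  proof
    fix p assume "p \<in> frontier \<Omega>"
    from boundary_chart_exists[OF open_\<Omega> C2 this] obtain r A B \<gamma> \<gamma>'
      where "boundary_chart \<Omega> p r A B \<gamma> \<gamma>'" .
    then show "\<exists>r. \<exists>A B \<gamma> \<gamma>'. boundary_chart \<Omega> p r A B \<gamma> \<gamma>'" by (intro exI)
  qed
  from bchoice[OF this] obtain rad
    where rad: "\<And>p. p \<in> frontier \<Omega> \<Longrightarrow> \<exists>A B \<gamma> \<gamma>'. boundary_chart \<Omega> p (rad p) A B \<gamma> \<gamma>'"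
    by blast
  then have pos: "rad p > 0" if "p \<in> frontier \<Omega>" for p using that boundary_chart.r_pos by blast
  obtain F where F: "F \<subseteq> frontier \<Omega>" "finite F" "frontier \<Omega> \<subseteq> (\<Union>p\<in>F. ball p (rad p / 2))"
  proof (rule compactE_image[OF compact_frontier, of "frontier \<Omega>" "\<lambda>p. ball p (rad p / 2)"])
    show "frontier \<Omega> \<subseteq> (\<Union>p\<in>frontier \<Omega>. ball p (rad p / 2))"
    proof
      fix p assume "p \<in> frontier \<Omega>"
      then show "p \<in> (\<Union>p\<in>frontier \<Omega>. ball p (rad p / 2))"
        using pos[of p] by (intro UN_I[of p]) auto
    qed
  qed auto
  show ?thesis
  proof (rule that[OF F(2,3)], rule ballI)
    fix p assume "p \<in> F"
    then show "\<exists>A B \<gamma> \<gamma>'. boundary_chart \<Omega> p (rad p) A B \<gamma> \<gamma>'" using rad F(1) by blast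
  qed
qed

lemma measurable_outward_normal: "outward_normal \<Omega> \<in> borel_measurable borel"
proof -
  obtain F rad where F: "finite F" "frontier \<Omega> \<subseteq> (\<Union>p\<in>F. ball p (rad p / 2))"
    "\<forall>p\<in>F. \<exists>A B \<gamma> \<gamma>'. boundary_chart \<Omega> p (rad p) A B \<gamma> \<gamma>'"
    by (rule frontier_cover)
  \<comment> \<open>Off the boundary the normal is constant, and in each chart ball it has an
    explicit formula; finitely many such Borel pieces cover space.\<close>
  let ?C = "insert (- frontier \<Omega>) ((\<lambda>p. ball p (rad p)) ` F)"
  show ?thesis
  proof (rule measurable_piecewise_restrict[of ?C])
    show "countable ?C" using F(1) by (simp add: countable_finite)
    show "X \<inter> space borel \<in> sets borel" if "X \<in> ?C" for X using that by auto
    show "space borel \<subseteq> \<Union>?C"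
    proof
      fix x :: "real^3"
      show "x \<in> \<Union>?C"
      proof (cases "x \<in> frontier \<Omega>")
        case True
        then obtain p where p: "p \<in> F" "x \<in> ball p (rad p / 2)" using F(2) by auto
        then have "x \<in> ball p (rad p)" using zero_le_dist[of p x] unfolding mem_ball by linarith
        then show ?thesis using p by auto
      qed auto
    qed
    fix X assume "X \<in> ?C"
    then consider "X = - frontier \<Omega>" | p where "p \<in> F" "X = ball p (rad p)" by auto
    then show "outward_normal \<Omega> \<in> measurable (restrict_space borel X) borel"
    proof cases
      case 1
      have "(\<lambda>x. THE n::real^3. False) \<in> measurable (restrict_space borel X) borel" by simp
      then show ?thesis
        by (subst measurable_cong[where g = "\<lambda>x. THE n::real^3. False"])
          (auto simp: 1 space_restrict_space outward_normal_off_frontier)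
    next
      case 2
      then show ?thesis using F(3) boundary_chart.measurable_outward_normal_local by blast
    qed
  qed
qed

lemma norm_outward_normal: "x \<in> frontier \<Omega> \<Longrightarrow> norm (outward_normal \<Omega> x) = 1"
proof -
  assume x: "x \<in> frontier \<Omega>"
  obtain r A B \<gamma> \<gamma>' where "boundary_chart \<Omega> x r A B \<gamma> \<gamma>'" using boundary_chart_exists[OF open_\<Omega> C2 x] .
  then interpret boundary_chart \<Omega> x r A B \<gamma> \<gamma>' .
  have "x = \<phi> (base x)" using frontier_eq_\<phi>[of x] x r_pos by simp
  then have "outward_normal \<Omega> x = N (base x) /\<^sub>R norm (N (base x))"
    using outward_normal_\<phi>[of "base x"] r_pos by simp
  then show ?thesis using N_nz[of "base x"] by simp
qed

lemma finite_measure_S: "finite_measure S"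
proof (rule finite_measureI)
  obtain F rad where F: "finite F" "frontier \<Omega> \<subseteq> (\<Union>p\<in>F. ball p (rad p / 2))"
    "\<forall>p\<in>F. \<exists>A B \<gamma> \<gamma>'. boundary_chart \<Omega> p (rad p) A B \<gamma> \<gamma>'"
    by (rule frontier_cover)
  have "emeasure S (space S) \<le> emeasure S (\<Union>p\<in>F. ball p (rad p))"
  proof (rule emeasure_mono_AE)
    show "AE x in S. x \<in> space S \<longrightarrow> x \<in> (\<Union>p\<in>F. ball p (rad p))"
      using AE_frontier
    proof eventually_elim
      case (elim x)
      then obtain p where p: "p \<in> F" "dist p x < rad p / 2" using F(2) by auto
      then have "dist p x < rad p" using zero_le_dist[of p x] by linarith
      then show ?case using p by auto
    qed
    have "open (\<Union>p\<in>F. ball p (rad p))" by auto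
    then show "(\<Union>p\<in>F. ball p (rad p)) \<in> sets S" unfolding sets_S by (rule borel_open)
  qed
  also have "\<dots> \<le> (\<Sum>p\<in>F. emeasure S (ball p (rad p)))"
    using F(1) by (intro emeasure_subadditive_finite) auto
  also have "\<dots> < \<infinity>"
    using F(1,3) boundary_chart.emeasure_surface_finite[OF _ S] by (auto simp: ennreal_sum_less_top)
  finally show "emeasure S (space S) \<noteq> \<infinity>" by simp
qed

lemma integrable_S_bounded_on_frontier:
  fixes g :: "real^3 \<Rightarrow> 'b::{banach, second_countable_topology}"
  assumes "g \<in> borel_measurable borel" "\<And>x. x \<in> frontier \<Omega> \<Longrightarrow> norm (g x) \<le> M"
  shows "integrable S g"
proof -
  interpret finite_measure S by (rule finite_measure_S)
  show ?thesis
    using assms(1) AE_frontier by (intro integrable_const_bound[where B = M])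
      (auto simp: measurable_S elim!: eventually_mono intro: assms(2))
qed

lemma continuous_bounded_on_closure:
  fixes f :: "real^3 \<Rightarrow> 'b::real_normed_vector"
  assumes "continuous_on UNIV f"
  obtains M where "M \<ge> 0" "\<And>x. x \<in> closure \<Omega> \<Longrightarrow> norm (f x) \<le> M"
proof -
  have "compact (f ` closure \<Omega>)"
    using bounded_\<Omega> by (intro compact_continuous_image continuous_on_subset[OF assms]) auto
  then obtain M where M: "\<forall>z\<in>f ` closure \<Omega>. norm z \<le> M"
    using compact_imp_bounded bounded_iff by metis
  then have "norm (f x) \<le> max 0 M" if "x \<in> closure \<Omega>" for x
    using that by (auto simp: le_max_iff_disj)
  then show ?thesis by (intro that[of "max 0 M"]) auto
qed

lemma frontier_subset_closure: "frontier \<Omega> \<subseteq> closure \<Omega>" 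
  by (auto simp: frontier_def)

lemma integrable_flux:
  fixes f :: "real^3 \<Rightarrow> complex"
  assumes "continuous_on UNIV f"
  shows "integrable S (\<lambda>x. (e \<bullet> outward_normal \<Omega> x) *\<^sub>R f x)"
proof -
  obtain M where M: "M \<ge> 0" "\<And>x. x \<in> closure \<Omega> \<Longrightarrow> norm (f x) \<le> M"
    using continuous_bounded_on_closure[OF assms] by blast
  have [measurable]: "f \<in> borel_measurable borel" using assms by (rule borel_measurable_continuous_onI)
  show ?thesis
  proof (rule integrable_S_bounded_on_frontier)
    show "(\<lambda>x. (e \<bullet> outward_normal \<Omega> x) *\<^sub>R f x) \<in> borel_measurable borel"
      using measurable_outward_normal by measurable
    fix x assume x: "x \<in> frontier \<Omega>"
    have "\<bar>e \<bullet> outward_normal \<Omega> x\<bar> \<le> norm e"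
      using Cauchy_Schwarz_ineq2[of e "outward_normal \<Omega> x"] norm_outward_normal[OF x] by simp
    then show "norm ((e \<bullet> outward_normal \<Omega> x) *\<^sub>R f x) \<le> norm e * M"
      using M x frontier_subset_closure by (auto intro!: mult_mono)
  qed
qed

lemma integrable_on_\<Omega>:
  fixes f :: "real^3 \<Rightarrow> 'b::{banach, second_countable_topology}"
  assumes "continuous_on UNIV f"
  shows "integrable lborel (\<lambda>x. indicator \<Omega> x *\<^sub>R f x)"
proof -
  obtain M where M: "M \<ge> 0" "\<And>x. x \<in> closure \<Omega> \<Longrightarrow> norm (f x) \<le> M"
    using continuous_bounded_on_closure[OF assms] by blast
  have [measurable]: "f \<in> borel_measurable borel" using assms by (rule borel_measurable_continuous_onI)
  have [measurable]: "\<Omega> \<in> sets borel" using open_\<Omega> by auto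
  have "integrable lborel (\<lambda>x. indicator \<Omega> x * M)"
    using emeasure_bounded_finite[OF bounded_\<Omega>] by (intro integrable_mult_left) auto
  then show ?thesis
    by (rule Bochner_Integration.integrable_bound) (use M closure_subset in \<open>auto simp: indicator_def\<close>)
qed

text \<open>For one fixed direction \<open>e\<close> the identity is additive in \<open>f\<close>;
  the induction over a cover rests on this additivity.\<close>

definition flux_identity :: "real^3 \<Rightarrow> (real^3 \<Rightarrow> complex) \<Rightarrow> (real^3 \<Rightarrow> real^3 \<Rightarrow> complex) \<Rightarrow> bool" where
  "flux_identity e f f' \<longleftrightarrow> 
     (\<integral>x. indicator \<Omega> x *\<^sub>R f' x e \<partial>lborel) = (\<integral>x. (e \<bullet> outward_normal \<Omega> x) *\<^sub>R f x \<partial>S)"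

lemma flux_identity_add:
  assumes "C1_deriv f f'" "C1_deriv g g'" "flux_identity e f f'" "flux_identity e g g'"
  shows "flux_identity e (\<lambda>x. f x + g x) (\<lambda>x v. f' x v + g' x v)"
  using assms(3,4) integrable_on_\<Omega>[OF C1_derivD(2)[OF assms(1)], of e] integrable_on_\<Omega>[OF C1_derivD(2)[OF assms(2)], of e]
    integrable_flux[OF C1_derivD(3)[OF assms(1)], of e] integrable_flux[OF C1_derivD(3)[OF assms(2)], of e]
  by (simp add: flux_identity_def scaleR_add_right)

lemma C1_deriv_zero_on_open:
  assumes "C1_deriv f f'" "open U" "x \<in> U" "\<And>x. x \<in> U \<Longrightarrow> f x = 0"
  shows "f' x v = 0"
proof -
  have "((\<lambda>_. 0) has_derivative f' x) (at x)"
    using assms by (intro has_derivative_transform_within_open[OF C1_derivD(1)[OF assms(1)], of U]) auto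
  then have "f' x = (\<lambda>_. 0)" by (rule has_derivative_unique) (rule has_derivative_const)
  then show ?thesis by simp
qed

text \<open>Both sides vanish: the volume side because the derivative of a compactly supported
  function integrates to zero, the boundary side because the boundary lies outside the
  support.\<close>

lemma flux_identity_interior:
  assumes C: "C1_deriv f f'" and supp: "\<And>x. x \<notin> cball q r \<Longrightarrow> f x = 0" and sub: "cball q r \<subseteq> \<Omega>"
  shows "flux_identity e f f'"
proof -
  have z: "f' x v = 0" if "x \<notin> cball q r" for x v
    using that supp by (intro C1_deriv_zero_on_open[OF C, of "- cball q r"]) auto
  have out: "x \<notin> cball q r" if "norm x > norm q + r" for x
  proof -
    have "norm x \<le> norm q + dist q x"
      using norm_triangle_sub[of x q] by (simp add: dist_norm norm_minus_commute)
    then show ?thesis using that by auto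
  qed
  have "(\<integral>x. indicator \<Omega> x *\<^sub>R f' x e \<partial>lborel) = (\<integral>x. f' x e \<partial>lborel)"
  proof (rule Bochner_Integration.integral_cong[OF refl])
    fix x show "indicator \<Omega> x *\<^sub>R f' x e = f' x e"
      using z[of x e] sub by (cases "x \<in> cball q r") (auto simp: indicator_def)
  qed
  also have "\<dots> = 0"
  proof (rule integral_directional_derivative_eq_0[where f = f and R = "norm q + r" and e = e])
    fix x
    have line: "((\<lambda>t. x + t *\<^sub>R e) has_vector_derivative e) (at 0)"
      using has_vector_derivative_add[OF has_vector_derivative_const[of x "at 0"]
              has_vector_derivative_scaleR[OF DERIV_ident has_vector_derivative_const[of e]]] by simp
    show "((\<lambda>t. f (x + t *\<^sub>R e)) has_vector_derivative f' x e) (at 0)"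
      by (rule has_derivative_along_curve[OF line]) (use C1_derivD(1)[OF C] in simp)
  qed (use C1_derivD[OF C] out z supp in auto)
  finally have 1: "(\<integral>x. indicator \<Omega> x *\<^sub>R f' x e \<partial>lborel) = 0" .
  have "AE x in S. (e \<bullet> outward_normal \<Omega> x) *\<^sub>R f x = 0"
    using AE_frontier
  proof eventually_elim
    case (elim x)
    then have "x \<notin> \<Omega>" using open_\<Omega> by (simp add: frontier_def interior_open)
    then have "x \<notin> cball q r" using sub by blast
    then show ?case using supp by simp
  qed
  then have "(\<integral>x. (e \<bullet> outward_normal \<Omega> x) *\<^sub>R f x \<partial>S) = 0"
    by (rule integral_eq_zero_AE)
  with 1 show ?thesis by (simp add: flux_identity_def)
qed

definition admissible_ball :: "real^3 \<Rightarrow> real \<Rightarrow> bool" where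
  "admissible_ball q r \<longleftrightarrow> r > 0 \<and> (ball q r \<subseteq> \<Omega> \<or> (\<exists>A B \<gamma> \<gamma>'. boundary_chart \<Omega> q r A B \<gamma> \<gamma>'))"

text \<open>\<open>3/4 * r\<close> is the support radius of the bumps; being less than
  \<open>r\<close>, it puts the closed support ball inside an open ball that lies in
  \<open>\<Omega>\<close> or carries a chart.\<close>

lemma flux_identity_admissible:
  assumes C: "C1_deriv f f'" and supp: "\<And>x. x \<notin> cball q (3/4 * r) \<Longrightarrow> f x = 0" and q: "admissible_ball q r"
  shows "flux_identity e f f'"
proof -
  have r: "3/4 * r < r" using q by (simp add: admissible_ball_def)
  from q consider "ball q r \<subseteq> \<Omega>" | A B \<gamma> \<gamma>' where "boundary_chart \<Omega> q r A B \<gamma> \<gamma>'"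
    unfolding admissible_ball_def by blast
  then show ?thesis
  proof cases
    case 1
    have "cball q (3/4 * r) \<subseteq> ball q r"
    proof
      fix x assume "x \<in> cball q (3/4 * r)"
      then show "x \<in> ball q r" using r unfolding mem_ball mem_cball by linarith
    qed
    with 1 have "cball q (3/4 * r) \<subseteq> \<Omega>" by (rule order_trans[rotated])
    then show ?thesis using supp by (intro flux_identity_interior[OF C])
  next
    case 2
    then interpret boundary_chart \<Omega> q r A B \<gamma> \<gamma>' .
    show ?thesis
      unfolding flux_identity_def
      by (rule divergence_theorem_local[OF S C1_derivD(1)[OF C] C1_derivD(2)[OF C] supp r measurable_outward_normal])
  qed
qed

text \<open>Peeling off one bump per ball replaces a partition of unity: \<open>f = \<psi> f + (1 - \<psi>) f\<close>, where
  \<open>\<psi> f\<close> lives in one ball and \<open>(1 - \<psi>) f\<close> vanishes on the part of the closure it covers.\<close>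

lemma flux_identity_cover:
  assumes "finite F" "\<And>q. q \<in> F \<Longrightarrow> admissible_ball q (rad q)" "C1_deriv f f'"
    "\<And>x. x \<in> closure \<Omega> - (\<Union>q\<in>F. ball q (rad q / 2)) \<Longrightarrow> f x = 0"
  shows "flux_identity e f f'"
  using assms
proof (induction F arbitrary: f f' rule: finite_induct)
  \<comment> \<open>With no ball left, \<open>f\<close> vanishes on the closure and its derivative
    on the open set \<open>\<Omega>\<close>. Nothing is known of \<open>f\<close> outside, but
    neither integral looks there.\<close>
  case empty
  then have z: "f x = 0" if "x \<in> closure \<Omega>" for x using that by simp
  have "f' x e = 0" if "x \<in> \<Omega>" for x
    using that z closure_subset by (intro C1_deriv_zero_on_open[OF empty(2) open_\<Omega>]) auto
  then have "(\<integral>x. indicator \<Omega> x *\<^sub>R f' x e \<partial>lborel) = 0"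
    by (intro integral_eq_zero_AE AE_I2) (auto simp: indicator_def)
  moreover have "AE x in S. (e \<bullet> outward_normal \<Omega> x) *\<^sub>R f x = 0"
    using AE_frontier by eventually_elim (use z frontier_subset_closure in auto)
  then have "(\<integral>x. (e \<bullet> outward_normal \<Omega> x) *\<^sub>R f x \<partial>S) = 0"
    by (rule integral_eq_zero_AE)
  ultimately show ?case by (simp add: flux_identity_def)
next
  case (insert q F)
  have q: "admissible_ball q (rad q)" using insert by simp
  then have "rad q > 0" by (simp add: admissible_ball_def)
  then obtain \<psi> \<psi>' where \<psi>: "C1_deriv \<psi> \<psi>'" "\<And>x. x \<in> ball q (rad q/2) \<Longrightarrow> \<psi> x = (1::real)"
    "\<And>x. x \<notin> cball q (3/4 * rad q) \<Longrightarrow> \<psi> x = 0"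
    using C1_bump_exists by metis
  note C1 = C1_deriv_scaleR[OF \<psi>(1) insert(5)]
  note C2 = C1_deriv_diff[OF insert(5) C1]
  have "flux_identity e (\<lambda>x. \<psi> x *\<^sub>R f x) (\<lambda>x v. \<psi> x *\<^sub>R f' x v + \<psi>' x v *\<^sub>R f x)"
    by (rule flux_identity_admissible[OF C1 _ q]) (simp add: \<psi>(3))
  moreover have "flux_identity e (\<lambda>x. f x - \<psi> x *\<^sub>R f x) (\<lambda>x v. f' x v - (\<psi> x *\<^sub>R f' x v + \<psi>' x v *\<^sub>R f x))"
  proof (rule insert.IH[OF _ C2])
    fix x assume x: "x \<in> closure \<Omega> - (\<Union>q\<in>F. ball q (rad q / 2))"
    show "f x - \<psi> x *\<^sub>R f x = 0"
      using \<psi>(2)[of x] insert(6)[of x] x by (cases "x \<in> ball q (rad q / 2)") auto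
  qed (use insert in simp)
  ultimately show ?case
    using flux_identity_add[OF C1 C2] by simp
qed

text \<open>Balls of half radius are made to cover the whole closure, so that the vanishing
  condition of \<open>flux_identity_cover\<close> holds vacuously.\<close>

theorem divergence_theorem:
  fixes f :: "real^3 \<Rightarrow> complex"
  assumes "C1_deriv f f'"
  shows "(\<integral>x. indicator \<Omega> x *\<^sub>R f' x e \<partial>lborel) = (\<integral>x. (e \<bullet> outward_normal \<Omega> x) *\<^sub>R f x \<partial>S)"
proof -
  have "\<forall>q\<in>closure \<Omega>. \<exists>r. admissible_ball q r"
  proof
    fix q assume q: "q \<in> closure \<Omega>"
    show "\<exists>r. admissible_ball q r"
    proof (cases "q \<in> \<Omega>")
      case True
      with open_\<Omega> obtain r where "r > 0" "ball q r \<subseteq> \<Omega>" by (rule openE)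
      then show ?thesis unfolding admissible_ball_def by blast
    next
      case False
      then have "q \<in> frontier \<Omega>" using q open_\<Omega> by (simp add: frontier_def interior_open)
      then show ?thesis
      proof -
        assume "q \<in> frontier \<Omega>"
        from boundary_chart_exists[OF open_\<Omega> C2 this] obtain r A B \<gamma> \<gamma>'
          where "boundary_chart \<Omega> q r A B \<gamma> \<gamma>'" .
        then show ?thesis using boundary_chart.r_pos unfolding admissible_ball_def by blast
      qed
    qed
  qed
  then obtain rad where rad: "\<And>q. q \<in> closure \<Omega> \<Longrightarrow> admissible_ball q (rad q)"
    using bchoice by metis
  have comp: "compact (closure \<Omega>)" using bounded_\<Omega> by simp
  obtain F where F: "F \<subseteq> closure \<Omega>" "finite F" "closure \<Omega> \<subseteq> (\<Union>q\<in>F. ball q (rad q / 2))"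
  proof (rule compactE_image[OF comp, of "closure \<Omega>" "\<lambda>q. ball q (rad q / 2)"])
    show "closure \<Omega> \<subseteq> (\<Union>q\<in>closure \<Omega>. ball q (rad q / 2))"
    proof
      fix q assume "q \<in> closure \<Omega>"
      then show "q \<in> (\<Union>q\<in>closure \<Omega>. ball q (rad q / 2))"
        using rad[of q] by (intro UN_I[of q]) (auto simp: admissible_ball_def)
    qed
  qed auto
  have "flux_identity e f f'"
    by (rule flux_identity_cover[OF F(2) _ assms]) (use F rad in auto)
  then show ?thesis by (simp add: flux_identity_def)
qed

end

section \<open>Green's identity for traces\<close>

text \<open>The inequality \<open>h \<le> \<delta> + h^2 / \<delta>\<close> bounds the integral of
  \<open>h\<close> by \<open>\<delta>\<close> times the total mass plus \<open>1/\<delta>\<close>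
  times the integral of the square; \<open>\<delta>\<close> is fixed before
  \<open>n\<close>.\<close>

lemma tendsto_nn_integral_of_square:
  fixes h :: "nat \<Rightarrow> 'a \<Rightarrow> real"
  assumes "finite_measure M" and [measurable]: "\<And>n. h n \<in> borel_measurable M"
    and lim: "(\<lambda>n. \<integral>\<^sup>+x. ennreal ((h n x)\<^sup>2) \<partial>M) \<longlonglongrightarrow> 0"
  shows "(\<lambda>n. \<integral>\<^sup>+x. ennreal (h n x) \<partial>M) \<longlonglongrightarrow> 0"
proof -
  interpret finite_measure M by fact
  define \<mu> where "\<mu> = measure M (space M)"
  have \<mu>: "\<mu> \<ge> 0" "emeasure M (space M) = ennreal \<mu>" by (simp_all add: \<mu>_def emeasure_eq_measure)
  have bound: "(\<integral>\<^sup>+x. ennreal (h n x) \<partial>M) \<le> ennreal (\<delta> * \<mu>) + ennreal (1/\<delta>) * (\<integral>\<^sup>+x. ennreal ((h n x)\<^sup>2) \<partial>M)"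
    if "\<delta> > 0" for \<delta> n
  proof -
    have "(\<integral>\<^sup>+x. ennreal (h n x) \<partial>M) \<le> (\<integral>\<^sup>+x. (ennreal \<delta> + ennreal (1/\<delta>) * ennreal ((h n x)\<^sup>2)) \<partial>M)"
    proof (rule nn_integral_mono)
      fix x
      have "h n x \<le> \<delta> + 1/\<delta> * (h n x)\<^sup>2"
      proof (cases "h n x \<le> \<delta>")
        case False
        then have "\<delta> * h n x \<le> (h n x)\<^sup>2" using that by (simp add: power2_eq_square)
        then have "h n x \<le> 1/\<delta> * (h n x)\<^sup>2" using that by (simp add: field_simps)
        then show ?thesis using that by simp
      next
        case True
        have "0 \<le> 1/\<delta> * (h n x)\<^sup>2" using that by simp
        with True show ?thesis by linarith
      qed
      then have "ennreal (h n x) \<le> ennreal (\<delta> + 1/\<delta> * (h n x)\<^sup>2)" by (rule ennreal_leI)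
      also have "\<dots> = ennreal \<delta> + ennreal (1/\<delta> * (h n x)\<^sup>2)"
        using that by (intro ennreal_plus) auto
      also have "ennreal (1/\<delta> * (h n x)\<^sup>2) = ennreal (1/\<delta>) * ennreal ((h n x)\<^sup>2)"
        using that by (intro ennreal_mult) auto
      finally show "ennreal (h n x) \<le> ennreal \<delta> + ennreal (1/\<delta>) * ennreal ((h n x)\<^sup>2)" .
    qed
    also have "\<dots> = ennreal \<delta> * emeasure M (space M) + ennreal (1/\<delta>) * (\<integral>\<^sup>+x. ennreal ((h n x)\<^sup>2) \<partial>M)"
      by (subst nn_integral_add) (auto simp: nn_integral_cmult)
    also have "\<dots> = ennreal (\<delta> * \<mu>) + ennreal (1/\<delta>) * (\<integral>\<^sup>+x. ennreal ((h n x)\<^sup>2) \<partial>M)"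
      using that \<mu> by (simp add: ennreal_mult)
    finally show ?thesis .
  qed
  show ?thesis
  proof (rule order_tendstoI)
    fix a :: ennreal assume "0 < a"
    then obtain b where b: "0 < b" "b < a" using dense by blast
    then obtain c where "c \<ge> 0" "b = ennreal c" by (cases b) auto
    with b have c: "c > 0" "ennreal c < a" by auto
    \<comment> \<open>This makes \<open>\<delta> * \<mu>\<close> at most \<open>c / 2\<close>, the
      \<open>+ 1\<close> covering total mass zero. Square integrals below
      \<open>\<delta> * (c / 2)\<close> account for the other half of \<open>c\<close>.\<close>
    define \<delta> where "\<delta> = c / (2 * (\<mu> + 1))"
    have \<delta>: "\<delta> > 0" using c \<mu> by (simp add: \<delta>_def)
    have d1: "\<delta> * \<mu> \<le> c / 2"
    proof -
      have "\<delta> * \<mu> \<le> \<delta> * (\<mu> + 1)" using \<delta> by simp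
      moreover have "\<mu> + 1 \<noteq> 0" using \<mu>(1) by linarith
      then have "\<delta> * (\<mu> + 1) = c / 2"
        using mult_divide_mult_cancel_right[of "\<mu> + 1" c 2] unfolding \<delta>_def times_divide_eq_left by simp
      ultimately show ?thesis by simp
    qed
    have "0 < ennreal (\<delta> * (c / 2))" using \<delta> c by simp
    from order_tendstoD(2)[OF lim this]
    show "\<forall>\<^sub>F n in sequentially. (\<integral>\<^sup>+x. ennreal (h n x) \<partial>M) < a"
    proof eventually_elim
      case (elim n)
      have "(\<integral>\<^sup>+x. ennreal (h n x) \<partial>M) \<le> ennreal (\<delta> * \<mu>) + ennreal (1/\<delta>) * (\<integral>\<^sup>+x. ennreal ((h n x)\<^sup>2) \<partial>M)"
        by (rule bound[OF \<delta>])
      also have "\<dots> \<le> ennreal (c/2) + ennreal (1/\<delta>) * ennreal (\<delta> * (c / 2))"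
        using d1 elim by (intro add_mono ennreal_leI mult_left_mono) auto
      also have "ennreal (1/\<delta>) * ennreal (\<delta> * (c / 2)) = ennreal (c/2)"
        using \<delta> c by (simp add: ennreal_mult[symmetric])
      also have "ennreal (c/2) + ennreal (c/2) = ennreal c"
        using c by (simp add: ennreal_plus[symmetric] del: ennreal_plus)
      finally show ?case using c(2) by (rule le_less_trans)
    qed
  qed simp
qed

text \<open>Shared by the volume and the boundary limit in Green's identity: the error of the
  integrand is a bounded factor times a quantity that tends to zero in L^2, hence in L^1 on a finite
  measure space.\<close>

lemma integral_tendsto_of_L2_bound:
  fixes F :: "nat \<Rightarrow> 'a \<Rightarrow> 'b::{banach, second_countable_topology}"
  assumes fin: "finite_measure M" and h: "\<And>n. h n \<in> borel_measurable M"
    and lim: "(\<lambda>n. \<integral>\<^sup>+x. ennreal ((h n x)\<^sup>2) \<partial>M) \<longlonglongrightarrow> 0"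
    and int: "\<And>n. integrable M (F n)" "integrable M G"
    and bound: "\<And>n. AE x in M. norm (F n x - G x) \<le> K * h n x" and K: "K \<ge> 0"
  shows "(\<lambda>n. \<integral>x. F n x \<partial>M) \<longlonglongrightarrow> (\<integral>x. G x \<partial>M)"
proof (rule tendsto_L1_int[OF int])
  have "(\<lambda>n. ennreal K * (\<integral>\<^sup>+x. ennreal (h n x) \<partial>M)) \<longlonglongrightarrow> ennreal K * 0"
    by (rule ennreal_tendsto_cmult[OF _ tendsto_nn_integral_of_square[OF fin h lim]]) simp
  then have up: "(\<lambda>n. ennreal K * (\<integral>\<^sup>+x. ennreal (h n x) \<partial>M)) \<longlonglongrightarrow> 0" by simp
  show "(\<lambda>n. \<integral>\<^sup>+x. norm (F n x - G x) \<partial>M) \<longlonglongrightarrow> 0"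
  proof (rule tendsto_sandwich[OF _ _ tendsto_const up])
    show "\<forall>\<^sub>F n in sequentially. (\<integral>\<^sup>+x. norm (F n x - G x) \<partial>M) \<le> ennreal K * (\<integral>\<^sup>+x. ennreal (h n x) \<partial>M)"
    proof (rule always_eventually, rule allI)
      fix n
      have "(\<integral>\<^sup>+x. norm (F n x - G x) \<partial>M) \<le> (\<integral>\<^sup>+x. ennreal K * ennreal (h n x) \<partial>M)"
        using bound[of n] K by (intro nn_integral_mono_AE) (auto elim!: eventually_mono simp: ennreal_mult'[symmetric] ennreal_leI)
      also have "\<dots> = ennreal K * (\<integral>\<^sup>+x. ennreal (h n x) \<partial>M)"
        using h by (intro nn_integral_cmult) auto
      finally show "(\<integral>\<^sup>+x. norm (F n x - G x) \<partial>M) \<le> ennreal K * (\<integral>\<^sup>+x. ennreal (h n x) \<partial>M)" .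
    qed
  qed auto
qed

lemma L2_imp_integrable_norm:
  assumes "finite_measure M" "L2 M f"
  shows "integrable M (\<lambda>x. norm (f x))"
proof -
  interpret finite_measure M by fact
  have m: "f \<in> borel_measurable M" and i: "integrable M (\<lambda>x. (norm (f x))\<^sup>2)"
    using assms(2) by (auto simp: L2_def)
  have "integrable M (\<lambda>x. 1 + (norm (f x))\<^sup>2)" using i by (intro Bochner_Integration.integrable_add) auto
  then show ?thesis
  proof (rule Bochner_Integration.integrable_bound)
    show "(\<lambda>x. norm (f x)) \<in> borel_measurable M" using m by measurable
    have "norm (f x) \<le> 1 + (norm (f x))\<^sup>2" for x
    proof -
      have "0 \<le> (norm (f x) - 1)\<^sup>2" by simp
      then have "2 * norm (f x) \<le> 1 + (norm (f x))\<^sup>2" by (simp add: power2_diff)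
      then show ?thesis using norm_ge_zero[of "f x"] by linarith
    qed
    then show "AE x in M. norm (norm (f x)) \<le> norm (1 + (norm (f x))\<^sup>2)"
      by (intro AE_I2) (simp add: abs_of_nonneg)
  qed
qed

text \<open>The factor 3 counts coordinates; a crude constant is enough, since the bound only has to
  be finite and uniform.\<close>

lemma norm_cdot_le: "norm (cdot a b) \<le> 3 * norm a * norm b"
proof -
  have "norm (cdot a b) \<le> (\<Sum>j\<in>(UNIV::3 set). norm (a $ j * b $ j))"
    unfolding cdot_def by (rule norm_sum)
  also have "\<dots> \<le> (\<Sum>j\<in>(UNIV::3 set). norm a * norm b)"
    unfolding norm_mult by (intro sum_mono mult_mono Finite_Cartesian_Product.norm_nth_le) auto
  finally show ?thesis by simp
qed

lemma cdot_diff_left: "cdot a c - cdot b c = cdot (a - b) c"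
  by (simp add: cdot_def sum_subtractf algebra_simps)

lemma measurable_cdot:
  assumes f: "f \<in> borel_measurable M" and g: "g \<in> borel_measurable M"
  shows "(\<lambda>x. cdot (f x) (g x)) \<in> borel_measurable M"
proof -
  have nth: "(\<lambda>a::complex^3. a $ j) \<in> borel_measurable borel" for j
    by (intro borel_measurable_continuous_onI continuous_intros)
  show ?thesis
    unfolding cdot_def
    by (intro borel_measurable_sum borel_measurable_times measurable_compose[OF f nth] measurable_compose[OF g nth])
qed

lemma Ck_on_1_imp_C1_deriv:
  assumes "Ck_on 1 UNIV f"
  shows "C1_deriv f (\<lambda>x. frechet_derivative f (at x))"
proof -
  have d: "\<forall>x. f differentiable (at x)" and c: "\<forall>v. continuous_on UNIV (\<lambda>x. frechet_derivative f (at x) v)"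
    using assms unfolding One_nat_def by simp_all
  show ?thesis
    unfolding C1_deriv_def using d[unfolded frechet_derivative_works] c by (intro conjI)
qed

lemma C1_deriv_grad:
  assumes "C1_deriv f f'"
  shows "grad f x $ j = f' x (axis j 1)" "frechet_derivative f (at x) = f' x"
proof -
  show "frechet_derivative f (at x) = f' x"
    using frechet_derivative_at[OF C1_derivD(1)[OF assms]] by simp
  then show "grad f x $ j = f' x (axis j 1)" by (simp add: grad_def)
qed

context C2_domain
begin

lemma sets_\<Omega>: "\<Omega> \<in> sets borel" "\<Omega> \<in> sets lebesgue"
  using open_\<Omega> by auto

lemma finite_measure_\<Omega>: "finite_measure (lebesgue_on \<Omega>)"
  using sets_\<Omega> emeasure_bounded_finite[OF bounded_\<Omega>]
  by (intro finite_measureI) (auto simp: space_restrict_space emeasure_restrict_space)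

lemma lebesgue_on_continuous:
  fixes f :: "real^3 \<Rightarrow> 'b::{banach, second_countable_topology}"
  assumes "continuous_on UNIV f"
  shows "f \<in> borel_measurable (lebesgue_on \<Omega>)" "integrable (lebesgue_on \<Omega>) f"
    "(\<integral>x. f x \<partial>lebesgue_on \<Omega>) = (\<integral>x. indicator \<Omega> x *\<^sub>R f x \<partial>lborel)"
proof -
  have fm: "f \<in> borel_measurable borel" using assms by (rule borel_measurable_continuous_onI)
  then show "f \<in> borel_measurable (lebesgue_on \<Omega>)"
    by (intro measurable_restrict_space1 measurable_completion) simp
  have im: "(\<lambda>x. indicator \<Omega> x *\<^sub>R f x) \<in> borel_measurable lborel"
    using fm sets_\<Omega>(1) by measurable
  show "integrable (lebesgue_on \<Omega>) f"
    using integrable_on_\<Omega>[OF assms] im sets_\<Omega> by (subst integrable_restrict_space) (auto simp: integrable_completion)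
  show "(\<integral>x. f x \<partial>lebesgue_on \<Omega>) = (\<integral>x. indicator \<Omega> x *\<^sub>R f x \<partial>lborel)"
    using im sets_\<Omega> by (subst integral_restrict_space) (auto simp: integral_completion)
qed

text \<open>The divergence theorem for a scalar function is applied to \<open>f * W j\<close> in the
  direction of the axis \<open>j\<close> and summed over \<open>j\<close>.\<close>

lemma green_identity_C1:
  fixes f :: "real^3 \<Rightarrow> complex" and W :: "3 \<Rightarrow> real^3 \<Rightarrow> complex"
  assumes f: "C1_deriv f f'" and W: "\<And>j. C1_deriv (W j) (W' j)"
  shows "(\<integral>x. (\<Sum>j\<in>UNIV. f x * W' j x (axis j 1) + f' x (axis j 1) * W j x) \<partial>lebesgue_on \<Omega>)
     = (\<integral>x. (\<Sum>j\<in>UNIV. outward_normal \<Omega> x $ j *\<^sub>R W j x) * f x \<partial>S)"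
proof -
  note P = C1_deriv_mult[OF f W]
  have c: "continuous_on UNIV (\<lambda>x. f x * W' j x (axis j 1) + f' x (axis j 1) * W j x)" for j
    using C1_derivD(2)[OF P] by blast
  have "(\<integral>x. (\<Sum>j\<in>UNIV. f x * W' j x (axis j 1) + f' x (axis j 1) * W j x) \<partial>lebesgue_on \<Omega>)
     = (\<Sum>j\<in>UNIV. (\<integral>x. f x * W' j x (axis j 1) + f' x (axis j 1) * W j x \<partial>lebesgue_on \<Omega>))"
    by (intro Bochner_Integration.integral_sum lebesgue_on_continuous c)
  also have "\<dots> = (\<Sum>j\<in>UNIV. (\<integral>x. (axis j 1 \<bullet> outward_normal \<Omega> x) *\<^sub>R (f x * W j x) \<partial>S))"
    by (intro sum.cong refl) (simp add: lebesgue_on_continuous(3)[OF c] divergence_theorem[OF P])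
  also have "\<dots> = (\<integral>x. (\<Sum>j\<in>UNIV. (axis j 1 \<bullet> outward_normal \<Omega> x) *\<^sub>R (f x * W j x)) \<partial>S)"
    by (intro Bochner_Integration.integral_sum[symmetric] integrable_flux C1_derivD(3)[OF P])
  also have "\<dots> = (\<integral>x. (\<Sum>j\<in>UNIV. outward_normal \<Omega> x $ j *\<^sub>R W j x) * f x \<partial>S)"
    by (intro Bochner_Integration.integral_cong refl)
      (simp add: sum_distrib_left inner_axis' mult.commute)
  finally show ?thesis .
qed

text \<open>\<open>W\<close> plays the role of the gradient of \<open>w\<close>, and
  \<open>c * w\<close> that of its Laplacian. The identity is linear in \<open>u\<close>,
  \<open>Du\<close> and \<open>T\<close> and puts no further derivative on them, so it passes to the
  limit along the \<open>C^1\<close> approximations that define the trace.\<close>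

lemma green_identity_trace:
  fixes u w T :: "real^3 \<Rightarrow> complex" and W :: "3 \<Rightarrow> real^3 \<Rightarrow> complex"
  assumes W: "\<And>j. C1_deriv (W j) (W' j)" and w: "continuous_on UNIV w"
    and lap: "\<And>x. (\<Sum>j\<in>UNIV. W' j x (axis j 1)) = c * w x"
    and u: "L2 (lebesgue_on \<Omega>) u" and Du: "L2 (lebesgue_on \<Omega>) Du"
    and T: "boundary_trace \<Omega> S u Du T"
  shows "integrable (lebesgue_on \<Omega>) (\<lambda>x. cdot (Du x) (\<chi> j. W j x) + c * u x * w x)"
    and "(\<integral>x. cdot (Du x) (\<chi> j. W j x) + c * u x * w x \<partial>lebesgue_on \<Omega>)
     = (\<integral>x. (\<Sum>j\<in>UNIV. outward_normal \<Omega> x $ j *\<^sub>R W j x) * T x \<partial>S)"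
proof -
  let ?W = "\<lambda>x. (\<chi> j. W j x) :: complex^3"
  have cW: "continuous_on UNIV ?W"
    using C1_derivD(3)[OF W] by (intro continuous_on_vec_lambda) auto
  obtain \<phi> where \<phi>: "\<And>n. Ck_on 1 UNIV (\<phi> n)"
    and lim\<Omega>: "(\<lambda>n. \<integral>\<^sup>+x. ennreal ((norm (\<phi> n x - u x))\<^sup>2 + (norm (grad (\<phi> n) x - Du x))\<^sup>2) \<partial>lebesgue_on \<Omega>) \<longlonglongrightarrow> 0"
    and limS: "(\<lambda>n. \<integral>\<^sup>+x. ennreal ((norm (\<phi> n x - T x))\<^sup>2) \<partial>S) \<longlonglongrightarrow> 0"
    and TL2: "L2 S T"
    using T unfolding boundary_trace_def by blast
  have C: "C1_deriv (\<phi> n) (\<lambda>x. frechet_derivative (\<phi> n) (at x))" for n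
    by (rule Ck_on_1_imp_C1_deriv[OF \<phi>])
  have c\<phi>: "continuous_on UNIV (\<phi> n)" for n by (rule C1_derivD(3)[OF C])
  have cg: "continuous_on UNIV (grad (\<phi> n))" for n
    unfolding grad_def using C1_derivD(2)[OF C] by (intro continuous_on_vec_lambda) auto
  have um: "u \<in> borel_measurable (lebesgue_on \<Omega>)" and Dum: "Du \<in> borel_measurable (lebesgue_on \<Omega>)"
    using u Du by (auto simp: L2_def)
  have Tm: "T \<in> borel_measurable S" using TL2 by (simp add: L2_def)
  obtain M1 where M1: "M1 \<ge> 0" "\<And>x. x \<in> closure \<Omega> \<Longrightarrow> norm (?W x) \<le> M1"
    using continuous_bounded_on_closure[OF cW] by blast
  obtain M2 where M2: "M2 \<ge> 0" "\<And>x. x \<in> closure \<Omega> \<Longrightarrow> norm (w x) \<le> M2"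
    using continuous_bounded_on_closure[OF w] by blast
  define G where "G x = cdot (Du x) (?W x) + c * u x * w x" for x
  define Gn where "Gn n x = cdot (grad (\<phi> n) x) (?W x) + c * \<phi> n x * w x" for n x
  define h where "h n x = sqrt ((norm (\<phi> n x - u x))\<^sup>2 + (norm (grad (\<phi> n) x - Du x))\<^sup>2)" for n x
  \<comment> \<open>\<open>K\<close> collects the bounds of \<open>W\<close> and \<open>w\<close>
    over the closure: the error of the volume integrand is at most \<open>K\<close> times the
    pointwise H^1 distance \<open>h n\<close>.\<close>
  define K where "K = 3 * M1 + norm c * M2"
  have K: "K \<ge> 0" using M1 M2 by (simp add: K_def)
  have est: "norm (cdot a (?W x) + c * b * w x) \<le> 3 * norm a * M1 + norm c * norm b * M2"
    if "x \<in> \<Omega>" for a b x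
  proof -
    have x: "x \<in> closure \<Omega>" using that closure_subset by blast
    have "norm (cdot a (?W x)) \<le> 3 * norm a * M1"
      by (rule order_trans[OF norm_cdot_le mult_left_mono[OF M1(2)[OF x]]]) simp
    moreover have "norm (c * b * w x) \<le> norm c * norm b * M2"
      using M2(2)[OF x] by (simp add: norm_mult mult_left_mono)
    ultimately show ?thesis using norm_triangle_ineq[of "cdot a (?W x)" "c * b * w x"] by linarith
  qed
  have Gm: "G \<in> borel_measurable (lebesgue_on \<Omega>)"
    unfolding G_def using um Dum lebesgue_on_continuous(1)[OF w] lebesgue_on_continuous(1)[OF cW]
    by (intro borel_measurable_add borel_measurable_times borel_measurable_const measurable_cdot)
  have Gint: "integrable (lebesgue_on \<Omega>) G"
  proof (rule Bochner_Integration.integrable_bound[OF _ Gm])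
    show "integrable (lebesgue_on \<Omega>) (\<lambda>x. (3 * M1) * norm (Du x) + (norm c * M2) * norm (u x))"
      by (intro Bochner_Integration.integrable_add integrable_mult_right L2_imp_integrable_norm finite_measure_\<Omega> u Du)
    show "AE x in lebesgue_on \<Omega>. norm (G x) \<le> norm ((3 * M1) * norm (Du x) + (norm c * M2) * norm (u x))"
    proof (rule AE_I2)
      fix x assume "x \<in> space (lebesgue_on \<Omega>)"
      then have "x \<in> \<Omega>" by (simp add: space_restrict_space)
      from est[OF this, of "Du x" "u x"] M1 M2
      show "norm (G x) \<le> norm ((3 * M1) * norm (Du x) + (norm c * M2) * norm (u x))"
        by (simp add: G_def algebra_simps abs_of_nonneg)
    qed
  qed
  then show "integrable (lebesgue_on \<Omega>) (\<lambda>x. cdot (Du x) (?W x) + c * u x * w x)"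
    by (simp only: G_def[abs_def])
  have Gnc: "continuous_on UNIV (Gn n)" for n
    unfolding Gn_def cdot_def by (intro continuous_intros c\<phi> cg cW w)
  have L: "(\<lambda>n. \<integral>x. Gn n x \<partial>lebesgue_on \<Omega>) \<longlonglongrightarrow> (\<integral>x. G x \<partial>lebesgue_on \<Omega>)"
  proof (rule integral_tendsto_of_L2_bound[OF finite_measure_\<Omega> _ _ _ Gint _ K])
    show "h n \<in> borel_measurable (lebesgue_on \<Omega>)" for n
      unfolding h_def using um Dum lebesgue_on_continuous(1)[OF c\<phi>] lebesgue_on_continuous(1)[OF cg]
      by measurable
    show "(\<lambda>n. \<integral>\<^sup>+x. ennreal ((h n x)\<^sup>2) \<partial>lebesgue_on \<Omega>) \<longlonglongrightarrow> 0"
      using lim\<Omega> by (simp add: h_def)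
    show "integrable (lebesgue_on \<Omega>) (Gn n)" for n by (rule lebesgue_on_continuous(2)[OF Gnc])
    show "AE x in lebesgue_on \<Omega>. norm (Gn n x - G x) \<le> K * h n x" for n
    proof (rule AE_I2)
      fix x assume "x \<in> space (lebesgue_on \<Omega>)"
      then have x: "x \<in> \<Omega>" by (simp add: space_restrict_space)
      have "Gn n x - G x = cdot (grad (\<phi> n) x - Du x) (?W x) + c * (\<phi> n x - u x) * w x"
        by (simp add: Gn_def G_def cdot_diff_left[symmetric] algebra_simps)
      then have "norm (Gn n x - G x) \<le> 3 * norm (grad (\<phi> n) x - Du x) * M1 + norm c * norm (\<phi> n x - u x) * M2"
        using est[OF x] by simp
      also have "\<dots> = (3 * M1) * norm (grad (\<phi> n) x - Du x) + (norm c * M2) * norm (\<phi> n x - u x)"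
        by simp
      also have "\<dots> \<le> (3 * M1) * h n x + (norm c * M2) * h n x"
        using M1 M2 by (intro add_mono mult_left_mono) (auto simp: h_def real_sqrt_sum_squares_ge1 real_sqrt_sum_squares_ge2)
      finally show "norm (Gn n x - G x) \<le> K * h n x" by (simp add: K_def algebra_simps)
    qed
  qed
  let ?n = "outward_normal \<Omega>"
  \<comment> \<open>Components of a unit normal have size at most 1. This is available on the
    boundary only, elsewhere the normal being unspecified, so the estimates on \<open>S\<close>
    below are made almost everywhere or on the boundary.\<close>
  have norm_flux: "norm (\<Sum>j\<in>UNIV. ?n x $ j *\<^sub>R W j x) \<le> 3 * M1" if "x \<in> frontier \<Omega>" for x
  proof -
    have "norm (\<Sum>j\<in>UNIV. ?n x $ j *\<^sub>R W j x) \<le> (\<Sum>j\<in>(UNIV::3 set). norm (?n x $ j *\<^sub>R W j x))"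
      by (rule norm_sum)
    also have "\<dots> \<le> (\<Sum>j\<in>(UNIV::3 set). 1 * M1)"
    proof (intro sum_mono)
      fix j :: 3
      have "norm (W j x) \<le> M1"
        using M1(2)[of x] that frontier_subset_closure Finite_Cartesian_Product.norm_nth_le[of "?W x" j] by auto
      moreover have "\<bar>?n x $ j\<bar> \<le> 1"
        using component_le_norm_cart[of "?n x" j] norm_outward_normal[OF that] by simp
      ultimately show "norm (?n x $ j *\<^sub>R W j x) \<le> 1 * M1"
        unfolding norm_scaleR by (intro mult_mono) auto
    qed
    finally show ?thesis by simp
  qed
  have fluxm: "(\<lambda>x. \<Sum>j\<in>UNIV. ?n x $ j *\<^sub>R W j x) \<in> borel_measurable borel"
  proof (intro borel_measurable_sum borel_measurable_scaleR)
    show "(\<lambda>x. ?n x $ j) \<in> borel_measurable borel" for j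
      by (rule measurable_compose[OF measurable_outward_normal])
        (intro borel_measurable_continuous_onI continuous_intros)
    show "W j \<in> borel_measurable borel" for j
      using C1_derivD(3)[OF W] by (rule borel_measurable_continuous_onI)
  qed
  have R: "(\<lambda>n. \<integral>x. (\<Sum>j\<in>UNIV. ?n x $ j *\<^sub>R W j x) * \<phi> n x \<partial>S) \<longlonglongrightarrow> (\<integral>x. (\<Sum>j\<in>UNIV. ?n x $ j *\<^sub>R W j x) * T x \<partial>S)"
  proof (rule integral_tendsto_of_L2_bound[OF finite_measure_S, where K = "3 * M1" and h = "\<lambda>n x. norm (\<phi> n x - T x)"])
    have \<phi>m: "\<phi> n \<in> borel_measurable borel" for n using c\<phi> by (rule borel_measurable_continuous_onI)
    then have \<phi>mS: "\<phi> n \<in> borel_measurable S" for n by (simp add: measurable_S)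
    show "(\<lambda>x. norm (\<phi> n x - T x)) \<in> borel_measurable S" for n
      using \<phi>mS[of n] Tm by measurable
    show "(\<lambda>n. \<integral>\<^sup>+x. ennreal ((norm (\<phi> n x - T x))\<^sup>2) \<partial>S) \<longlonglongrightarrow> 0" by (rule limS)
    show "3 * M1 \<ge> 0" using M1 by simp
    show "integrable S (\<lambda>x. (\<Sum>j\<in>UNIV. ?n x $ j *\<^sub>R W j x) * \<phi> n x)" for n
    proof -
      obtain M3 where M3: "M3 \<ge> 0" "\<And>x. x \<in> closure \<Omega> \<Longrightarrow> norm (\<phi> n x) \<le> M3"
        using continuous_bounded_on_closure[OF c\<phi>] by blast
      show ?thesis
      proof (rule integrable_S_bounded_on_frontier[where M = "3 * M1 * M3"])
        show "(\<lambda>x. (\<Sum>j\<in>UNIV. ?n x $ j *\<^sub>R W j x) * \<phi> n x) \<in> borel_measurable borel"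
          by (intro borel_measurable_times fluxm \<phi>m)
        fix x assume "x \<in> frontier \<Omega>"
        then show "norm ((\<Sum>j\<in>UNIV. ?n x $ j *\<^sub>R W j x) * \<phi> n x) \<le> 3 * M1 * M3"
          using norm_flux[of x] M3 M1(1) frontier_subset_closure unfolding norm_mult by (intro mult_mono) auto
      qed
    qed
    have TS: "integrable S (\<lambda>x. (3 * M1) * norm (T x))"
      by (intro integrable_mult_right L2_imp_integrable_norm finite_measure_S TL2)
    show "integrable S (\<lambda>x. (\<Sum>j\<in>UNIV. ?n x $ j *\<^sub>R W j x) * T x)"
    proof (rule Bochner_Integration.integrable_bound[OF TS])
      have "(\<lambda>x. \<Sum>j\<in>UNIV. ?n x $ j *\<^sub>R W j x) \<in> borel_measurable S" using fluxm by (simp add: measurable_S)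
      then show "(\<lambda>x. (\<Sum>j\<in>UNIV. ?n x $ j *\<^sub>R W j x) * T x) \<in> borel_measurable S"
        using Tm by (rule borel_measurable_times)
      show "AE x in S. norm ((\<Sum>j\<in>UNIV. ?n x $ j *\<^sub>R W j x) * T x) \<le> norm (3 * M1 * norm (T x))"
        using AE_frontier
      proof eventually_elim
        case (elim x)
        have "norm (\<Sum>j\<in>UNIV. ?n x $ j *\<^sub>R W j x) * norm (T x) \<le> 3 * M1 * norm (T x)"
          by (rule mult_right_mono[OF norm_flux[OF elim]]) simp
        then show ?case using M1 by (simp add: norm_mult)
      qed
    qed
    show "AE x in S. norm ((\<Sum>j\<in>UNIV. ?n x $ j *\<^sub>R W j x) * \<phi> n x - (\<Sum>j\<in>UNIV. ?n x $ j *\<^sub>R W j x) * T x)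
        \<le> 3 * M1 * norm (\<phi> n x - T x)" for n
      using AE_frontier
    proof eventually_elim
      case (elim x)
      have "norm (\<Sum>j\<in>UNIV. ?n x $ j *\<^sub>R W j x) * norm (\<phi> n x - T x) \<le> 3 * M1 * norm (\<phi> n x - T x)"
        by (rule mult_right_mono[OF norm_flux[OF elim]]) simp
      then show ?case by (simp only: right_diff_distrib[symmetric] norm_mult)
    qed
  qed
  have "(\<integral>x. Gn n x \<partial>lebesgue_on \<Omega>) = (\<integral>x. (\<Sum>j\<in>UNIV. ?n x $ j *\<^sub>R W j x) * \<phi> n x \<partial>S)" for n
  proof -
    \<comment> \<open>The hypothesis \<open>lap\<close> turns the zeroth-order term into
      \<open>\<phi> n\<close> times the divergence of \<open>W\<close>, the form in which the
      \<open>C^1\<close> identity applies.\<close>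
    have "Gn n x = (\<Sum>j\<in>UNIV. \<phi> n x * W' j x (axis j 1) + frechet_derivative (\<phi> n) (at x) (axis j 1) * W j x)" for x
      using lap[of x] by (simp add: Gn_def cdot_def grad_def sum.distrib sum_distrib_left[symmetric] mult_ac)
    then show ?thesis using green_identity_C1[OF C W] by simp
  qed
  with L R have "(\<integral>x. G x \<partial>lebesgue_on \<Omega>) = (\<integral>x. (\<Sum>j\<in>UNIV. ?n x $ j *\<^sub>R W j x) * T x \<partial>S)"
    using LIMSEQ_unique by simp
  then show "(\<integral>x. cdot (Du x) (?W x) + c * u x * w x \<partial>lebesgue_on \<Omega>)
     = (\<integral>x. (\<Sum>j\<in>UNIV. ?n x $ j *\<^sub>R W j x) * T x \<partial>S)"
    by (simp add: G_def)
qed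

end

section \<open>Exponentials with affine amplitude\<close>

definition ldot :: "complex^3 \<Rightarrow> real^3 \<Rightarrow> complex" where
  "ldot a x = (\<Sum>j\<in>UNIV. a $ j * of_real (x $ j))"

text \<open>The family contains both \<open>v\<close> (amplitude 1) and its
  \<open>\<tau>\<close>-derivative (linear amplitude) and is closed under partial derivatives, so
  one derivative formula serves gradients and Laplacians.\<close>

definition poly_exp :: "complex \<Rightarrow> complex^3 \<Rightarrow> complex^3 \<Rightarrow> real^3 \<Rightarrow> complex" where
  "poly_exp b a z x = (b + ldot a x) * exp (ldot z x)"

lemma bounded_linear_ldot: "bounded_linear (ldot a)"
  unfolding linear_conv_bounded_linear[symmetric]
  by (rule linearI) (simp_all add: ldot_def algebra_simps sum.distrib sum_distrib_left scaleR_sum_right scaleR_conv_of_real[where 'a = complex])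

lemma ldot_axis [simp]: "ldot a (axis j 1) = a $ j"
  by (simp add: ldot_def axis_def if_distrib cong: if_cong)

lemma continuous_on_ldot: "continuous_on U (ldot a)"
  by (intro linear_continuous_on bounded_linear_ldot)

lemma C1_deriv_ldot: "C1_deriv (ldot a) (\<lambda>x. ldot a)"
  unfolding C1_deriv_def using bounded_linear_imp_has_derivative[OF bounded_linear_ldot] by auto

lemma C1_deriv_poly_exp:
  "C1_deriv (poly_exp b a z) (\<lambda>x v. ldot a v * exp (ldot z x) + poly_exp b a z x * ldot z v)"
proof -
  have e: "((\<lambda>x. exp (ldot z x)) has_derivative (\<lambda>v. exp (ldot z x) * ldot z v)) (at x)" for x
    using has_derivative_compose[OF C1_derivD(1)[OF C1_deriv_ldot[of z]] DERIV_exp[unfolded has_field_derivative_def]] by simp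
  have "((\<lambda>x. (b + ldot a x) * exp (ldot z x)) has_derivative
      (\<lambda>v. (b + ldot a x) * (exp (ldot z x) * ldot z v) + ldot a v * exp (ldot z x))) (at x)" for x
    using has_derivative_mult[OF has_derivative_add[OF has_derivative_const[of b "at x"] C1_derivD(1)[OF C1_deriv_ldot[of a]]] e]
    by simp
  then show ?thesis
    unfolding C1_deriv_def poly_exp_def
    by (auto simp: algebra_simps intro!: continuous_intros continuous_on_ldot)
qed

lemma ldot_smult [simp]: "ldot (c *s a) x = c * ldot a x"
  by (simp add: ldot_def sum_distrib_left mult_ac)

lemma poly_exp_partial:
  "ldot a (axis j 1) * exp (ldot z x) + poly_exp b a z x * ldot z (axis j 1)
    = poly_exp (a $ j + b * z $ j) (z $ j *s a) z x"
  by (simp add: poly_exp_def algebra_simps)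

text \<open>The Laplacian of \<open>poly_exp b a z\<close> is
  \<open>2 * cdot a z * exp (ldot z x) + cdot z z * poly_exp b a z x\<close>, so the conditions on
  \<open>a\<close> and \<open>z\<close> yield the Helmholtz equation. Green's identity cancels the
  boundary integral of the trace against the part of the pairing without source.\<close>

theorem (in C2_domain) boundary_indicator_poly_exp:
  fixes u T F :: "real^3 \<Rightarrow> complex"
  assumes u: "L2 (lebesgue_on \<Omega>) u" and Du: "L2 (lebesgue_on \<Omega>) Du"
    and T: "boundary_trace \<Omega> S u Du T"
    and zz: "cdot z z = - of_real (k\<^sup>2)" and az: "cdot a z = 0"
    and F: "integrable (lebesgue_on \<Omega>) (\<lambda>x. F x * poly_exp b a z x)"
  shows "boundary_indicator \<Omega> S k F u Du T (poly_exp b a z) = (\<integral>x. F x * poly_exp b a z x \<partial>lebesgue_on \<Omega>)"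
proof -
  let ?w = "poly_exp b a z"
  define W where "W j = poly_exp (a $ j + b * z $ j) (z $ j *s a) z" for j :: 3
  note C = C1_deriv_poly_exp[of b a z]
  have gradw: "grad ?w x = (\<chi> j. W j x)" for x
    by (simp add: vec_eq_iff C1_deriv_grad(1)[OF C] W_def poly_exp_partial[symmetric])
  have lap: "(\<Sum>j\<in>UNIV. ldot (z $ j *s a) (axis j 1) * exp (ldot z x)
      + poly_exp (a $ j + b * z $ j) (z $ j *s a) z x * ldot z (axis j 1)) = - of_real (k\<^sup>2) * ?w x" for x
  proof -
    have "(\<Sum>j\<in>UNIV. ldot (z $ j *s a) (axis j 1) * exp (ldot z x)
      + poly_exp (a $ j + b * z $ j) (z $ j *s a) z x * ldot z (axis j 1))
      = (\<Sum>j\<in>UNIV. (2 * exp (ldot z x)) * (a $ j * z $ j) + ?w x * (z $ j * z $ j))"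
      by (intro sum.cong refl) (simp add: poly_exp_def algebra_simps)
    also have "\<dots> = (2 * exp (ldot z x)) * cdot a z + ?w x * cdot z z"
      by (simp add: cdot_def sum.distrib sum_distrib_left)
    finally show ?thesis using zz az by simp
  qed
  note G = green_identity_trace[OF C1_deriv_poly_exp C1_derivD(3)[OF C] lap u Du T]
  have "normal_derivative_pairing \<Omega> k F u Du ?w (grad ?w)
    = (\<integral>x. (cdot (Du x) (\<chi> j. W j x) + (- of_real (k\<^sup>2)) * u x * ?w x) + F x * ?w x \<partial>lebesgue_on \<Omega>)"
    unfolding normal_derivative_pairing_def gradw by simp
  also have "\<dots> = (\<integral>x. cdot (Du x) (\<chi> j. W j x) + (- of_real (k\<^sup>2)) * u x * ?w x \<partial>lebesgue_on \<Omega>) + (\<integral>x. F x * ?w x \<partial>lebesgue_on \<Omega>)"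
    using G(1) F unfolding W_def by (rule Bochner_Integration.integral_add)
  also have "(\<integral>x. cdot (Du x) (\<chi> j. W j x) + (- of_real (k\<^sup>2)) * u x * ?w x \<partial>lebesgue_on \<Omega>)
     = (\<integral>x. (\<Sum>j\<in>UNIV. outward_normal \<Omega> x $ j *\<^sub>R W j x) * T x \<partial>S)"
    using G(2) unfolding W_def .
  finally have "normal_derivative_pairing \<Omega> k F u Du ?w (grad ?w)
    = (\<integral>x. (\<Sum>j\<in>UNIV. outward_normal \<Omega> x $ j *\<^sub>R W j x) * T x \<partial>S) + (\<integral>x. F x * ?w x \<partial>lebesgue_on \<Omega>)" .
  moreover have "(\<Sum>j\<in>UNIV. outward_normal \<Omega> x $ j *\<^sub>R W j x) = frechet_derivative ?w (at x) (outward_normal \<Omega> x)" for x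
  proof -
    let ?n = "outward_normal \<Omega> x"
    have lin: "linear (frechet_derivative ?w (at x))"
      unfolding C1_deriv_grad(2)[OF C] by (rule has_derivative_linear[OF C1_derivD(1)[OF C]])
    have "?n = (\<Sum>j\<in>UNIV. ?n $ j *\<^sub>R axis j 1)"
      by (simp add: vec_eq_iff axis_def if_distrib cong: if_cong)
    then have "frechet_derivative ?w (at x) ?n = (\<Sum>j\<in>UNIV. ?n $ j *\<^sub>R frechet_derivative ?w (at x) (axis j 1))"
      by (metis (no_types, lifting) linear_sum[OF lin] linear_scale[OF lin] sum.cong)
    moreover have "frechet_derivative ?w (at x) (axis j 1) = W j x" for j
      unfolding C1_deriv_grad(2)[OF C] W_def by (rule poly_exp_partial)
    ultimately show ?thesis by simp
  qed
  ultimately show ?thesis by (simp add: boundary_indicator_def)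
qed

section \<open>Tetrahedral cones\<close>

lemma lborel_prod_Basis:
  fixes f :: "'a::euclidean_space \<Rightarrow> real \<Rightarrow> 'b::{real_normed_field,banach,second_countable_topology}"
  assumes f: "\<And>b. b \<in> Basis \<Longrightarrow> integrable lborel (f b)"
  shows "integrable lborel (\<lambda>x::'a. \<Prod>b\<in>Basis. f b (x \<bullet> b))"
    and "(\<integral>x. (\<Prod>b\<in>Basis. f b (x \<bullet> b)) \<partial>(lborel :: 'a measure)) = (\<Prod>b\<in>Basis. (\<integral>t. f b t \<partial>lborel))"
proof -
  interpret product_sigma_finite "\<lambda>_::'a. lborel :: real measure" ..
  let ?g = "\<lambda>h::'a \<Rightarrow> real. \<Sum>b\<in>Basis. h b *\<^sub>R b"
  have g: "?g \<in> measurable (\<Pi>\<^sub>M b\<in>Basis. lborel) borel" by measurable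
  have "(\<lambda>x. f b (x \<bullet> b)) \<in> borel_measurable borel" if "b \<in> Basis" for b
  proof -
    have "f b \<in> borel_measurable borel" using borel_measurable_integrable[OF f[OF that]] by simp
    moreover have "(\<lambda>x. x \<bullet> b) \<in> borel_measurable borel" by (intro borel_measurable_inner) auto
    ultimately show ?thesis by (rule measurable_compose[rotated])
  qed
  then have m: "(\<lambda>x::'a. \<Prod>b\<in>Basis. f b (x \<bullet> b)) \<in> borel_measurable borel"
    by (rule borel_measurable_prod)
  have eq: "(\<Prod>b\<in>Basis. f b (?g h \<bullet> b)) = (\<Prod>b\<in>Basis. f b (h b))" for h
    by (intro prod.cong refl) simp
  have i: "integrable (\<Pi>\<^sub>M b\<in>Basis. lborel) (\<lambda>h. \<Prod>b\<in>(Basis::'a set). f b (h b))"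
    using f by (intro product_integrable_prod) auto
  show "integrable lborel (\<lambda>x::'a. \<Prod>b\<in>Basis. f b (x \<bullet> b))"
    by (subst lborel_eq, subst integrable_distr_eq[OF g m]) (simp only: eq i)
  have "(\<integral>x. (\<Prod>b\<in>Basis. f b (x \<bullet> b)) \<partial>(lborel :: 'a measure)) = (\<integral>h. (\<Prod>b\<in>(Basis::'a set). f b (h b)) \<partial>(\<Pi>\<^sub>M b\<in>Basis. lborel))"
    by (subst lborel_eq, subst integral_distr[OF g m]) (simp only: eq)
  also have "\<dots> = (\<Prod>b\<in>Basis. (\<integral>t. f b t \<partial>lborel))"
    using f by (intro product_integral_prod) auto
  finally show "(\<integral>x. (\<Prod>b\<in>Basis. f b (x \<bullet> b)) \<partial>(lborel :: 'a measure)) = (\<Prod>b\<in>Basis. (\<integral>t. f b t \<partial>lborel))" .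
qed

lemma integral_exp_halfline:
  fixes l :: complex
  assumes "Re l < 0"
  shows "integrable lborel (\<lambda>s. indicator {0<..} s *\<^sub>R exp (l * of_real s))"
    and "(\<integral>s. indicator {0<..} s *\<^sub>R exp (l * of_real s) \<partial>lborel) = - (1 / l)"
proof -
  have c: "continuous_on UNIV (\<lambda>s::real. exp (l * of_real s))" by (intro continuous_intros)
  have [measurable]: "(\<lambda>s::real. exp (l * of_real s)) \<in> borel_measurable borel"
    using c by (rule borel_measurable_continuous_onI)
  have d: "((\<lambda>s::real. exp (Re l * s) / Re l) has_real_derivative exp (Re l * s)) (at s)" for s
    using assms by (auto intro!: derivative_eq_intros)
  have "filterlim (\<lambda>s. Re l * s) at_bot at_top"
    using assms by (intro filterlim_tendsto_neg_mult_at_bot[OF tendsto_const _ filterlim_ident])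
  then have lim0: "((\<lambda>s::real. exp (Re l * s)) \<longlongrightarrow> 0) at_top"
    by (rule filterlim_compose[OF exp_at_bot])
  have "((\<lambda>s::real. exp (Re l * s) / Re l) \<longlongrightarrow> 0 / Re l) at_top"
    using assms by (intro tendsto_divide lim0 tendsto_const) auto
  then have "(\<integral>\<^sup>+s. ennreal (exp (Re l * s)) * indicator {0..} s \<partial>lborel) = ennreal (0 / Re l - exp (Re l * 0) / Re l)"
    by (intro nn_integral_FTC_atLeast[OF _ d]) auto
  then have fin: "(\<integral>\<^sup>+s. ennreal (exp (Re l * s)) * indicator {0..} s \<partial>lborel) < \<infinity>"
    by simp
  have iw: "integrable lborel (\<lambda>s. indicator {0..} s *\<^sub>R exp (Re l * s))"
  proof (rule integrableI_bounded)
    have "(\<integral>\<^sup>+s. ennreal (norm (indicator {0..} s *\<^sub>R exp (Re l * s))) \<partial>lborel)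
      = (\<integral>\<^sup>+s. ennreal (exp (Re l * s)) * indicator {0..} s \<partial>lborel)"
      by (intro nn_integral_cong) (auto simp: indicator_def)
    then show "(\<integral>\<^sup>+s. ennreal (norm (indicator {0..} s *\<^sub>R exp (Re l * s))) \<partial>lborel) < \<infinity>"
      using fin by simp
  qed measurable
  have b: "norm (indicator {0<..} s *\<^sub>R exp (l * of_real s)) \<le> indicator {0..} s *\<^sub>R exp (Re l * s)" for s
    by (auto simp: indicator_def)
  show "integrable lborel (\<lambda>s. indicator {0<..} s *\<^sub>R exp (l * of_real s))"
    by (rule Bochner_Integration.integrable_bound[OF iw])
      (measurable, use b in \<open>auto intro!: AE_I2 simp: indicator_def\<close>)
  have l0: "l \<noteq> 0" using assms by auto
  have dl: "((\<lambda>s::real. exp (l * of_real s) / l) has_vector_derivative exp (l * of_real s)) (at s)" for s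
  proof -
    have "((\<lambda>z. exp (l * z) / l) has_field_derivative exp (l * of_real s)) (at (of_real s))"
      using l0 by (auto intro!: derivative_eq_intros)
    from has_vector_derivative_real_field[OF this] show ?thesis .
  qed
  \<comment> \<open>The value is found as a limit over the intervals \<open>{0..real n}\<close>
    under the integrable majorant \<open>exp (Re l * s)\<close>; the point 0, where the indicators
    differ, is a null set.\<close>
  have lim: "(\<lambda>n. \<integral>s. indicator {0..real n} s *\<^sub>R exp (l * of_real s) \<partial>lborel)
      \<longlonglongrightarrow> (\<integral>s. indicator {0<..} s *\<^sub>R exp (l * of_real s) \<partial>lborel)"
  proof (rule integral_dominated_convergence[OF _ _ iw])
    show "AE s in lborel. (\<lambda>n. indicator {0..real n} s *\<^sub>R exp (l * of_real s)) \<longlonglongrightarrow> indicator {0<..} s *\<^sub>R exp (l * of_real s)"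
      using AE_lborel_singleton[of 0]
    proof eventually_elim
      case (elim s)
      obtain n0 where "s \<le> real n0" using real_arch_simple by blast
      then have "\<forall>\<^sub>F n in sequentially. indicator {0..real n} s *\<^sub>R exp (l * of_real s) = indicator {0<..} s *\<^sub>R exp (l * of_real s)"
        using elim by (intro eventually_sequentiallyI[of n0]) (auto simp: indicator_def)
      then show ?case by (rule tendsto_eventually)
    qed
    show "AE s in lborel. norm (indicator {0..real n} s *\<^sub>R exp (l * of_real s)) \<le> indicator {0..} s *\<^sub>R exp (Re l * s)" for n
      by (intro AE_I2) (auto simp: indicator_def)
  qed measurable
  have "(\<integral>s. indicator {0..real n} s *\<^sub>R exp (l * of_real s) \<partial>lborel) = exp (l * of_real (real n)) / l - exp (l * of_real 0) / l" for n
    by (rule integral_FTC_Icc) (auto intro: has_vector_derivative_at_within[OF dl] continuous_on_subset[OF c])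
  moreover have "(\<lambda>n. exp (l * of_real (real n)) / l - exp (l * of_real 0) / l) \<longlonglongrightarrow> 0 / l - exp (l * of_real 0) / l"
  proof (intro tendsto_diff tendsto_divide tendsto_const l0)
    have "(\<lambda>n. norm (exp (l * of_real (real n)))) \<longlonglongrightarrow> 0"
      using filterlim_compose[OF lim0 filterlim_real_sequentially] by simp
    then show "(\<lambda>n. exp (l * of_real (real n))) \<longlonglongrightarrow> 0" by (rule tendsto_norm_zero_cancel)
  qed
  ultimately show "(\<integral>s. indicator {0<..} s *\<^sub>R exp (l * of_real s) \<partial>lborel) = - (1 / l)"
    using LIMSEQ_unique[OF lim] by simp
qed

lemma integral_exp_octant:
  fixes l :: "complex^'n"
  assumes "\<And>i. Re (l $ i) < 0"
  shows "integrable lborel (\<lambda>s::real^'n. \<Prod>i\<in>UNIV. indicator {0<..} (s $ i) *\<^sub>R exp (l $ i * of_real (s $ i)))"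
    and "(\<integral>s. (\<Prod>i\<in>UNIV. indicator {0<..} (s $ i) *\<^sub>R exp (l $ i * of_real (s $ i))) \<partial>(lborel :: (real^'n) measure)) \<noteq> 0"
proof -
  \<comment> \<open>The product formula is indexed by basis vectors, the factors by coordinates;
    \<open>idx\<close> translates between them.\<close>
  define idx where "idx b = (THE i. b = axis i (1::real))" for b :: "real^'n"
  have [simp]: "idx (axis i 1) = i" for i by (auto simp: idx_def axis_eq_axis)
  define f where "f b t = indicator {0<..} t *\<^sub>R exp (l $ idx b * of_real t)" for b :: "real^'n" and t :: real
  have i: "integrable lborel (f b)" for b
    unfolding f_def by (rule integral_exp_halfline(1)[OF assms])
  have eq: "(\<Prod>b\<in>Basis. f b (s \<bullet> b)) = (\<Prod>i\<in>UNIV. indicator {0<..} (s $ i) *\<^sub>R exp (l $ i * of_real (s $ i)))" for s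
    by (simp only: prod_Basis_vec) (simp add: f_def inner_axis)
  show "integrable lborel (\<lambda>s::real^'n. \<Prod>i\<in>UNIV. indicator {0<..} (s $ i) *\<^sub>R exp (l $ i * of_real (s $ i)))"
    using lborel_prod_Basis(1)[of f, OF i] unfolding eq .
  have nz: "(\<integral>t. f b t \<partial>lborel) \<noteq> 0" for b
    unfolding f_def integral_exp_halfline(2)[OF assms] using assms[of "idx b"] by auto
  show "(\<integral>s. (\<Prod>i\<in>UNIV. indicator {0<..} (s $ i) *\<^sub>R exp (l $ i * of_real (s $ i))) \<partial>(lborel :: (real^'n) measure)) \<noteq> 0"
    using lborel_prod_Basis(2)[of f, OF i] nz unfolding eq by simp
qed

text \<open>The interior of the simplex is where all four barycentric weights are positive. The
  weights of the three vertices other than \<open>p\<close> become the coordinates \<open>s\<close>,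
  with the edge vectors as columns of \<open>L\<close>; the weight of \<open>p\<close> is 1 minus
  their sum, which is positive near \<open>p\<close>.\<close>

lemma simplex_cone_at_vertex:
  assumes K: "3 simplex K" and p: "p extreme_point_of K"
  obtains L :: "real^3 \<Rightarrow> real^3" and \<delta> where "linear L" "inj L" "\<delta> > 0"
    "\<And>s. norm (L s) < \<delta> \<Longrightarrow> p + L s \<in> interior K \<longleftrightarrow> (\<forall>i. s $ i > 0)"
proof -
  obtain C where C: "\<not> affine_dependent C" "card C = 4" "K = convex hull C"
    using K unfolding simplex_def by auto
  have finC: "finite C" using C(2) by (intro card_ge_0_finite) simp
  have pC: "p \<in> C" using p C(1,3) extreme_point_of_convex_hull_affine_independent by blast
  have "card (UNIV :: 3 set) = card (C - {p})" using C(2) pC finC by simp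
  then obtain e where e: "bij_betw e (UNIV :: 3 set) (C - {p})"
    using finite_same_card_bij[of "UNIV :: 3 set" "C - {p}"] finC by auto
  have injE: "inj e" and rangeE: "e ` UNIV = C - {p}" using e by (auto simp: bij_betw_def)
  define L where "L s = (\<Sum>i\<in>UNIV. s $ i *\<^sub>R (e i - p))" for s :: "real^3"
  have lin: "linear L"
    by (rule linearI) (simp_all add: L_def scaleR_add_left sum.distrib scaleR_sum_right)
  have sumC: "(\<Sum>c\<in>C. g c) = g p + (\<Sum>i\<in>UNIV. g (e i))" for g :: "real^3 \<Rightarrow> 'b::comm_monoid_add"
  proof -
    have "(\<Sum>c\<in>C. g c) = g p + (\<Sum>c\<in>C - {p}. g c)" using finC pC by (rule sum.remove)
    also have "(\<Sum>c\<in>C - {p}. g c) = (\<Sum>i\<in>UNIV. g (e i))"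
      unfolding rangeE[symmetric] by (simp add: sum.reindex injE)
    finally show ?thesis .
  qed
  have ep: "e i \<noteq> p" for i using rangeE by blast
  have comb: "(\<Sum>c\<in>C. u c *\<^sub>R c) = (\<Sum>c\<in>C. u c) *\<^sub>R p + L (\<chi> i. u (e i))" for u
    unfolding sumC by (simp add: L_def scaleR_add_left scaleR_diff_right sum_subtractf scaleR_sum_left)
  have inj: "inj L"
  proof (rule linear_injective_0[OF lin, THEN iffD2], intro allI impI)
    fix s assume "L s = 0"
    \<comment> \<open>Weights of total sum zero with vanishing combination: affine independence
      makes all of them zero.\<close>
    define u where "u c = (if c = p then - (\<Sum>i\<in>UNIV. s $ i) else s $ inv e c)" for c
    have ue: "u (e i) = s $ i" for i using ep injE by (simp add: u_def)
    have "sum u C = 0" unfolding sumC by (simp add: ue) (simp add: u_def)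
    moreover have "(\<Sum>c\<in>C. u c *\<^sub>R c) = 0"
      unfolding comb \<open>sum u C = 0\<close> using \<open>L s = 0\<close> by (simp add: ue)
    ultimately have "\<forall>v\<in>C. u v = 0"
      using C(1) unfolding affine_dependent_explicit_finite[OF finC] by blast
    then have "s $ i = 0" for i using ue[of i] rangeE by (metis DiffD1 rangeI)
    then show "s = 0" by (simp add: vec_eq_iff)
  qed
  obtain B where B: "B > 0" "\<And>x. B * norm x \<le> norm (L x)"
    using linear_inj_bounded_below_pos[OF lin inj] by blast
  show ?thesis
  proof (rule that[OF lin inj])
    \<comment> \<open>\<open>B\<close> bounds \<open>L\<close> from below, so
      \<open>norm (L s) < B / 3\<close> makes each coordinate less than 1/3 and their sum less than
      1; the weight of \<open>p\<close> then imposes no condition of its own.\<close>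
    show "B / 3 > 0" using B by simp
    fix s assume s: "norm (L s) < B / 3"
    have "B * norm s < B * (1/3)" using B(2)[of s] s by simp
    then have "norm s < 1/3" using B(1) by simp
    moreover have "s $ i \<le> norm s" for i using component_le_norm_cart[of s i] by linarith
    ultimately have lt: "s $ i < 1/3" for i by (meson le_less_trans)
    have "(\<Sum>i\<in>UNIV. s $ i) < (\<Sum>i\<in>(UNIV::3 set). 1/3)" using lt by (intro sum_strict_mono) auto
    then have s1: "(\<Sum>i\<in>UNIV. s $ i) < 1" by simp
    have int: "interior K = {y. \<exists>u. (\<forall>x \<in> C. 0 < u x \<and> u x < 1) \<and> sum u C = 1 \<and> (\<Sum>x\<in>C. u x *\<^sub>R x) = y}"
      unfolding C(3) interior_convex_hull_explicit[OF C(1)] using C(2) by simp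
    show "p + L s \<in> interior K \<longleftrightarrow> (\<forall>i. s $ i > 0)"
    proof
      assume "p + L s \<in> interior K"
      then obtain u where u: "\<forall>x \<in> C. 0 < u x \<and> u x < 1" "sum u C = 1" "(\<Sum>x\<in>C. u x *\<^sub>R x) = p + L s"
        unfolding int by blast
      have "L (\<chi> i. u (e i)) = L s" using u(3) unfolding comb u(2) by simp
      then have "s = (\<chi> i. u (e i))" using inj by (simp add: inj_eq)
      then show "\<forall>i. s $ i > 0" using u(1) rangeE by auto
    next
      assume pos: "\<forall>i. s $ i > 0"
      define u where "u c = (if c = p then 1 - (\<Sum>i\<in>UNIV. s $ i) else s $ inv e c)" for c
      have ue: "u (e i) = s $ i" for i using ep injE by (simp add: u_def)
      have up: "u p = 1 - (\<Sum>i\<in>UNIV. s $ i)" by (simp add: u_def)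
      have "(\<Sum>i\<in>(UNIV::3 set). s $ i) > 0" using pos by (intro sum_pos) auto
      then have "0 < u p \<and> u p < 1" using s1 up by simp
      moreover have "0 < u (e i) \<and> u (e i) < 1" for i using pos lt[of i] ue[of i] by auto
      ultimately have "\<forall>x \<in> C. 0 < u x \<and> u x < 1"
        using rangeE by (metis Diff_iff image_iff singletonD)
      moreover have "sum u C = 1" unfolding sumC by (simp add: ue up)
      moreover have "(\<Sum>x\<in>C. u x *\<^sub>R x) = p + L s"
        unfolding comb \<open>sum u C = 1\<close> by (simp add: ue)
      ultimately show "p + L s \<in> interior K" unfolding int by blast
    qed
  qed
qed

section \<open>Asymptotics at the tip of a cone\<close>

text \<open>The oscillation frequency is asymptotically \<open>\<tau>\<close>: after scaling lengths
  by \<open>1 / \<tau>\<close> the wave number \<open>k\<close> disappears from the limit.\<close>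

lemma tendsto_sqrt_ratio: "((\<lambda>\<tau>. sqrt (\<tau>\<^sup>2 + k\<^sup>2) / \<tau>) \<longlongrightarrow> 1) at_top" for k :: real
proof -
  have "((\<lambda>\<tau>. sqrt (1 + (k * inverse \<tau>)\<^sup>2)) \<longlongrightarrow> sqrt (1 + (k * 0)\<^sup>2)) at_top"
    by (intro tendsto_intros tendsto_inverse_0_at_top[OF filterlim_ident])
  moreover have "\<forall>\<^sub>F \<tau> in at_top. sqrt (1 + (k * inverse \<tau>)\<^sup>2) = sqrt (\<tau>\<^sup>2 + k\<^sup>2) / \<tau>"
    using eventually_gt_at_top[of 0]
  proof eventually_elim
    case (elim \<tau>)
    have "sqrt (\<tau>\<^sup>2 + k\<^sup>2) / \<tau> = sqrt ((\<tau>\<^sup>2 + k\<^sup>2) / \<tau>\<^sup>2)"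
      using elim by (simp add: real_sqrt_divide)
    also have "(\<tau>\<^sup>2 + k\<^sup>2) / \<tau>\<^sup>2 = 1 + (k * inverse \<tau>)\<^sup>2"
      using elim by (simp add: field_simps power_mult_distrib)
    finally show ?case by simp
  qed
  ultimately show ?thesis by (simp add: Lim_transform_eventually)
qed

text \<open>\<open>cone\<close> and \<open>edge\<close> control the integral near \<open>p\<close>;
  \<open>max\<close> and the integrability of \<open>\<rho>\<close> control the rest.
  \<open>c\<close> is the volume factor of \<open>L\<close>, and \<open>\<rho>'\<close> is the
  continuous representative of the density near the vertex.\<close>

locale cone_tip =
  fixes D :: "(real^3) set" and p :: "real^3" and L :: "real^3 \<Rightarrow> real^3" and \<delta> c :: real
    and \<omega> \<theta> :: "real^3" and k :: real and \<rho> \<rho>' :: "real^3 \<Rightarrow> complex"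
  assumes open_D: "open D" and bounded_D: "bounded D"
    and linL: "linear L" and c_pos: "c > 0"
    and lborel_L: "lborel = density (distr lborel borel L) (\<lambda>_. ennreal c)"
    and \<delta>_pos: "\<delta> > 0"
    and cone: "\<And>s. norm (L s) < \<delta> \<Longrightarrow> p + L s \<in> D \<longleftrightarrow> (\<forall>i. s $ i > 0)"
    and edge: "\<And>i. L (axis i 1) \<bullet> \<omega> < 0"
    and max: "\<And>x. x \<in> closure D \<Longrightarrow> x \<noteq> p \<Longrightarrow> x \<bullet> \<omega> < p \<bullet> \<omega>"
    and \<rho>_int: "integrable (lebesgue_on D) \<rho>"
    and \<rho>'_cont: "continuous_on (ball p \<delta>) \<rho>'"
    and \<rho>'_bdd: "bounded (\<rho>' ` ball p \<delta>)"
    and \<rho>_eq: "AE x in lebesgue. x \<in> ball p \<delta> \<inter> D \<longrightarrow> \<rho> x = \<rho>' x"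
begin

abbreviation v :: "real \<Rightarrow> real^3 \<Rightarrow> complex" where "v \<equiv> exp_solution k \<omega> \<theta>"

lemma v_add: "v \<tau> (x + y) = v \<tau> x * v \<tau> y"
  by (simp add: exp_solution_def inner_add_left exp_add[symmetric] algebra_simps)

lemma norm_v: "norm (v \<tau> x) = exp (\<tau> * (x \<bullet> \<omega>))"
  by (simp add: exp_solution_def norm_exp_eq_Re)

lemma v_nz [simp]: "v \<tau> x \<noteq> 0"
  by (simp add: exp_solution_def)

lemma cont_v: "continuous_on UNIV (v \<tau>)"
  unfolding exp_solution_def by (intro continuous_intros)

lemma sets_D: "D \<in> sets borel" "D \<in> sets lebesgue"
  using open_D by auto

lemma measurable_L: "L \<in> borel_measurable borel"
  using linL by (intro borel_measurable_continuous_onI linear_continuous_on linear_conv_bounded_linear[THEN iffD1])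

text \<open>Translation, dilation by \<open>1 / \<tau>\<close> and \<open>L\<close> combine to the
  Jacobian \<open>c / \<tau>^3\<close>.\<close>

lemma integral_rescale:
  fixes g :: "real^3 \<Rightarrow> complex"
  assumes g: "g \<in> borel_measurable borel" and \<tau>: "\<tau> > 0"
  shows "(\<integral>x. g x \<partial>lborel) = (c / \<tau>^3) *\<^sub>R (\<integral>s. g (p + L s /\<^sub>R \<tau>) \<partial>lborel)"
proof -
  let ?r = "1/\<tau>"
  have aff: "(\<lambda>x. p + ?r *\<^sub>R x) \<in> measurable lborel borel" by measurable
  have ga: "(\<lambda>x. g (p + ?r *\<^sub>R x)) \<in> borel_measurable borel"
    using measurable_compose[OF aff g] by simp
  have L': "L \<in> measurable lborel borel" using measurable_L by simp
  have "(\<integral>x. g x \<partial>lborel) = (\<integral>x. g x \<partial>density (distr lborel borel (\<lambda>x. p + ?r *\<^sub>R x)) (\<lambda>_. ennreal (\<bar>?r\<bar>^3)))"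
    using lborel_affine[of ?r p] \<tau> by (simp add: ennreal_power)
  also have "\<dots> = (\<integral>x. \<bar>?r\<bar>^3 *\<^sub>R g x \<partial>distr lborel borel (\<lambda>x. p + ?r *\<^sub>R x))"
    using g by (intro integral_density) auto
  also have "\<dots> = \<bar>?r\<bar>^3 *\<^sub>R (\<integral>x. g x \<partial>distr lborel borel (\<lambda>x. p + ?r *\<^sub>R x))" by simp
  also have "(\<integral>x. g x \<partial>distr lborel borel (\<lambda>x. p + ?r *\<^sub>R x)) = (\<integral>x. g (p + ?r *\<^sub>R x) \<partial>lborel)"
    by (rule integral_distr[OF aff g])
  also have "(\<integral>x. g (p + ?r *\<^sub>R x) \<partial>lborel) = (\<integral>x. g (p + ?r *\<^sub>R x) \<partial>density (distr lborel borel L) (\<lambda>_. ennreal c))"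
    by (subst lborel_L) simp
  also have "\<dots> = (\<integral>x. c *\<^sub>R g (p + ?r *\<^sub>R x) \<partial>distr lborel borel L)"
    using ga c_pos by (intro integral_density) auto
  also have "\<dots> = c *\<^sub>R (\<integral>x. g (p + ?r *\<^sub>R x) \<partial>distr lborel borel L)" by simp
  also have "(\<integral>x. g (p + ?r *\<^sub>R x) \<partial>distr lborel borel L) = (\<integral>s. g (p + ?r *\<^sub>R L s) \<partial>lborel)"
    by (rule integral_distr[OF L' ga])
  finally show ?thesis
    using \<tau> by (simp add: power_one_over inverse_eq_divide)
qed

text \<open>These are the exponents \<open>\<lambda>\<close> of the three one-dimensional integrals,
  one for each edge at \<open>p\<close>.\<close>

definition edge_exp :: "complex^3" where
  "edge_exp = (\<chi> i. of_real (L (axis i 1) \<bullet> \<omega>) + \<i> * of_real (L (axis i 1) \<bullet> \<theta>))"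

text \<open>Written as a product so that its integral factors; \<open>E_eq\<close> identifies it as
  the limit of the rescaled exponential, restricted to the open octant.\<close>

definition E :: "real^3 \<Rightarrow> complex" where
  "E s = (\<Prod>i\<in>UNIV. indicator {0<..} (s $ i) *\<^sub>R exp (edge_exp $ i * of_real (s $ i)))"

lemma edge_exp_Re: "Re (edge_exp $ i) < 0"
  using edge[of i] by (simp add: edge_exp_def)

lemma E_integrable: "integrable lborel E" and E_nz: "(\<integral>s. E s \<partial>lborel) \<noteq> 0"
  unfolding E_def[abs_def] by (rule integral_exp_octant[OF edge_exp_Re])+

lemma L_inner: "L s \<bullet> x = (\<Sum>i\<in>UNIV. s $ i * (L (axis i 1) \<bullet> x))"
proof -
  have "s = (\<Sum>i\<in>UNIV. s $ i *\<^sub>R axis i 1)"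
    by (simp add: vec_eq_iff axis_def if_distrib cong: if_cong)
  then have "L s = L (\<Sum>i\<in>UNIV. s $ i *\<^sub>R axis i 1)" by (rule arg_cong)
  also have "\<dots> = (\<Sum>i\<in>UNIV. s $ i *\<^sub>R L (axis i 1))"
    by (simp add: linear_sum[OF linL] linear_scale[OF linL])
  finally show ?thesis by (simp add: inner_sum_left)
qed

lemma E_eq:
  "E s = (if \<forall>i. s $ i > 0 then exp (of_real (L s \<bullet> \<omega>) + \<i> * of_real (L s \<bullet> \<theta>)) else 0)"
proof (cases "\<forall>i. s $ i > 0")
  case True
  have "E s = (\<Prod>i\<in>UNIV. exp (edge_exp $ i * of_real (s $ i)))"
    unfolding E_def using True by (intro prod.cong refl) (simp add: indicator_def)
  also have "\<dots> = exp (\<Sum>i\<in>UNIV. edge_exp $ i * of_real (s $ i))" by (simp add: exp_sum)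
  also have "(\<Sum>i\<in>UNIV. edge_exp $ i * of_real (s $ i)) = of_real (L s \<bullet> \<omega>) + \<i> * of_real (L s \<bullet> \<theta>)"
    unfolding L_inner[of s \<omega>] L_inner[of s \<theta>]
    by (simp add: edge_exp_def sum.distrib sum_distrib_left algebra_simps)
  finally show ?thesis using True by simp
next
  case False
  then obtain i where "\<not> s $ i > 0" by blast
  then have "E s = 0" unfolding E_def by (intro prod_zero) (auto intro!: exI[of _ i])
  then show ?thesis using False by simp
qed

lemma norm_E: "norm (E s) = (if \<forall>i. s $ i > 0 then exp (L s \<bullet> \<omega>) else 0)"
  unfolding E_eq by (simp add: norm_exp_eq_Re)

definition tip_constant :: complex where "tip_constant = c *\<^sub>R (\<rho>' p * (\<integral>s. E s \<partial>lborel))"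

text \<open>One amplitude \<open>P\<close> serves both indicators: 1 for \<open>v\<close>, and the
  factor in front of \<open>v\<close> for the \<open>\<tau>\<close>-derivative. As the latter varies
  with \<open>\<tau>\<close>, a bound on \<open>D\<close> uniform in \<open>\<tau> \<ge> 1\<close>
  is assumed, and a limit \<open>P\<^sub>0\<close> at points approaching the vertex at rate
  \<open>1 / \<tau>\<close>.\<close>

context
  fixes P :: "real \<Rightarrow> real^3 \<Rightarrow> complex" and P\<^sub>0 :: complex and M :: real
  assumes P_cont: "\<And>\<tau>. continuous_on UNIV (P \<tau>)"
    and P_bound: "\<And>\<tau> x. \<tau> \<ge> 1 \<Longrightarrow> x \<in> D \<Longrightarrow> norm (P \<tau> x) \<le> M" and M_nonneg: "M \<ge> 0"
    and P_lim: "\<And>y. ((\<lambda>\<tau>. P \<tau> (p + y /\<^sub>R \<tau>)) \<longlongrightarrow> P\<^sub>0) at_top"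
begin

text \<open>\<open>\<rho>'\<close> stands in for \<open>\<rho>\<close>, to which it is equal almost
  everywhere on this set: the integrand becomes Borel, as the substitution requires, and the density
  has a limit at \<open>p\<close>.\<close>

definition near :: "real \<Rightarrow> real^3 \<Rightarrow> complex" where
  "near \<tau> x = indicator (D \<inter> ball p \<delta>) x *\<^sub>R (\<rho>' x * (P \<tau> x * v \<tau> x))"

lemma near_measurable: "near \<tau> \<in> borel_measurable borel"
  unfolding near_def[abs_def]
  using open_D continuous_on_subset[OF \<rho>'_cont] continuous_on_subset[OF P_cont] continuous_on_subset[OF cont_v]
  by (intro borel_measurable_continuous_on_indicator continuous_intros) auto

lemma near_limit:
  "((\<lambda>\<tau>. \<integral>s. near \<tau> (p + L s /\<^sub>R \<tau>) / v \<tau> p \<partial>lborel) \<longlongrightarrow> (\<integral>s. (\<rho>' p * P\<^sub>0) * E s \<partial>lborel)) at_top"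
proof -
  obtain R where R: "R > 0" "\<And>x. x \<in> ball p \<delta> \<Longrightarrow> norm (\<rho>' x) \<le> R"
    using \<rho>'_bdd unfolding bounded_pos by auto
  define G where "G \<tau> s = near \<tau> (p + L s /\<^sub>R \<tau>) / v \<tau> p" for \<tau> s
  have G_eq: "G \<tau> s = (if norm (L s) < \<tau> * \<delta> \<and> (\<forall>i. s $ i > 0)
      then \<rho>' (p + L s /\<^sub>R \<tau>) * P \<tau> (p + L s /\<^sub>R \<tau>) * v \<tau> (L s /\<^sub>R \<tau>) else 0)" if "\<tau> > 0" for \<tau> s
  proof -
    have eq: "L s /\<^sub>R \<tau> = L (s /\<^sub>R \<tau>)" by (simp add: linear_scale[OF linL])
    have b: "p + L s /\<^sub>R \<tau> \<in> ball p \<delta> \<longleftrightarrow> norm (L s) < \<tau> * \<delta>"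
      using that by (simp add: dist_norm divide_inverse[symmetric] field_simps)
    have d: "p + L s /\<^sub>R \<tau> \<in> D \<longleftrightarrow> (\<forall>i. s $ i > 0)" if "norm (L s) < \<tau> * \<delta>"
    proof -
      have "norm (L (s /\<^sub>R \<tau>)) < \<delta>"
        unfolding eq[symmetric] using that \<open>\<tau> > 0\<close> by (simp add: divide_inverse[symmetric] field_simps)
      from cone[OF this] show ?thesis using \<open>\<tau> > 0\<close> unfolding eq by (simp add: zero_less_mult_iff)
    qed
    have m: "p + L s /\<^sub>R \<tau> \<in> D \<inter> ball p \<delta> \<longleftrightarrow> norm (L s) < \<tau> * \<delta> \<and> (\<forall>i. s $ i > 0)"
      using b d by blast
    show ?thesis unfolding G_def near_def indicator_def m by (simp add: v_add)
  qed
  have nv: "norm (v \<tau> (L s /\<^sub>R \<tau>)) = exp (L s \<bullet> \<omega>)" if "\<tau> > 0" for \<tau> s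
    using that by (simp add: norm_v)
  have "((\<lambda>\<tau>. \<integral>s. G \<tau> s \<partial>lborel) \<longlongrightarrow> (\<integral>s. (\<rho>' p * P\<^sub>0) * E s \<partial>lborel)) at_top"
  \<comment> \<open>The modulus of the rescaled exponential is
    \<open>exp (L s \<bullet> \<omega>)\<close>, independent of \<open>\<tau>\<close>; hence the
    norm of \<open>E\<close>, times the bounds \<open>R\<close> of \<open>\<rho>'\<close> and
    \<open>M\<close> of \<open>P\<close>, dominates for all \<open>\<tau> \<ge> 1\<close>.\<close>
  proof (rule integral_dominated_convergence_at_top[where w = "\<lambda>s. (R * M) * norm (E s)"])
    show "(\<lambda>s. \<rho>' p * P\<^sub>0 * E s) \<in> borel_measurable lborel"
      using borel_measurable_integrable[OF E_integrable] by measurable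
    show "G \<tau> \<in> borel_measurable lborel" for \<tau>
    proof -
      have "(\<lambda>s. p + L s /\<^sub>R \<tau>) \<in> borel_measurable borel" using measurable_L by measurable
      from measurable_compose[OF this near_measurable] show ?thesis unfolding G_def[abs_def] by simp
    qed
    show "integrable lborel (\<lambda>s. (R * M) * norm (E s))"
      by (intro integrable_mult_right integrable_norm E_integrable)
    show "AE s in lborel. ((\<lambda>\<tau>. G \<tau> s) \<longlongrightarrow> \<rho>' p * P\<^sub>0 * E s) at_top"
    proof (rule AE_I2)
      fix s
      show "((\<lambda>\<tau>. G \<tau> s) \<longlongrightarrow> \<rho>' p * P\<^sub>0 * E s) at_top"
      proof (cases "\<forall>i. s $ i > 0")
        case False
        have "\<forall>\<^sub>F \<tau> in at_top. G \<tau> s = 0"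
          using eventually_gt_at_top[of 0] by eventually_elim (use False G_eq in auto)
        then show ?thesis using False by (auto simp: E_eq intro: tendsto_eventually)
      next
        case True
        have inv0: "((\<lambda>\<tau>::real. inverse \<tau>) \<longlongrightarrow> 0) at_top" by (rule tendsto_inverse_0_at_top[OF filterlim_ident])
        have x0: "((\<lambda>\<tau>. p + L s /\<^sub>R \<tau>) \<longlongrightarrow> p + 0 *\<^sub>R L s) at_top"
          by (intro tendsto_intros inv0)
        have "isCont \<rho>' p"
          using \<rho>'_cont \<delta>_pos continuous_on_interior[of "ball p \<delta>" \<rho>' p] by simp
        then have \<rho>lim: "((\<lambda>\<tau>. \<rho>' (p + L s /\<^sub>R \<tau>)) \<longlongrightarrow> \<rho>' p) at_top"
          using x0 by (intro isCont_tendsto_compose[of p \<rho>']) simp_all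
        have "((\<lambda>\<tau>. exp (of_real (L s \<bullet> \<omega>) + \<i> * of_real (sqrt (\<tau>\<^sup>2 + k\<^sup>2) / \<tau> * (L s \<bullet> \<theta>))))
            \<longlongrightarrow> exp (of_real (L s \<bullet> \<omega>) + \<i> * of_real (1 * (L s \<bullet> \<theta>)))) at_top"
          by (intro tendsto_intros tendsto_sqrt_ratio)
        moreover have "\<forall>\<^sub>F \<tau> in at_top. exp (of_real (L s \<bullet> \<omega>) + \<i> * of_real (sqrt (\<tau>\<^sup>2 + k\<^sup>2) / \<tau> * (L s \<bullet> \<theta>))) = v \<tau> (L s /\<^sub>R \<tau>)"
          using eventually_gt_at_top[of 0]
        proof eventually_elim
          case (elim \<tau>)
          then have e: "\<tau> * ((L s /\<^sub>R \<tau>) \<bullet> \<omega>) = L s \<bullet> \<omega>"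
            "sqrt (\<tau>\<^sup>2 + k\<^sup>2) * ((L s /\<^sub>R \<tau>) \<bullet> \<theta>) = sqrt (\<tau>\<^sup>2 + k\<^sup>2) / \<tau> * (L s \<bullet> \<theta>)"
            by (simp_all add: divide_inverse)
          then show ?case by (simp only: exp_solution_def e)
        qed
        ultimately have vlim: "((\<lambda>\<tau>. v \<tau> (L s /\<^sub>R \<tau>)) \<longlongrightarrow> E s) at_top"
          using True by (simp add: E_eq Lim_transform_eventually)
        have "((\<lambda>\<tau>. \<rho>' (p + L s /\<^sub>R \<tau>) * P \<tau> (p + L s /\<^sub>R \<tau>) * v \<tau> (L s /\<^sub>R \<tau>)) \<longlongrightarrow> \<rho>' p * P\<^sub>0 * E s) at_top"
          by (intro tendsto_mult \<rho>lim P_lim vlim)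
        moreover have "\<forall>\<^sub>F \<tau> in at_top. \<rho>' (p + L s /\<^sub>R \<tau>) * P \<tau> (p + L s /\<^sub>R \<tau>) * v \<tau> (L s /\<^sub>R \<tau>) = G \<tau> s"
          using eventually_gt_at_top[of "norm (L s) / \<delta>"] eventually_gt_at_top[of 0]
        proof eventually_elim
          case (elim \<tau>)
          then have "norm (L s) < \<tau> * \<delta>" using \<delta>_pos by (simp add: field_simps)
          then show ?case using G_eq[OF elim(2)] True by simp
        qed
        ultimately show ?thesis by (rule Lim_transform_eventually)
      qed
    qed
    show "\<forall>\<^sub>F \<tau> in at_top. AE s in lborel. norm (G \<tau> s) \<le> (R * M) * norm (E s)"
      using eventually_ge_at_top[of 1]
    proof eventually_elim
      case (elim \<tau>)
      then have \<tau>: "\<tau> > 0" by simp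
      show ?case
      proof (rule AE_I2)
        fix s
        show "norm (G \<tau> s) \<le> (R * M) * norm (E s)"
        proof (cases "p + L s /\<^sub>R \<tau> \<in> D \<inter> ball p \<delta> \<and> norm (L s) < \<tau> * \<delta> \<and> (\<forall>i. s $ i > 0)")
          case True
          have "norm (G \<tau> s) = norm (\<rho>' (p + L s /\<^sub>R \<tau>)) * norm (P \<tau> (p + L s /\<^sub>R \<tau>)) * exp (L s \<bullet> \<omega>)"
            using True G_eq[OF \<tau>] nv[OF \<tau>] by (simp add: norm_mult)
          also have "\<dots> \<le> R * M * exp (L s \<bullet> \<omega>)"
            using True R P_bound[OF elim] by (intro mult_right_mono mult_mono) auto
          finally show ?thesis using True by (simp add: norm_E)
        next
          case False
          then have "G \<tau> s = 0" using G_eq[OF \<tau>, of s] by (auto simp: G_def near_def indicator_def)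
          then show ?thesis using R M_nonneg by simp
        qed
      qed
    qed
  qed
  then show ?thesis by (simp add: G_def[abs_def])
qed

text \<open>On the compact part of the closure outside the ball, \<open>x \<bullet> \<omega>\<close>
  attains a maximum strictly below \<open>p \<bullet> \<omega>\<close>; the gap \<open>d\<close> is
  the exponential gain. If that part is empty, any positive \<open>d\<close> will do.\<close>

lemma far_estimate:
  obtains d B where "d > 0" "\<And>\<tau>. \<tau> \<ge> 1 \<Longrightarrow>
     norm (\<integral>x. indicator (- ball p \<delta>) x *\<^sub>R (\<rho> x * (P \<tau> x * v \<tau> x)) \<partial>lebesgue_on D) \<le> B * exp (\<tau> * (p \<bullet> \<omega> - d))"
proof -
  let ?K = "closure D - ball p \<delta>"
  have cK: "compact ?K" using bounded_D by (intro compact_diff) auto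
  obtain d where d: "d > 0" "\<And>x. x \<in> ?K \<Longrightarrow> x \<bullet> \<omega> \<le> p \<bullet> \<omega> - d"
  proof (cases "?K = {}")
    case True
    then show ?thesis by (intro that[of 1]) auto
  next
    case False
    have "continuous_on ?K (\<lambda>x. x \<bullet> \<omega>)" by (intro continuous_intros)
    from continuous_attains_sup[OF cK False this] obtain x0
      where x0: "x0 \<in> ?K" "\<And>x. x \<in> ?K \<Longrightarrow> x \<bullet> \<omega> \<le> x0 \<bullet> \<omega>" by blast
    have "x0 \<noteq> p" using x0(1) \<delta>_pos by auto
    then have "x0 \<bullet> \<omega> < p \<bullet> \<omega>" using max x0(1) by blast
    with x0 show ?thesis by (intro that[of "p \<bullet> \<omega> - x0 \<bullet> \<omega>"]) auto
  qed
  define B where "B = M * (\<integral>x. norm (\<rho> x) \<partial>lebesgue_on D)"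
  have "norm (\<integral>x. indicator (- ball p \<delta>) x *\<^sub>R (\<rho> x * (P \<tau> x * v \<tau> x)) \<partial>lebesgue_on D) \<le> B * exp (\<tau> * (p \<bullet> \<omega> - d))"
    if \<tau>: "\<tau> \<ge> 1" for \<tau>
  proof -
    have "norm (\<integral>x. indicator (- ball p \<delta>) x *\<^sub>R (\<rho> x * (P \<tau> x * v \<tau> x)) \<partial>lebesgue_on D)
      \<le> (\<integral>x. norm (indicator (- ball p \<delta>) x *\<^sub>R (\<rho> x * (P \<tau> x * v \<tau> x))) \<partial>lebesgue_on D)"
      by (rule integral_norm_bound)
    also have "\<dots> \<le> (\<integral>x. (M * exp (\<tau> * (p \<bullet> \<omega> - d))) * norm (\<rho> x) \<partial>lebesgue_on D)"
    proof (rule integral_mono_AE')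
      show "integrable (lebesgue_on D) (\<lambda>x. (M * exp (\<tau> * (p \<bullet> \<omega> - d))) * norm (\<rho> x))"
        by (intro integrable_mult_right integrable_norm \<rho>_int)
      show "AE x in lebesgue_on D. norm (indicator (- ball p \<delta>) x *\<^sub>R (\<rho> x * (P \<tau> x * v \<tau> x))) \<le> (M * exp (\<tau> * (p \<bullet> \<omega> - d))) * norm (\<rho> x)"
      proof (rule AE_I2)
        fix x assume "x \<in> space (lebesgue_on D)"
        then have x: "x \<in> D" by (simp add: space_restrict_space)
        show "norm (indicator (- ball p \<delta>) x *\<^sub>R (\<rho> x * (P \<tau> x * v \<tau> x))) \<le> (M * exp (\<tau> * (p \<bullet> \<omega> - d))) * norm (\<rho> x)"
        proof (cases "x \<in> ball p \<delta>")
          case True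
          then show ?thesis using M_nonneg by simp
        next
          case False
          then have "x \<bullet> \<omega> \<le> p \<bullet> \<omega> - d" using d(2)[of x] x closure_subset by blast
          then have "\<tau> * (x \<bullet> \<omega>) \<le> \<tau> * (p \<bullet> \<omega> - d)" using \<tau> by (intro mult_left_mono) auto
          then have "norm (P \<tau> x) * norm (v \<tau> x) \<le> M * exp (\<tau> * (p \<bullet> \<omega> - d))"
            unfolding norm_v using P_bound[OF \<tau> x] M_nonneg by (intro mult_mono) auto
          from mult_left_mono[OF this norm_ge_zero[of "\<rho> x"]]
          show ?thesis using False by (simp add: norm_mult mult_ac)
        qed
      qed
    qed (simp add: M_nonneg)
    also have "\<dots> = B * exp (\<tau> * (p \<bullet> \<omega> - d))" by (simp add: B_def)
    finally show ?thesis .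
  qed
  then show ?thesis using that[OF d(1)] by blast
qed

lemma measurable_integrand: "(\<lambda>x. \<rho> x * (P \<tau> x * v \<tau> x)) \<in> borel_measurable (lebesgue_on D)"
proof -
  have "(\<lambda>x. P \<tau> x * v \<tau> x) \<in> borel_measurable (lebesgue_on D)"
    by (intro measurable_restrict_space1 measurable_completion)
      (simp, intro borel_measurable_continuous_onI continuous_intros P_cont cont_v)
  then show ?thesis using borel_measurable_integrable[OF \<rho>_int] by measurable
qed

lemma integrable_integrand:
  assumes "\<tau> \<ge> 1"
  shows "integrable (lebesgue_on D) (\<lambda>x. \<rho> x * (P \<tau> x * v \<tau> x))"
proof (rule Bochner_Integration.integrable_bound)
  show "integrable (lebesgue_on D) (\<lambda>x. (M * exp (\<tau> * (p \<bullet> \<omega>))) * norm (\<rho> x))"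
    by (intro integrable_mult_right integrable_norm \<rho>_int)
  show "(\<lambda>x. \<rho> x * (P \<tau> x * v \<tau> x)) \<in> borel_measurable (lebesgue_on D)" by (rule measurable_integrand)
  show "AE x in lebesgue_on D. norm (\<rho> x * (P \<tau> x * v \<tau> x)) \<le> norm ((M * exp (\<tau> * (p \<bullet> \<omega>))) * norm (\<rho> x))"
  proof (rule AE_I2)
    fix x assume "x \<in> space (lebesgue_on D)"
    then have x: "x \<in> D" by (simp add: space_restrict_space)
    have "x \<bullet> \<omega> \<le> p \<bullet> \<omega>" using max[of x] x closure_subset by (cases "x = p") force+
    then have "norm (P \<tau> x) * norm (v \<tau> x) \<le> M * exp (\<tau> * (p \<bullet> \<omega>))"
      unfolding norm_v using P_bound[OF assms x] M_nonneg assms by (intro mult_mono) auto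
    from mult_left_mono[OF this norm_ge_zero[of "\<rho> x"]]
    show "norm (\<rho> x * (P \<tau> x * v \<tau> x)) \<le> norm ((M * exp (\<tau> * (p \<bullet> \<omega>))) * norm (\<rho> x))"
      using M_nonneg by (simp add: norm_mult mult_ac)
  qed
qed

text \<open>\<open>\<rho>\<close> is given as a Lebesgue measurable function. The part near
  \<open>p\<close> passes from Lebesgue to Borel measure after \<open>\<rho>\<close> has been
  exchanged for \<open>\<rho>'\<close> up to a null set.\<close>

lemma integral_split:
  assumes "\<tau> \<ge> 1"
  shows "(\<integral>x. \<rho> x * (P \<tau> x * v \<tau> x) \<partial>lebesgue_on D) = (\<integral>x. near \<tau> x \<partial>lborel)
     + (\<integral>x. indicator (- ball p \<delta>) x *\<^sub>R (\<rho> x * (P \<tau> x * v \<tau> x)) \<partial>lebesgue_on D)"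
proof -
  let ?f = "\<lambda>x. \<rho> x * (P \<tau> x * v \<tau> x)"
  have bs: "ball p \<delta> \<inter> D \<in> sets (lebesgue_on D)" "(- ball p \<delta>) \<inter> D \<in> sets (lebesgue_on D)"
    using sets_D(2) by (auto simp: sets_restrict_space_iff)
  have i: "integrable (lebesgue_on D) (\<lambda>x. indicator (A \<inter> D) x *\<^sub>R ?f x)" if "A \<inter> D \<in> sets (lebesgue_on D)" for A
    by (rule integrable_mult_indicator[OF that integrable_integrand[OF assms]])
  have cg: "(\<integral>x. indicator (A \<inter> D) x *\<^sub>R ?f x \<partial>lebesgue_on D) = (\<integral>x. indicator A x *\<^sub>R ?f x \<partial>lebesgue_on D)" for A
    by (intro Bochner_Integration.integral_cong refl) (auto simp: indicator_def space_restrict_space)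
  have "(\<integral>x. ?f x \<partial>lebesgue_on D) = (\<integral>x. indicator (ball p \<delta> \<inter> D) x *\<^sub>R ?f x + indicator ((- ball p \<delta>) \<inter> D) x *\<^sub>R ?f x \<partial>lebesgue_on D)"
    by (intro Bochner_Integration.integral_cong refl) (auto simp: indicator_def space_restrict_space)
  also have "\<dots> = (\<integral>x. indicator (ball p \<delta> \<inter> D) x *\<^sub>R ?f x \<partial>lebesgue_on D) + (\<integral>x. indicator ((- ball p \<delta>) \<inter> D) x *\<^sub>R ?f x \<partial>lebesgue_on D)"
    by (intro Bochner_Integration.integral_add i bs)
  also have "(\<integral>x. indicator (ball p \<delta> \<inter> D) x *\<^sub>R ?f x \<partial>lebesgue_on D) = (\<integral>x. indicator D x *\<^sub>R (indicator (ball p \<delta> \<inter> D) x *\<^sub>R ?f x) \<partial>lebesgue)"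
    using sets_D by (intro integral_restrict_space) auto
  also have "\<dots> = (\<integral>x. near \<tau> x \<partial>lebesgue)"
  proof (rule integral_cong_AE)
    have "(\<lambda>x. indicator (ball p \<delta> \<inter> D) x *\<^sub>R ?f x) \<in> borel_measurable (lebesgue_on D)"
      using i[OF bs(1)] by (rule borel_measurable_integrable)
    then show "(\<lambda>x. indicator D x *\<^sub>R (indicator (ball p \<delta> \<inter> D) x *\<^sub>R ?f x)) \<in> borel_measurable lebesgue"
      using sets_D by (subst (asm) borel_measurable_restrict_space_iff) (auto simp: mult.commute)
    show "near \<tau> \<in> borel_measurable lebesgue"
      using near_measurable by (intro measurable_completion) simp
    show "AE x in lebesgue. indicator D x *\<^sub>R (indicator (ball p \<delta> \<inter> D) x *\<^sub>R ?f x) = near \<tau> x"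
      using \<rho>_eq by eventually_elim (auto simp: near_def indicator_def)
  qed
  also have "\<dots> = (\<integral>x. near \<tau> x \<partial>lborel)"
    using near_measurable by (intro integral_completion) simp
  finally show ?thesis by (simp only: cg)
qed

theorem cone_asymptotics:
  "((\<lambda>\<tau>. of_real (\<tau>^3) * (\<integral>x. \<rho> x * (P \<tau> x * v \<tau> x) \<partial>lebesgue_on D) / v \<tau> p) \<longlongrightarrow> P\<^sub>0 * tip_constant) at_top"
proof -
  obtain d B where d: "d > 0" and far: "\<And>\<tau>. \<tau> \<ge> 1 \<Longrightarrow>
     norm (\<integral>x. indicator (- ball p \<delta>) x *\<^sub>R (\<rho> x * (P \<tau> x * v \<tau> x)) \<partial>lebesgue_on D) \<le> B * exp (\<tau> * (p \<bullet> \<omega> - d))"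
    using far_estimate by blast
  let ?far = "\<lambda>\<tau>. \<integral>x. indicator (- ball p \<delta>) x *\<^sub>R (\<rho> x * (P \<tau> x * v \<tau> x)) \<partial>lebesgue_on D"
  \<comment> \<open>The gap leaves a factor \<open>exp (- (d * \<tau>))\<close> after division by
    \<open>v \<tau> p\<close>, and this beats \<open>\<tau>^3\<close>.\<close>
  have far0: "((\<lambda>\<tau>. of_real (\<tau>^3) * ?far \<tau> / v \<tau> p) \<longlongrightarrow> 0) at_top"
  proof (rule Lim_null_comparison)
    have "filterlim (\<lambda>\<tau>. d * \<tau>) at_top at_top"
      using d by (intro filterlim_tendsto_pos_mult_at_top[OF tendsto_const _ filterlim_ident])
    from filterlim_compose[OF tendsto_power_div_exp_0[of 3] this]
    have "((\<lambda>\<tau>. (B / d^3) * ((d * \<tau>)^3 / exp (d * \<tau>))) \<longlongrightarrow> (B / d^3) * 0) at_top"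
      by (intro tendsto_mult tendsto_const)
    then show "((\<lambda>\<tau>. B * \<tau>^3 * exp (- (d * \<tau>))) \<longlongrightarrow> 0) at_top"
      using d by (simp add: power_mult_distrib exp_minus divide_inverse mult_ac)
    show "\<forall>\<^sub>F \<tau> in at_top. norm (of_real (\<tau>^3) * ?far \<tau> / v \<tau> p) \<le> B * \<tau>^3 * exp (- (d * \<tau>))"
      using eventually_ge_at_top[of 1]
    proof eventually_elim
      case (elim \<tau>)
      have e: "exp (\<tau> * (p \<bullet> \<omega> - d)) = exp (\<tau> * (p \<bullet> \<omega>)) * exp (- (d * \<tau>))"
        by (simp add: exp_add[symmetric] algebra_simps)
      have "norm (of_real (\<tau>^3) * ?far \<tau> / v \<tau> p) = \<tau>^3 * norm (?far \<tau>) / exp (\<tau> * (p \<bullet> \<omega>))"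
        using elim by (simp add: norm_mult norm_divide norm_v norm_power)
      also have "\<dots> \<le> \<tau>^3 * (B * exp (\<tau> * (p \<bullet> \<omega> - d))) / exp (\<tau> * (p \<bullet> \<omega>))"
        using far[OF elim] elim by (intro divide_right_mono mult_left_mono) auto
      also have "\<dots> = B * \<tau>^3 * exp (- (d * \<tau>))" unfolding e by simp
      finally show ?case .
    qed
  qed
  have "((\<lambda>\<tau>. c *\<^sub>R (\<integral>s. near \<tau> (p + L s /\<^sub>R \<tau>) / v \<tau> p \<partial>lborel) + of_real (\<tau>^3) * ?far \<tau> / v \<tau> p)
     \<longlongrightarrow> c *\<^sub>R (\<integral>s. (\<rho>' p * P\<^sub>0) * E s \<partial>lborel) + 0) at_top"
    by (intro tendsto_add tendsto_scaleR tendsto_const near_limit far0)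
  moreover have "\<forall>\<^sub>F \<tau> in at_top. c *\<^sub>R (\<integral>s. near \<tau> (p + L s /\<^sub>R \<tau>) / v \<tau> p \<partial>lborel) + of_real (\<tau>^3) * ?far \<tau> / v \<tau> p
     = of_real (\<tau>^3) * (\<integral>x. \<rho> x * (P \<tau> x * v \<tau> x) \<partial>lebesgue_on D) / v \<tau> p"
    using eventually_ge_at_top[of 1]
  proof eventually_elim
    case (elim \<tau>)
    then have \<tau>: "\<tau> > 0" by simp
    have "of_real (\<tau>^3) * (\<integral>x. near \<tau> x \<partial>lborel) / v \<tau> p = c *\<^sub>R (\<integral>s. near \<tau> (p + L s /\<^sub>R \<tau>) / v \<tau> p \<partial>lborel)"
      unfolding integral_rescale[OF near_measurable \<tau>] using \<tau> by (simp add: scaleR_conv_of_real)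
    then show ?case unfolding integral_split[OF elim] by (simp add: distrib_left add_divide_distrib)
  qed
  ultimately have "((\<lambda>\<tau>. of_real (\<tau>^3) * (\<integral>x. \<rho> x * (P \<tau> x * v \<tau> x) \<partial>lebesgue_on D) / v \<tau> p)
     \<longlongrightarrow> c *\<^sub>R (\<integral>s. (\<rho>' p * P\<^sub>0) * E s \<partial>lborel) + 0) at_top"
    by (rule Lim_transform_eventually)
  moreover have "c *\<^sub>R (\<integral>s. (\<rho>' p * P\<^sub>0) * E s \<partial>lborel) + 0 = P\<^sub>0 * tip_constant"
    by (simp add: tip_constant_def)
  ultimately show ?thesis by simp
qed

end

end

section \<open>The indicator function\<close>

text \<open>The supporting hyperplane of a regular direction cuts \<open>P\<close> in a face that is
  a single point, and singleton faces are extreme points. Convexity and nonempty interior give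
  \<open>closure D = P\<close>, which transfers the contact set from \<open>D\<close> to
  \<open>P\<close>.\<close>

lemma contact_point_exposed:
  assumes P: "polyhedron P" "D = interior P" and D: "D \<noteq> {}" "bounded D" and reg: "regular_direction D \<omega>"
  defines "p \<equiv> contact_point D \<omega>"
  shows "p \<in> closure D" "p \<bullet> \<omega> = support_fun D \<omega>" "p extreme_point_of P"
    "\<And>x. x \<in> closure D \<Longrightarrow> x \<noteq> p \<Longrightarrow> x \<bullet> \<omega> < p \<bullet> \<omega>"
proof -
  have cs: "contact_set D \<omega> = {p}"
    using reg unfolding regular_direction_def p_def contact_point_def by (simp add: is_singleton_the_elem)
  then have "p \<in> contact_set D \<omega>" by simp
  then have pc': "p \<in> closure D \<and> p \<bullet> \<omega> = support_fun D \<omega>" unfolding contact_set_def by (rule CollectD)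
  show "p \<in> closure D" and p2: "p \<bullet> \<omega> = support_fun D \<omega>" by (rule pc'[THEN conjunct1], rule pc'[THEN conjunct2])
  have conv: "convex P" by (rule polyhedron_imp_convex[OF P(1)])
  have cl: "closure D = P"
    using convex_closure_interior[OF conv] P(2) D(1) closure_closed[OF polyhedron_imp_closed[OF P(1)]] by simp
  have "bounded ((\<lambda>x. x \<bullet> \<omega>) ` D)"
    using D(2) by (intro bounded_linear_image bounded_linear_inner_left)
  then have bdd: "bdd_above ((\<lambda>x. x \<bullet> \<omega>) ` D)" by (rule bounded_imp_bdd_above)
  have "D \<subseteq> {x. x \<bullet> \<omega> \<le> support_fun D \<omega>}"
    unfolding support_fun_def using cSUP_upper[OF _ bdd] by auto
  moreover have "closed {x. x \<bullet> \<omega> \<le> support_fun D \<omega>}" by (intro closed_Collect_le continuous_intros)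
  ultimately have le: "x \<bullet> \<omega> \<le> support_fun D \<omega>" if "x \<in> closure D" for x
    using that closure_minimal by blast
  show "x \<bullet> \<omega> < p \<bullet> \<omega>" if "x \<in> closure D" "x \<noteq> p" for x
  proof -
    have "x \<notin> contact_set D \<omega>" using cs that(2) by simp
    then have "x \<bullet> \<omega> \<noteq> support_fun D \<omega>" using that(1) by (simp add: contact_set_def)
    then show ?thesis using le[OF that(1)] p2 by simp
  qed
  have "(P \<inter> {x. \<omega> \<bullet> x = support_fun D \<omega>}) face_of P"
    using le cl by (intro face_of_Int_supporting_hyperplane_le[OF conv]) (simp add: inner_commute)
  moreover have "P \<inter> {x. \<omega> \<bullet> x = support_fun D \<omega>} = {p}"
    using cs cl unfolding contact_set_def by (auto simp: inner_commute)
  ultimately show "p extreme_point_of P" by (simp add: face_of_singleton)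
qed

lemma hoelder_continuous_on:
  fixes f :: "real^3 \<Rightarrow> complex"
  assumes "\<And>x y. x \<in> U \<Longrightarrow> y \<in> U \<Longrightarrow> norm (f x - f y) \<le> C * dist x y powr \<alpha>" "\<alpha> > 0"
  shows "continuous_on U f"
  unfolding continuous_on_def
proof
  fix x assume x: "x \<in> U"
  show "(f \<longlongrightarrow> f x) (at x within U)"
  proof (rule LIM_zero_cancel, rule Lim_null_comparison)
    show "\<forall>\<^sub>F y in at x within U. norm (f y - f x) \<le> C * dist y x powr \<alpha>"
      unfolding eventually_at_filter using assms(1) x by simp
    have "((\<lambda>y. dist y x) \<longlongrightarrow> dist x x) (at x within U)" by (intro tendsto_intros)
    then have "((\<lambda>y. dist y x powr \<alpha>) \<longlongrightarrow> 0) (at x within U)"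
      using assms(2) by (intro tendsto_zero_powrI[OF _ tendsto_const]) auto
    from tendsto_mult[OF tendsto_const[of C] this]
    show "((\<lambda>y. C * dist y x powr \<alpha>) \<longlongrightarrow> 0) (at x within U)" by simp
  qed
qed

text \<open>The cone description concerns the open octant, which excludes its edges; the point on
  the edge is a limit of points of \<open>D\<close> shifted inwards by multiples of the diagonal
  vector (1, 1, 1).\<close>

lemma edge_direction_in_closure:
  fixes L :: "real^3 \<Rightarrow> real^3"
  assumes L: "linear L" and \<delta>: "\<delta> > 0"
    and cone: "\<And>s. norm (L s) < \<delta> \<Longrightarrow> p + L s \<in> D \<longleftrightarrow> (\<forall>i. s $ i > 0)"
  obtains \<epsilon> where "\<epsilon> > 0" "p + \<epsilon> *\<^sub>R L (axis i 1) \<in> closure D"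
proof -
  define a where "a = L (axis i 1)"
  define o1 where "o1 = L (\<chi> j. 1)"
  \<comment> \<open>The edge part and the diagonal part may each use half of
    \<open>\<delta>\<close>; the \<open>1 +\<close> in the denominators avoids division by zero and
    makes both bounds strict.\<close>
  define \<epsilon> where "\<epsilon> = \<delta> / (2 * (1 + norm a))"
  define \<kappa> where "\<kappa> = \<delta> / (2 * (1 + norm o1))"
  have na: "1 + norm a > 0" "1 + norm o1 > 0" using norm_ge_zero[of a] norm_ge_zero[of o1] by linarith+
  have \<epsilon>: "\<epsilon> > 0" and \<kappa>: "\<kappa> > 0" using \<delta> na by (simp_all add: \<epsilon>_def \<kappa>_def)
  have e1: "\<epsilon> * norm a < \<delta> / 2"
  proof -
    have "\<epsilon> * norm a < \<epsilon> * (1 + norm a)" using \<epsilon> by simp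
    also have "\<dots> = \<delta> / 2" using na by (simp add: \<epsilon>_def field_simps)
    finally show ?thesis .
  qed
  have k1: "\<kappa> * norm o1 < \<delta> / 2"
  proof -
    have "\<kappa> * norm o1 < \<kappa> * (1 + norm o1)" using \<kappa> by simp
    also have "\<dots> = \<delta> / 2" using na by (simp add: \<kappa>_def field_simps)
    finally show ?thesis .
  qed
  let ?t = "\<lambda>n. \<kappa> * inverse (real (Suc n))"
  have t: "0 < ?t n" "?t n \<le> \<kappa>" for n
    using \<kappa> by (simp_all add: mult_left_le inverse_le_1_iff del: of_nat_Suc)
  have eq: "L (\<epsilon> *\<^sub>R axis i 1 + ?t n *\<^sub>R (\<chi> j. 1)) = \<epsilon> *\<^sub>R a + ?t n *\<^sub>R o1" for n
    by (simp add: a_def o1_def linear_add[OF L] linear_scale[OF L])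
  have mem: "p + (\<epsilon> *\<^sub>R a + ?t n *\<^sub>R o1) \<in> D" for n
  proof -
    have "norm (\<epsilon> *\<^sub>R a + ?t n *\<^sub>R o1) \<le> \<epsilon> * norm a + ?t n * norm o1"
      using norm_triangle_ineq[of "\<epsilon> *\<^sub>R a" "?t n *\<^sub>R o1"] \<epsilon> t(1)[of n] by simp
    also have "\<dots> \<le> \<epsilon> * norm a + \<kappa> * norm o1"
      using t(2)[of n] by (intro add_left_mono mult_right_mono) auto
    also have "\<dots> < \<delta>" using e1 k1 by linarith
    finally have "norm (L (\<epsilon> *\<^sub>R axis i 1 + ?t n *\<^sub>R (\<chi> j. 1))) < \<delta>" unfolding eq .
    moreover have "(\<epsilon> *\<^sub>R (axis i 1 :: real^3) + ?t n *\<^sub>R (\<chi> j. 1)) $ j > 0" for j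
      using \<epsilon> t(1)[of n] by (auto simp: axis_def intro: add_nonneg_pos)
    ultimately show ?thesis using cone eq by metis
  qed
  have "(\<lambda>n. p + (\<epsilon> *\<^sub>R a + ?t n *\<^sub>R o1)) \<longlonglongrightarrow> p + (\<epsilon> *\<^sub>R a + (\<kappa> * 0) *\<^sub>R o1)"
    by (intro tendsto_intros LIMSEQ_inverse_real_of_nat)
  then have "(\<lambda>n. p + (\<epsilon> *\<^sub>R a + ?t n *\<^sub>R o1)) \<longlonglongrightarrow> p + \<epsilon> *\<^sub>R a" by simp
  with mem have "p + \<epsilon> *\<^sub>R a \<in> closure D"
    unfolding closure_sequential by (intro exI[of _ "\<lambda>n. p + (\<epsilon> *\<^sub>R a + ?t n *\<^sub>R o1)"] conjI allI)
  with \<epsilon> show ?thesis unfolding a_def by (rule that)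
qed

lemma cone_tip_exists:
  assumes D: "open D" "bounded D" and \<rho>: "integrable (lebesgue_on D) \<rho>"
    and tet: "locally_tetrahedral_at D p" and act: "source_active_at \<rho> D p"
    and max: "\<And>x. x \<in> closure D \<Longrightarrow> x \<noteq> p \<Longrightarrow> x \<bullet> \<omega> < p \<bullet> \<omega>"
  obtains L \<delta> c \<rho>' where "cone_tip D p L \<delta> c \<omega> \<rho> \<rho>'" "\<rho>' p \<noteq> 0"
proof -
  obtain \<eta> K where \<eta>: "\<eta> > 0" and K: "3 simplex K" "p extreme_point_of K"
    and DK: "D \<inter> ball p \<eta> = interior K \<inter> ball p \<eta>"
    using tet unfolding locally_tetrahedral_at_def by blast
  obtain \<eta>' \<alpha> \<rho>' C where \<eta>': "\<eta>' > 0" and \<alpha>: "\<alpha> > 0"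
    and hoel: "\<forall>x\<in>cball p \<eta>'. \<forall>y\<in>cball p \<eta>'. norm (\<rho>' x - \<rho>' y) \<le> C * dist x y powr \<alpha>"
    and ae: "AE x in lebesgue. x \<in> ball p \<eta>' \<inter> D \<longrightarrow> \<rho> x = \<rho>' x" and nz: "\<rho>' p \<noteq> 0"
    using act unfolding source_active_at_def by blast
  obtain L :: "real^3 \<Rightarrow> real^3" and \<delta>1 where L: "linear L" "inj L" and \<delta>1: "\<delta>1 > 0"
    "\<And>s. norm (L s) < \<delta>1 \<Longrightarrow> p + L s \<in> interior K \<longleftrightarrow> (\<forall>i. s $ i > 0)"
    using simplex_cone_at_vertex[OF K] by blast
  obtain c where c: "c > 0" "lborel = density (distr lborel borel L) (\<lambda>_. ennreal c)"
    using lborel_linear_image[OF L] by blast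
  define \<delta> where "\<delta> = min \<delta>1 (min \<eta> \<eta>')"
  have \<delta>: "\<delta> > 0" "\<delta> \<le> \<delta>1" "\<delta> \<le> \<eta>" "\<delta> \<le> \<eta>'" using \<delta>1 \<eta> \<eta>' by (auto simp: \<delta>_def)
  have cone: "p + L s \<in> D \<longleftrightarrow> (\<forall>i. s $ i > 0)" if "norm (L s) < \<delta>" for s
  proof -
    have "p + L s \<in> ball p \<eta>" using that \<delta> by (simp add: dist_norm)
    then have "p + L s \<in> D \<longleftrightarrow> p + L s \<in> interior K" using DK by blast
    then show ?thesis using \<delta>1(2)[of s] that \<delta>(2) by simp
  qed
  have cont: "continuous_on (cball p \<eta>') \<rho>'"
    using hoel \<alpha> by (intro hoelder_continuous_on[where C = C]) auto
  have sub: "ball p \<delta> \<subseteq> cball p \<eta>'" using \<delta>(4) by auto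
  have "compact (\<rho>' ` cball p \<eta>')" using cont by (intro compact_continuous_image) auto
  then have bdd: "bounded (\<rho>' ` ball p \<delta>)"
    using compact_imp_bounded bounded_subset image_mono[OF sub] by metis
  have "cone_tip D p L \<delta> c \<omega> \<rho> \<rho>'"
  proof (rule cone_tip.intro)
    show "linear L" by (rule L(1))
    \<comment> \<open>The closure contains a point on this edge, different from \<open>p\<close>
      since \<open>L\<close> is injective; it lies strictly below the maximum at
      \<open>p\<close>.\<close>
    show "L (axis i 1) \<bullet> \<omega> < 0" for i
    proof -
      obtain \<epsilon> where \<epsilon>: "\<epsilon> > 0" "p + \<epsilon> *\<^sub>R L (axis i 1) \<in> closure D"
        using edge_direction_in_closure[OF L(1) \<delta>(1) cone] by blast
      have "L (axis i 1) \<noteq> 0"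
        using linear_injective_0[OF L(1)] L(2) by (metis axis_eq_0_iff zero_neq_one)
      then have "p + \<epsilon> *\<^sub>R L (axis i 1) \<noteq> p" using \<epsilon>(1) by simp
      from max[OF \<epsilon>(2) this] show ?thesis using \<epsilon>(1) by (simp add: inner_add_left mult_less_0_iff)
    qed
    show "AE x in lebesgue. x \<in> ball p \<delta> \<inter> D \<longrightarrow> \<rho> x = \<rho>' x"
      using ae by eventually_elim (use \<delta>(4) in auto)
    show "continuous_on (ball p \<delta>) \<rho>'" by (rule continuous_on_subset[OF cont sub])
  qed (use D c \<delta> cone max \<rho> bdd in auto)
  then show ?thesis using nz by (rule that)
qed

text \<open>Everything follows from \<open>cmod (I \<tau>) = cmod (Q \<tau>) * (exp (\<tau> * h) /
  \<tau>^3)\<close> with \<open>Q\<close> tending to the nonzero \<open>A\<close>: the logarithm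
  divided by \<open>\<tau>\<close> forgets the power, the quotient of the indicators cancels it, and
  at \<open>t = h\<close> it alone forces the limit 0.\<close>

lemma asymptotic_consequences:
  fixes I I' V :: "real \<Rightarrow> complex"
  assumes V: "\<And>\<tau>. norm (V \<tau>) = exp (\<tau> * h)"
    and A: "((\<lambda>\<tau>. of_real (\<tau>^3) * I \<tau> / V \<tau>) \<longlongrightarrow> A) at_top" "A \<noteq> 0"
    and A': "((\<lambda>\<tau>. of_real (\<tau>^3) * I' \<tau> / V \<tau>) \<longlongrightarrow> \<Lambda> * A) at_top"
  shows "\<forall>\<^sub>F \<tau> in at_top. I \<tau> \<noteq> 0"
    and "((\<lambda>\<tau>. ln (cmod (I \<tau>)) / \<tau>) \<longlongrightarrow> h) at_top"
    and "((\<lambda>\<tau>. I' \<tau> / I \<tau>) \<longlongrightarrow> \<Lambda>) at_top"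
    and "t \<ge> h \<Longrightarrow> ((\<lambda>\<tau>. exp (- \<tau> * t) * cmod (I \<tau>)) \<longlongrightarrow> 0) at_top"
    and "t < h \<Longrightarrow> filterlim (\<lambda>\<tau>. exp (- \<tau> * t) * cmod (I \<tau>)) at_top at_top"
proof -
  define Q where "Q \<tau> = of_real (\<tau>^3) * I \<tau> / V \<tau>" for \<tau>
  have Q: "(Q \<longlongrightarrow> A) at_top" using A(1) by (simp add: Q_def[abs_def])
  have Vnz: "V \<tau> \<noteq> 0" for \<tau> using V[of \<tau>] by (metis exp_not_eq_zero norm_zero)
  have ev: "\<forall>\<^sub>F \<tau> in at_top. \<tau> > 0 \<and> Q \<tau> \<noteq> 0 \<and> cmod (I \<tau>) = cmod (Q \<tau>) * (exp (\<tau> * h) / \<tau>^3)"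
    using eventually_gt_at_top[of 0] tendsto_imp_eventually_ne[OF Q A(2)]
  proof eventually_elim
    case (elim \<tau>)
    have "cmod (Q \<tau>) = \<tau>^3 * cmod (I \<tau>) / exp (\<tau> * h)"
      using elim(1) by (simp add: Q_def norm_mult norm_divide V norm_power)
    then show ?case using elim by (simp add: field_simps)
  qed
  have Qn: "((\<lambda>\<tau>. cmod (Q \<tau>)) \<longlongrightarrow> cmod A) at_top" by (intro tendsto_norm Q)
  show "\<forall>\<^sub>F \<tau> in at_top. I \<tau> \<noteq> 0"
    using ev by eventually_elim (auto simp: Q_def)
  have inv0: "((\<lambda>\<tau>::real. inverse \<tau>) \<longlongrightarrow> 0) at_top" by (rule tendsto_inverse_0_at_top[OF filterlim_ident])
  have "((\<lambda>\<tau>. ln (cmod (Q \<tau>)) * inverse \<tau> - 3 * (ln \<tau> / \<tau>) + h) \<longlongrightarrow> ln (cmod A) * 0 - 3 * 0 + h) at_top"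
    using A(2) by (intro tendsto_intros Qn inv0 ln_x_over_x_tendsto_0) auto
  moreover have "\<forall>\<^sub>F \<tau> in at_top. ln (cmod (Q \<tau>)) * inverse \<tau> - 3 * (ln \<tau> / \<tau>) + h = ln (cmod (I \<tau>)) / \<tau>"
    using ev
  proof eventually_elim
    case (elim \<tau>)
    then have "\<tau> > 0" "cmod (Q \<tau>) > 0" by auto
    then have "ln (cmod (I \<tau>)) = ln (cmod (Q \<tau>)) + (\<tau> * h - 3 * ln \<tau>)"
      using elim by (simp add: ln_mult ln_div ln_realpow)
    then show ?case using elim by (simp add: field_simps)
  qed
  ultimately show "((\<lambda>\<tau>. ln (cmod (I \<tau>)) / \<tau>) \<longlongrightarrow> h) at_top"
    by (simp add: Lim_transform_eventually)
  have "((\<lambda>\<tau>. (of_real (\<tau>^3) * I' \<tau> / V \<tau>) / Q \<tau>) \<longlongrightarrow> (\<Lambda> * A) / A) at_top"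
    by (intro tendsto_divide A' Q A(2))
  moreover have "\<forall>\<^sub>F \<tau> in at_top. (of_real (\<tau>^3) * I' \<tau> / V \<tau>) / Q \<tau> = I' \<tau> / I \<tau>"
    using ev by eventually_elim (use Vnz in \<open>auto simp: Q_def\<close>)
  ultimately show "((\<lambda>\<tau>. I' \<tau> / I \<tau>) \<longlongrightarrow> \<Lambda>) at_top"
    using A(2) by (simp add: Lim_transform_eventually)
  have form: "\<forall>\<^sub>F \<tau> in at_top. \<tau> > 0 \<and> exp (- \<tau> * t) * cmod (I \<tau>) = cmod (Q \<tau>) * (exp ((h - t) * \<tau>) / \<tau>^3)"
    using ev
  proof eventually_elim
    case (elim \<tau>)
    have "exp ((h - t) * \<tau>) = exp (- \<tau> * t) * exp (\<tau> * h)" by (simp add: exp_add[symmetric] algebra_simps)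
    then show ?case using elim by simp
  qed
  show "((\<lambda>\<tau>. exp (- \<tau> * t) * cmod (I \<tau>)) \<longlongrightarrow> 0) at_top" if "t \<ge> h"
  proof (rule Lim_null_comparison)
    have "((\<lambda>\<tau>. cmod (Q \<tau>) * (inverse \<tau>)^3) \<longlongrightarrow> cmod A * 0^3) at_top"
      by (intro tendsto_intros Qn inv0)
    then show "((\<lambda>\<tau>. cmod (Q \<tau>) * (inverse \<tau>)^3) \<longlongrightarrow> 0) at_top" by simp
    show "\<forall>\<^sub>F \<tau> in at_top. norm (exp (- \<tau> * t) * cmod (I \<tau>)) \<le> cmod (Q \<tau>) * (inverse \<tau>)^3"
      using form
    proof eventually_elim
      case (elim \<tau>)
      have "(h - t) * \<tau> \<le> 0" using elim that by (simp add: mult_nonpos_nonneg)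
      then have "exp ((h - t) * \<tau>) / \<tau>^3 \<le> 1 / \<tau>^3" using elim by (intro divide_right_mono) auto
      then have "cmod (Q \<tau>) * (exp ((h - t) * \<tau>) / \<tau>^3) \<le> cmod (Q \<tau>) * (1 / \<tau>^3)"
        by (intro mult_left_mono) auto
      moreover have "norm (exp (- \<tau> * t) * cmod (I \<tau>)) = exp (- \<tau> * t) * cmod (I \<tau>)" by simp
      ultimately show ?case using elim by (simp add: power_one_over inverse_eq_divide)
    qed
  qed
  show "filterlim (\<lambda>\<tau>. exp (- \<tau> * t) * cmod (I \<tau>)) at_top at_top" if "t < h"
  proof -
    define d where "d = h - t"
    have d: "d > 0" using that by (simp add: d_def)
    have "filterlim (\<lambda>\<tau>. d * \<tau>) at_top at_top"
      using d by (intro filterlim_tendsto_pos_mult_at_top[OF tendsto_const _ filterlim_ident])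
    from filterlim_compose[OF tendsto_power_div_exp_0[of 3] this]
    have "((\<lambda>\<tau>. (1 / d^3) * ((d * \<tau>)^3 / exp (d * \<tau>))) \<longlongrightarrow> (1 / d^3) * 0) at_top"
      by (intro tendsto_mult tendsto_const)
    then have l0: "((\<lambda>\<tau>. \<tau>^3 / exp (d * \<tau>)) \<longlongrightarrow> 0) at_top"
      using d by (simp add: power_mult_distrib)
    \<comment> \<open>The quotient tends to 0 through positive values, so its reciprocal tends to
      plus infinity.\<close>
    have "filterlim (\<lambda>\<tau>. inverse (\<tau>^3 / exp (d * \<tau>))) at_top at_top"
      by (rule filterlim_inverse_at_top[OF l0])
        (use eventually_gt_at_top[of 0] in \<open>eventually_elim, simp\<close>)
    then have "filterlim (\<lambda>\<tau>. cmod (Q \<tau>) * inverse (\<tau>^3 / exp (d * \<tau>))) at_top at_top"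
      using A(2) by (intro filterlim_tendsto_pos_mult_at_top[OF Qn]) auto
    then show ?thesis
    proof (rule filterlim_mono_eventually[OF _ order_refl order_refl])
      show "\<forall>\<^sub>F \<tau> in at_top. cmod (Q \<tau>) * inverse (\<tau>^3 / exp (d * \<tau>)) = exp (- \<tau> * t) * cmod (I \<tau>)"
        using form by eventually_elim (simp add: d_def)
    qed
  qed
qed

section \<open>Complex wave vectors and the final assembly\<close>

definition phase :: "real^3 \<Rightarrow> real^3 \<Rightarrow> real \<Rightarrow> real \<Rightarrow> complex^3" where
  "phase \<omega> \<theta> \<alpha> \<beta> = (\<chi> j. of_real (\<alpha> * \<omega> $ j) + \<i> * of_real (\<beta> * \<theta> $ j))"

lemma ldot_phase: "ldot (phase \<omega> \<theta> \<alpha> \<beta>) x = of_real (\<alpha> * (x \<bullet> \<omega>)) + \<i> * of_real (\<beta> * (x \<bullet> \<theta>))"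
  by (simp add: ldot_def phase_def inner_vec_def sum.distrib sum_distrib_left algebra_simps)

text \<open>Orthogonality of \<open>\<omega>\<close> and \<open>\<theta>\<close> removes the mixed
  terms; as \<open>cdot\<close> does not conjugate, the part along \<open>\<theta>\<close> enters
  with a minus sign.\<close>

lemma cdot_phase:
  assumes "norm \<omega> = 1" "norm \<theta> = 1" "\<omega> \<bullet> \<theta> = 0"
  shows "cdot (phase \<omega> \<theta> \<alpha> \<beta>) (phase \<omega> \<theta> \<alpha>' \<beta>') = of_real (\<alpha> * \<alpha>' - \<beta> * \<beta>')"
proof -
  have 1: "\<omega> \<bullet> \<omega> = 1" "\<theta> \<bullet> \<theta> = 1" using assms by (simp_all add: norm_eq_1)
  have "cdot (phase \<omega> \<theta> \<alpha> \<beta>) (phase \<omega> \<theta> \<alpha>' \<beta>')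
     = of_real (\<alpha> * \<alpha>' * (\<omega> \<bullet> \<omega>) - \<beta> * \<beta>' * (\<theta> \<bullet> \<theta>)) + \<i> * of_real ((\<alpha> * \<beta>' + \<beta> * \<alpha>') * (\<omega> \<bullet> \<theta>))"
    by (simp add: cdot_def phase_def inner_vec_def sum.distrib sum_subtractf sum_distrib_left algebra_simps)
  then show ?thesis using 1 assms(3) by simp
qed

text \<open>The linear amplitude of the second solution is the \<open>\<tau>\<close>-derivative of
  the wave vector \<open>z\<close>. As \<open>cdot z z\<close> keeps the value \<open>- k^2\<close>
  for all \<open>\<tau>\<close>, differentiation explains the orthogonality that
  \<open>boundary_indicator_poly_exp\<close> asks for.\<close>

lemma exp_solution_eq_poly_exp:
  "exp_solution k \<omega> \<theta> \<tau> = poly_exp 1 0 (phase \<omega> \<theta> \<tau> (sqrt (\<tau>\<^sup>2 + k\<^sup>2)))"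
  "exp_solution_deriv k \<omega> \<theta> \<tau> = poly_exp 0 (phase \<omega> \<theta> 1 (\<tau> / sqrt (\<tau>\<^sup>2 + k\<^sup>2))) (phase \<omega> \<theta> \<tau> (sqrt (\<tau>\<^sup>2 + k\<^sup>2)))"
proof -
  have "ldot 0 x = 0" for x by (simp add: ldot_def)
  then show "exp_solution k \<omega> \<theta> \<tau> = poly_exp 1 0 (phase \<omega> \<theta> \<tau> (sqrt (\<tau>\<^sup>2 + k\<^sup>2)))"
    by (intro ext) (simp only: exp_solution_def poly_exp_def ldot_phase, simp)
  show "exp_solution_deriv k \<omega> \<theta> \<tau> = poly_exp 0 (phase \<omega> \<theta> 1 (\<tau> / sqrt (\<tau>\<^sup>2 + k\<^sup>2))) (phase \<omega> \<theta> \<tau> (sqrt (\<tau>\<^sup>2 + k\<^sup>2)))"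
    by (intro ext) (simp only: exp_solution_deriv_def exp_solution_def poly_exp_def ldot_phase, simp)
qed

lemma source_integral:
  assumes D: "D \<in> sets lebesgue" "D \<subseteq> \<Omega>" and \<Omega>: "\<Omega> \<in> sets lebesgue"
    and i: "integrable (lebesgue_on D) (\<lambda>x. \<rho> x * w x)"
  shows "integrable (lebesgue_on \<Omega>) (\<lambda>x. source \<rho> D x * w x)"
    "(\<integral>x. source \<rho> D x * w x \<partial>lebesgue_on \<Omega>) = (\<integral>x. \<rho> x * w x \<partial>lebesgue_on D)"
proof -
  have eq: "indicator \<Omega> x *\<^sub>R (source \<rho> D x * w x) = indicator D x *\<^sub>R (\<rho> x * w x)" for x
    using D(2) by (auto simp: indicator_def source_def)
  show "integrable (lebesgue_on \<Omega>) (\<lambda>x. source \<rho> D x * w x)"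
    using i D \<Omega> by (simp add: integrable_restrict_space eq)
  show "(\<integral>x. source \<rho> D x * w x \<partial>lebesgue_on \<Omega>) = (\<integral>x. \<rho> x * w x \<partial>lebesgue_on D)"
    using D \<Omega> by (simp add: integral_restrict_space eq)
qed

text \<open>The logarithm at 0 and division by 0 have default values, so limits alone would not show
  that the expressions are meaningful; eventual nonvanishing of \<open>I\<close> is therefore part
  of the conclusion.\<close>

theorem corollary1p2:
  fixes \<Omega> D P :: "(real^3) set" and k :: real
    and \<rho> u T :: "real^3 \<Rightarrow> complex" and Du :: "real^3 \<Rightarrow> complex^3"
    and S :: "(real^3) measure" and \<omega> \<theta> :: "real^3" and I I' :: "real \<Rightarrow> complex"
  assumes "open \<Omega>" "connected \<Omega>" "bounded \<Omega>" "Ck_boundary 2 \<Omega>"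
    and "k \<ge> 0"
    and "open D" "D \<noteq> {}" "closure D \<subseteq> \<Omega>"
    and "L2 (lebesgue_on D) \<rho>"
    and "weak_solution \<Omega> k (source \<rho> D) u Du"
    and "surface_measure_on (frontier \<Omega>) S"
    and "boundary_trace \<Omega> S u Du T"
    and "polyhedron P" "D = interior P"
    and "\<And>p. p extreme_point_of P \<Longrightarrow> locally_tetrahedral_at D p \<and> source_active_at \<rho> D p"
    and "norm \<omega> = 1" "regular_direction D \<omega>"
    and "norm \<theta> = 1" "\<omega> \<bullet> \<theta> = 0"
  defines "I \<equiv> \<lambda>\<tau>. boundary_indicator \<Omega> S k (source \<rho> D) u Du T (exp_solution k \<omega> \<theta> \<tau>)"
    and "I' \<equiv> \<lambda>\<tau>. boundary_indicator \<Omega> S k (source \<rho> D) u Du T (exp_solution_deriv k \<omega> \<theta> \<tau>)"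
  shows "(\<forall>\<^sub>F \<tau> in at_top. I \<tau> \<noteq> 0) \<and>
    ((\<lambda>\<tau>. ln (cmod (I \<tau>)) / \<tau>) \<longlongrightarrow> support_fun D \<omega>) at_top \<and>
    ((\<lambda>\<tau>. I' \<tau> / I \<tau>) \<longlongrightarrow>
       of_real (support_fun D \<omega>) + \<i> * of_real (contact_point D \<omega> \<bullet> \<theta>)) at_top \<and>
    (\<forall>t. (t \<ge> support_fun D \<omega> \<longrightarrow> ((\<lambda>\<tau>. exp (- \<tau> * t) * cmod (I \<tau>)) \<longlongrightarrow> 0) at_top) \<and>
         (t < support_fun D \<omega> \<longrightarrow> filterlim (\<lambda>\<tau>. exp (- \<tau> * t) * cmod (I \<tau>)) at_top at_top))"
proof -
  have \<Omega>: "C2_domain \<Omega> S" using assms(1,3,4,11) by (intro C2_domain.intro)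
  interpret C2_domain \<Omega> S by (rule \<Omega>)
  have D\<Omega>: "D \<subseteq> \<Omega>" using assms(8) closure_subset by blast
  have bD: "bounded D" using assms(3) D\<Omega> by (rule bounded_subset)
  have setsD: "D \<in> sets lebesgue" using assms(6) by auto
  have "finite_measure (lebesgue_on D)"
    using setsD emeasure_bounded_finite[OF bD] assms(6)
    by (intro finite_measureI) (auto simp: space_restrict_space emeasure_restrict_space)
  from L2_imp_integrable_norm[OF this assms(9)] have \<rho>: "integrable (lebesgue_on D) \<rho>"
    using assms(9) integrable_norm_iff[of \<rho> "lebesgue_on D"] by (simp add: L2_def)
  have u: "L2 (lebesgue_on \<Omega>) u" and Du: "L2 (lebesgue_on \<Omega>) Du"
    using assms(10) by (auto simp: weak_solution_def H1_def)
  define p where "p = contact_point D \<omega>"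
  note ex = contact_point_exposed[OF assms(13,14,7) bD assms(17), folded p_def]
  have tet: "locally_tetrahedral_at D p" and act: "source_active_at \<rho> D p"
    using assms(15)[OF ex(3)] by auto
  obtain L \<delta> c \<rho>' where ct: "cone_tip D p L \<delta> c \<omega> \<rho> \<rho>'" and nz: "\<rho>' p \<noteq> 0"
    using cone_tip_exists[OF assms(6) bD \<rho> tet act ex(4)] by blast
  interpret cone_tip D p L \<delta> c \<omega> \<theta> k \<rho> \<rho>' by (rule ct)
  have tip: "tip_constant \<noteq> 0"
    unfolding tip_constant_def using nz c_pos E_nz by simp
  let ?v = "exp_solution k \<omega> \<theta>"
  obtain R where R: "R > 0" "\<And>x. x \<in> D \<Longrightarrow> norm x \<le> R"
    using bD unfolding bounded_pos by blast
  define r where "r \<tau> = \<tau> / sqrt (\<tau>\<^sup>2 + k\<^sup>2)" for \<tau>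
  have r1: "\<bar>r \<tau>\<bar> \<le> 1" for \<tau>
  proof -
    have "\<bar>\<tau>\<bar> \<le> sqrt (\<tau>\<^sup>2 + k\<^sup>2)" by (rule real_le_rsqrt) simp
    then have "\<bar>\<tau>\<bar> / sqrt (\<tau>\<^sup>2 + k\<^sup>2) \<le> sqrt (\<tau>\<^sup>2 + k\<^sup>2) / sqrt (\<tau>\<^sup>2 + k\<^sup>2)"
      by (intro divide_right_mono) auto
    \<comment> \<open>Only an inequality holds in general: for \<open>\<tau> = k = 0\<close> the
      root is 0 and the quotient takes the default value 0.\<close>
    also have "\<dots> \<le> 1" by (simp only: divide_self_if) simp
    finally show ?thesis by (simp add: r_def abs_divide)
  qed
  have rlim: "(r \<longlongrightarrow> 1) at_top"
  proof -
    have "((\<lambda>\<tau>. inverse (sqrt (\<tau>\<^sup>2 + k\<^sup>2) / \<tau>)) \<longlongrightarrow> inverse 1) at_top"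
      by (intro tendsto_inverse tendsto_sqrt_ratio) simp
    then show ?thesis by (simp add: r_def[abs_def])
  qed
  define P1 where "P1 \<tau> x = of_real (x \<bullet> \<omega>) + \<i> * of_real (r \<tau> * (x \<bullet> \<theta>))" for \<tau> and x :: "real^3"
  have P1c: "continuous_on UNIV (P1 \<tau>)" for \<tau>
    unfolding P1_def[abs_def] by (intro continuous_intros)
  have P1b: "norm (P1 \<tau> x) \<le> 2 * R" if "x \<in> D" for \<tau> x
  proof -
    have "\<bar>x \<bullet> \<omega>\<bar> \<le> R" "\<bar>x \<bullet> \<theta>\<bar> \<le> R"
      using Cauchy_Schwarz_ineq2[of x \<omega>] Cauchy_Schwarz_ineq2[of x \<theta>] R(2)[OF that] assms(16,18) by auto
    moreover have "\<bar>r \<tau> * (x \<bullet> \<theta>)\<bar> \<le> 1 * \<bar>x \<bullet> \<theta>\<bar>"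
      unfolding abs_mult using r1[of \<tau>] by (intro mult_right_mono) auto
    moreover have "norm (P1 \<tau> x) \<le> \<bar>x \<bullet> \<omega>\<bar> + \<bar>r \<tau> * (x \<bullet> \<theta>)\<bar>"
      unfolding P1_def by (rule order_trans[OF norm_triangle_ineq]) (simp add: norm_mult)
    ultimately show ?thesis by linarith
  qed
  have P1l: "((\<lambda>\<tau>. P1 \<tau> (p + y /\<^sub>R \<tau>)) \<longlongrightarrow> of_real (p \<bullet> \<omega>) + \<i> * of_real (p \<bullet> \<theta>)) at_top" for y
  proof -
    have x: "((\<lambda>\<tau>. p + y /\<^sub>R \<tau>) \<longlongrightarrow> p + 0 *\<^sub>R y) at_top"
      by (intro tendsto_intros tendsto_inverse_0_at_top[OF filterlim_ident])
    have "((\<lambda>\<tau>. P1 \<tau> (p + y /\<^sub>R \<tau>)) \<longlongrightarrow> of_real ((p + 0 *\<^sub>R y) \<bullet> \<omega>) + \<i> * of_real (1 * ((p + 0 *\<^sub>R y) \<bullet> \<theta>))) at_top"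
      unfolding P1_def by (intro tendsto_add tendsto_mult tendsto_const tendsto_of_real tendsto_inner rlim x)
    then show ?thesis by simp
  qed
  have As0: "((\<lambda>\<tau>. of_real (\<tau>^3) * (\<integral>x. \<rho> x * (1 * ?v \<tau> x) \<partial>lebesgue_on D) / ?v \<tau> p) \<longlongrightarrow> 1 * tip_constant) at_top"
    by (rule cone_asymptotics[where M = 1]) auto
  have As1: "((\<lambda>\<tau>. of_real (\<tau>^3) * (\<integral>x. \<rho> x * (P1 \<tau> x * ?v \<tau> x) \<partial>lebesgue_on D) / ?v \<tau> p)
     \<longlongrightarrow> (of_real (p \<bullet> \<omega>) + \<i> * of_real (p \<bullet> \<theta>)) * tip_constant) at_top"
    using R(1) by (intro cone_asymptotics[where M = "2 * R"] P1c P1b P1l) auto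
  have zz: "cdot (phase \<omega> \<theta> \<tau> (sqrt (\<tau>\<^sup>2 + k\<^sup>2))) (phase \<omega> \<theta> \<tau> (sqrt (\<tau>\<^sup>2 + k\<^sup>2))) = - of_real (k\<^sup>2)" for \<tau>
    unfolding cdot_phase[OF assms(16,18,19)] by (simp add: power2_eq_square[symmetric])
  have Ieq: "I \<tau> = (\<integral>x. \<rho> x * (1 * ?v \<tau> x) \<partial>lebesgue_on D)" if "\<tau> \<ge> 1" for \<tau>
  proof -
    have "integrable (lebesgue_on D) (\<lambda>x. \<rho> x * (1 * ?v \<tau> x))"
      by (rule integrable_integrand[where P = "\<lambda>\<tau> x. 1" and P\<^sub>0 = 1 and M = 1]) (use that in auto)
    then have "integrable (lebesgue_on D) (\<lambda>x. \<rho> x * ?v \<tau> x)" by simp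
    note si = source_integral[OF setsD D\<Omega> sets_\<Omega>(2) this]
    show ?thesis
      unfolding I_def exp_solution_eq_poly_exp(1)
      using boundary_indicator_poly_exp[OF u Du assms(12) zz _ si(1)[unfolded exp_solution_eq_poly_exp(1)]] si(2)
      by (simp add: exp_solution_eq_poly_exp(1) cdot_def)
  qed
  have vd: "exp_solution_deriv k \<omega> \<theta> \<tau> x = P1 \<tau> x * ?v \<tau> x" for \<tau> x
    by (simp add: exp_solution_deriv_def P1_def r_def)
  have I'eq: "I' \<tau> = (\<integral>x. \<rho> x * (P1 \<tau> x * ?v \<tau> x) \<partial>lebesgue_on D)" if "\<tau> \<ge> 1" for \<tau>
  proof -
    have "integrable (lebesgue_on D) (\<lambda>x. \<rho> x * (P1 \<tau> x * ?v \<tau> x))"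
      by (rule integrable_integrand[where M = "2 * R"]) (use that P1c P1b P1l R in auto)
    then have "integrable (lebesgue_on D) (\<lambda>x. \<rho> x * exp_solution_deriv k \<omega> \<theta> \<tau> x)" by (simp add: vd)
    note si = source_integral[OF setsD D\<Omega> sets_\<Omega>(2) this]
    \<comment> \<open>The product of the two wave vectors is \<open>\<tau>\<close> minus
      \<open>\<tau>\<close> divided and multiplied by this root, which is zero once the root is
      nonzero.\<close>
    have "sqrt (\<tau>\<^sup>2 + k\<^sup>2) \<noteq> 0" using that by (simp add: add_nonneg_eq_0_iff)
    then have az: "cdot (phase \<omega> \<theta> 1 (\<tau> / sqrt (\<tau>\<^sup>2 + k\<^sup>2))) (phase \<omega> \<theta> \<tau> (sqrt (\<tau>\<^sup>2 + k\<^sup>2))) = 0"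
      unfolding cdot_phase[OF assms(16,18,19)] by simp
    have "I' \<tau> = (\<integral>x. source \<rho> D x * exp_solution_deriv k \<omega> \<theta> \<tau> x \<partial>lebesgue_on \<Omega>)"
      unfolding I'_def exp_solution_eq_poly_exp(2)
      by (rule boundary_indicator_poly_exp[OF u Du assms(12) zz az si(1)[unfolded exp_solution_eq_poly_exp(2)]])
    then show ?thesis using si(2) by (simp add: vd)
  qed
  have V: "norm (?v \<tau> p) = exp (\<tau> * support_fun D \<omega>)" for \<tau>
    unfolding norm_v ex(2) ..
  \<comment> \<open>The volume formulas are available for \<open>\<tau> \<ge> 1\<close>, which is
    enough for limits at infinity.\<close>
  have A: "((\<lambda>\<tau>. of_real (\<tau>^3) * I \<tau> / ?v \<tau> p) \<longlongrightarrow> tip_constant) at_top"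
  proof (rule Lim_transform_eventually)
    show "\<forall>\<^sub>F \<tau> in at_top. of_real (\<tau>^3) * (\<integral>x. \<rho> x * (1 * ?v \<tau> x) \<partial>lebesgue_on D) / ?v \<tau> p = of_real (\<tau>^3) * I \<tau> / ?v \<tau> p"
      using eventually_ge_at_top[of 1] by eventually_elim (simp only: Ieq)
  qed (use As0 in simp)
  have A': "((\<lambda>\<tau>. of_real (\<tau>^3) * I' \<tau> / ?v \<tau> p) \<longlongrightarrow>
      (of_real (support_fun D \<omega>) + \<i> * of_real (p \<bullet> \<theta>)) * tip_constant) at_top"
  proof (rule Lim_transform_eventually)
    show "\<forall>\<^sub>F \<tau> in at_top. of_real (\<tau>^3) * (\<integral>x. \<rho> x * (P1 \<tau> x * ?v \<tau> x) \<partial>lebesgue_on D) / ?v \<tau> p = of_real (\<tau>^3) * I' \<tau> / ?v \<tau> p"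
      using eventually_ge_at_top[of 1] by eventually_elim (simp only: I'eq)
  qed (use As1 in \<open>simp only: ex(2)\<close>)
  note C = asymptotic_consequences[OF V A tip A']
  show ?thesis
    using C(1,2,3,4,5) unfolding p_def by blast
qed

end
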